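(* For each ordinal $1\leq \alpha<\omega_1$ there exist a Stone space (a compact Hausdorff zero-dimensional space) $K^{(\alpha)}$ and a Borel probability measure $\mu^{(\alpha)}$ on $K^{(\alpha)}$ such that (1) $\mu^{(\alpha)}\in S_\alpha(K^{(\alpha)})\setminus \bigcup_{\beta<\alpha} S_\beta(K^{(\alpha)})$, and (2) $S(K^{(\alpha)}) = S_{\alpha+1}(K^{(\alpha)})$.
   Context: For a compact Hausdorff space $K$, $P(K)$ denotes the set of (Radon) Borel probability measures on $K$ with the weak$^*$ topology (as functionals on $C(K)$), so $\mu_n\to\mu$ iff $\int f\,d\mu_n\to\int f\,d\mu$ for every $f\in C(K)$. For $A\subseteq K$, let $S_0(A)=\mathrm{conv}\{\delta_x : x\in A\}$, the set of finitely supported probability measures with support in $A$ ($\delta_x$ the Dirac measure at $x$). For an ordinal $0<\alpha\leq\omega_1$, recursively let $S_\alpha(A)$ be the set of all weak$^*$ limits in $P(K)$ of convergent sequences $(\mu_n)_{n\in\omega}$ such that for every $n$ there is $\beta<\alpha$ with $\mu_n\in S_\beta(A)$. Let $S(A)=S_{\omega_1}(A)$. *)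

theory Defs
  imports "HOL-Probability.Probability"
begin

section \<open>Ordinals\<close>

text \<open>
  The type \<open>ordinal\<close> is a copy of the initial ordinal \<open>\<omega>\<^sub>2\<close>, i.e. it consists of
  the ordinals below \<open>\<omega>\<^sub>2\<close>. This is merely a well-order long enough to contain all ordinals
  \<open>\<alpha> \<le> \<omega>\<^sub>1\<close>, so that the levels \<open>\<alpha> < \<omega>\<^sub>1\<close> and the level \<open>\<omega>\<^sub>1\<close> are treated
  uniformly.
\<close>

abbreviation omega2_rel :: "nat set set rel" where
  "omega2_rel \<equiv> cardSuc (cardSuc natLeq)"

lemma Card_order_omega2_rel: "Card_order omega2_rel"
  by (intro cardSuc_Card_order natLeq_Card_order)

lemma infinite_Field_omega2_rel: "infinite (Field omega2_rel)"
  by (metis cardSuc_finite cardSuc_Card_order natLeq_Card_order Field_natLeq infinite_UNIV_nat)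

typedef ordinal = "Field omega2_rel"
  using infinite_Field_omega2_rel by (metis finite.emptyI ex_in_conv)

lemma Linear_order_omega2_rel: "Linear_order omega2_rel"
  and wf_omega2_rel: "wf (omega2_rel - Id)"
  using Card_order_omega2_rel by (simp_all add: card_order_on_def well_order_on_def)

instantiation ordinal :: linorder
begin

definition less_eq_ordinal :: "ordinal \<Rightarrow> ordinal \<Rightarrow> bool" where
  "a \<le> b \<longleftrightarrow> (Rep_ordinal a, Rep_ordinal b) \<in> omega2_rel"

definition less_ordinal :: "ordinal \<Rightarrow> ordinal \<Rightarrow> bool" where
  "a < b \<longleftrightarrow> a \<le> b \<and> a \<noteq> (b :: ordinal)"

instance
proof
  have refl: "Refl omega2_rel" and tr: "trans omega2_rel" and an: "antisym omega2_rel"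
    and tot: "Total omega2_rel"
    using Linear_order_omega2_rel by (auto simp: order_on_defs)
  fix a b c :: ordinal
  show refl': "a \<le> a"
    using refl Rep_ordinal by (auto simp: less_eq_ordinal_def refl_on_def)
  show "a \<le> c" if "a \<le> b" "b \<le> c"
    using that tr by (auto simp: less_eq_ordinal_def dest: transD)
  show an': "a = b" if "a \<le> b" "b \<le> a"
    using that an by (auto simp: less_eq_ordinal_def Rep_ordinal_inject[symmetric] dest: antisymD)
  show "(a < b) = (a \<le> b \<and> \<not> b \<le> a)"
    using refl' an' by (auto simp: less_ordinal_def)
  show "a \<le> b \<or> b \<le> a"
    using tot Rep_ordinal refl' unfolding less_eq_ordinal_def total_on_def
    by (metis Rep_ordinal_inject)
qed

end

instance ordinal :: wellorder
proof (rule wf_wellorderI)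
  have "{(a, b). a < b} \<subseteq> inv_image (omega2_rel - Id) Rep_ordinal"
    by (auto simp: less_ordinal_def less_eq_ordinal_def Rep_ordinal_inject)
  then show "wf {(a, b :: ordinal). a < b}"
    using wf_omega2_rel wf_inv_image wf_subset by blast
qed intro_classes

text \<open>The successor ordinal \<open>a + 1\<close>.\<close>

definition osuc :: "ordinal \<Rightarrow> ordinal" where
  "osuc a = (LEAST b. a < b)"

instantiation ordinal :: "{zero, one}"
begin

definition zero_ordinal :: ordinal where
  "0 = (LEAST a :: ordinal. True)"

definition one_ordinal :: ordinal where
  "1 = osuc 0"

instance ..

end

definition omega1 :: ordinal where
  "omega1 = (LEAST a. uncountable {..<a})"

lemma zero_le_ordinal: "0 \<le> (a :: ordinal)"
  unfolding zero_ordinal_def by (rule Least_le) simp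

lemma ordinal_no_top: "\<exists>b :: ordinal. a < b"
proof -
  obtain y where "y \<in> Field omega2_rel" "Rep_ordinal a \<noteq> y" "(Rep_ordinal a, y) \<in> omega2_rel"
    using infinite_Card_order_limit[OF Card_order_omega2_rel infinite_Field_omega2_rel]
      Rep_ordinal by blast
  then have "a < Abs_ordinal y"
    by (auto simp: less_ordinal_def less_eq_ordinal_def Abs_ordinal_inverse)
  then show ?thesis ..
qed

lemma less_osuc: "a < osuc a"
  unfolding osuc_def using ordinal_no_top by (rule LeastI_ex)

lemma osuc_le_iff: "osuc a \<le> b \<longleftrightarrow> a < b"
  by (metis Least_le less_osuc less_le_trans osuc_def)

lemma less_osuc_iff: "b < osuc a \<longleftrightarrow> b \<le> a"
  by (metis osuc_le_iff not_less)

lemma one_le_ordinal_iff: "1 \<le> (a :: ordinal) \<longleftrightarrow> 0 < a"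
  by (simp add: one_ordinal_def osuc_le_iff)

lemma ex_uncountable_lessThan_ordinal: "\<exists>a :: ordinal. uncountable {..<a}"
proof -
  include cardinal_syntax
  have C: "Card_order (cardSuc natLeq)"
    by (intro cardSuc_Card_order natLeq_Card_order)
  have "cardSuc natLeq <o omega2_rel"
    by (rule cardSuc_greater[OF C])
  then obtain y where y: "y \<in> Field omega2_rel"
    and iso: "cardSuc natLeq =o Restr omega2_rel (underS omega2_rel y)"
    using ordLess_iff_ordIso_Restr[of omega2_rel "cardSuc natLeq"] C Card_order_omega2_rel
    by (auto simp: card_order_on_def)
  have le: "cardSuc natLeq \<le>o |underS omega2_rel y|"
  proof -
    have "|Field (cardSuc natLeq)| \<le>o |Field (Restr omega2_rel (underS omega2_rel y))|"
      using iso by (intro ordIso_imp_ordLeq card_of_cong)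
    also have "|Field (Restr omega2_rel (underS omega2_rel y))| \<le>o |underS omega2_rel y|"
      by (intro card_of_mono1) (auto simp: Field_def)
    finally show ?thesis
      using C by (meson Card_order_iff_ordLeq_card_of ordLeq_transitive)
  qed
  have "uncountable {..<Abs_ordinal y}"
  proof
    assume "countable {..<Abs_ordinal y}"
    then have "countable (Rep_ordinal ` {..<Abs_ordinal y})"
      by blast
    moreover have "underS omega2_rel y \<subseteq> Rep_ordinal ` {..<Abs_ordinal y}"
    proof
      fix x assume x: "x \<in> underS omega2_rel y"
      then have xF: "x \<in> Field omega2_rel"
        by (auto simp: underS_def Field_def)
      then have "Abs_ordinal x < Abs_ordinal y"
        using x y by (auto simp: less_ordinal_def less_eq_ordinal_def Abs_ordinal_inverse
            Abs_ordinal_inject underS_def)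
      then show "x \<in> Rep_ordinal ` {..<Abs_ordinal y}"
        using xF by (metis Abs_ordinal_inverse imageI lessThan_iff)
    qed
    ultimately have "countable (underS omega2_rel y)"
      using countable_subset by blast
    then have "|underS omega2_rel y| \<le>o |UNIV :: nat set|"
      by (auto simp: countable_def card_of_ordLeq[symmetric])
    then have "|underS omega2_rel y| \<le>o natLeq"
      using card_of_nat ordLeq_ordIso_trans by blast
    then have "cardSuc natLeq \<le>o natLeq"
      using le ordLeq_transitive by blast
    then show False
      using cardSuc_greater[OF natLeq_Card_order] not_ordLess_ordLeq by blast
  qed
  then show ?thesis ..
qed

lemma uncountable_lessThan_omega1: "uncountable {..<omega1}"
  unfolding omega1_def using ex_uncountable_lessThan_ordinal by (rule LeastI_ex)

lemma less_omega1_iff: "a < omega1 \<longleftrightarrow> countable {..<a}"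
proof
  show "countable {..<a}" if "a < omega1"
    using that not_less_Least unfolding omega1_def by blast
  show "a < omega1" if "countable {..<a}"
  proof (rule ccontr)
    assume "\<not> a < omega1"
    then have "{..<omega1} \<subseteq> {..<a}"
      by auto
    then show False
      using that uncountable_lessThan_omega1 countable_subset by blast
  qed
qed


section \<open>Radon probability measures and the weak* topology\<close>

definition stone_space :: "'a topology \<Rightarrow> bool" where
  "stone_space K \<longleftrightarrow> compact_space K \<and> Hausdorff_space K \<and>
     (\<forall>U x. openin K U \<and> x \<in> U \<longrightarrow> (\<exists>V. openin K V \<and> closedin K V \<and> x \<in> V \<and> V \<subseteq> U))"

text \<open>
  The library's \<^const>\<open>borel\<close> lives on a type of class \<^class>\<open>topological_space\<close>; the
  following is its counterpart for a topological space with a carrier. It only serves as a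
  measurable space (the measure itself is zero).
\<close>

definition borel_on :: "'a topology \<Rightarrow> 'a measure" where
  "borel_on K = sigma (topspace K) {U. openin K U}"

lemma space_borel_on [simp]: "space (borel_on K) = topspace K"
  and sets_borel_on: "sets (borel_on K) = sigma_sets (topspace K) {U. openin K U}"
  using openin_subset unfolding borel_on_def
  by (auto intro!: space_measure_of sets_measure_of)

definition radon_prob :: "'a topology \<Rightarrow> 'a measure set" where
  "radon_prob K = {\<mu>. sets \<mu> = sets (borel_on K) \<and> prob_space \<mu> \<and>
     (\<forall>B \<in> sets \<mu>. emeasure \<mu> B = (SUP C \<in> {C. compactin K C \<and> C \<subseteq> B}. emeasure \<mu> C))}"

definition cont_funs :: "'a topology \<Rightarrow> ('a \<Rightarrow> real) set" where
  "cont_funs K = {f. continuous_map K euclideanreal f}"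

text \<open>
  The topology on \<^term>\<open>radon_prob K\<close> induced by embedding it, via integration, into the
  product of copies of the real line indexed by the continuous functions on \<^term>\<open>K\<close>.
\<close>

definition weak_star :: "'a topology \<Rightarrow> 'a measure topology" where
  "weak_star K = pullback_topology (radon_prob K)
     (\<lambda>\<mu>. \<lambda>f \<in> cont_funs K. \<integral>x. f x \<partial>\<mu>) (product_topology (\<lambda>_. euclideanreal) (cont_funs K))"

lemma topspace_weak_star [simp]: "topspace (weak_star K) = radon_prob K"
  by (auto simp: weak_star_def topspace_pullback_topology)

lemma limitin_weak_star_iff:
  assumes "\<And>n. \<mu> n \<in> radon_prob K" "\<nu> \<in> radon_prob K"
  shows "limitin (weak_star K) \<mu> \<nu> sequentially \<longleftrightarrow>
    (\<forall>f. continuous_map K euclideanreal f \<longrightarrow> (\<lambda>n. \<integral>x. f x \<partial>\<mu> n) \<longlonglongrightarrow> (\<integral>x. f x \<partial>\<nu>))"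
    (is "?L \<longleftrightarrow> ?R")
proof -
  let ?I = "\<lambda>\<mu>. \<lambda>f \<in> cont_funs K. \<integral>x. f x \<partial>\<mu>"
  let ?P = "product_topology (\<lambda>_. euclideanreal) (cont_funs K)"
  have "?L \<longleftrightarrow> limitin ?P (\<lambda>n. ?I (\<mu> n)) (?I \<nu>) sequentially"
  proof
    assume L: ?L
    have "continuous_map (weak_star K) ?P (id \<circ> ?I)"
      unfolding weak_star_def by (rule continuous_map_pullback) simp
    from continuous_map_limit[OF this[simplified] L]
    show "limitin ?P (\<lambda>n. ?I (\<mu> n)) (?I \<nu>) sequentially"
      by (simp add: o_def)
  next
    assume R: "limitin ?P (\<lambda>n. ?I (\<mu> n)) (?I \<nu>) sequentially"
    show ?L
      unfolding limitin_def topspace_weak_star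
    proof (intro conjI allI impI assms)
      fix U assume U: "openin (weak_star K) U \<and> \<nu> \<in> U"
      then obtain V where V: "openin ?P V" "U = ?I -` V \<inter> radon_prob K"
        by (auto simp: weak_star_def openin_pullback_topology)
      with U R have "\<forall>\<^sub>F n in sequentially. ?I (\<mu> n) \<in> V"
        by (auto simp: limitin_def)
      then show "\<forall>\<^sub>F n in sequentially. \<mu> n \<in> U"
        by eventually_elim (use V assms in auto)
    qed
  qed
  also have "\<dots> \<longleftrightarrow> ?R"
    by (auto simp: limitin_componentwise cont_funs_def)
  finally show ?thesis .
qed


section \<open>The sequential hierarchy over the finitely supported measures\<close>

text \<open>
  Convex combinations of Dirac measures \<^term>\<open>return (borel_on K) x\<close>. Measures do not form a
  vector space in the library, hence the combination is written out on measurable sets.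
\<close>

definition conv_dirac :: "'a topology \<Rightarrow> 'a set \<Rightarrow> 'a measure set" where
  "conv_dirac K A = {\<mu> \<in> radon_prob K. \<exists>F w. finite F \<and> F \<subseteq> A \<and> (\<forall>x \<in> F. 0 \<le> w x) \<and> sum w F = 1 \<and>
     (\<forall>B \<in> sets (borel_on K). measure \<mu> B = (\<Sum>x\<in>F. w x * measure (return (borel_on K) x) B))}"

function seq_level :: "'a topology \<Rightarrow> 'a set \<Rightarrow> ordinal \<Rightarrow> 'a measure set" where
  "seq_level K A \<alpha> = (if \<alpha> = 0 then conv_dirac K A
     else {\<mu>. \<exists>m. (\<forall>n :: nat. \<exists>\<beta> \<in> {..<\<alpha>}. m n \<in> seq_level K A \<beta>) \<and>
                  limitin (weak_star K) m \<mu> sequentially})"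
  by auto
termination
  by (relation "inv_image {(\<alpha>, \<beta>). \<alpha> < \<beta>} (\<lambda>(K, A, \<alpha>). \<alpha>)") (auto intro!: wf_inv_image wf)

declare seq_level.simps [simp del]

definition seq_closure :: "'a topology \<Rightarrow> 'a set \<Rightarrow> 'a measure set" where
  "seq_closure K A = seq_level K A omega1"

lemma conv_dirac_subset: "conv_dirac K A \<subseteq> radon_prob K"
  by (auto simp: conv_dirac_def)

lemma seq_level_0: "seq_level K A 0 = conv_dirac K A"
  by (simp add: seq_level.simps)

lemma seq_level_pos:
  "0 < \<alpha> \<Longrightarrow> seq_level K A \<alpha> = {\<mu>. \<exists>m. (\<forall>n :: nat. \<exists>\<beta><\<alpha>. m n \<in> seq_level K A \<beta>) \<and>
     limitin (weak_star K) m \<mu> sequentially}"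
  by (auto simp: seq_level.simps[of K A \<alpha>] Bex_def)

lemma seq_level_subset: "seq_level K A \<alpha> \<subseteq> radon_prob K"
proof (cases "\<alpha> = 0")
  case True
  then show ?thesis by (simp add: seq_level_0 conv_dirac_subset)
next
  case False
  then have "0 < \<alpha>" using zero_le_ordinal[of \<alpha>] by simp
  then show ?thesis by (auto simp: seq_level_pos dest: limitin_topspace)
qed

end

theory Submission
  imports Defs
begin

text \<open>
  Stone duality turns the problem into one about finitely additive measures. If \<open>K\<close> is the space of
  ultrafilters of a field \<open>M\<close> of sets, then a Radon probability measure on \<open>K\<close> restricts to a charge
  (a nonnegative finitely additive function) on \<open>M\<close>, each charge of total mass 1 arises in this way,
  and weak* convergence is pointwise convergence on \<open>M\<close>. So the levels \<open>S\<^sub>\<alpha>\<close> become a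
  hierarchy of charges: level 0 consists of the finite combinations of ultrafilters, and a higher
  level of the pointwise limits of sequences from lower levels (\<open>seq_level_iff_lev\<close>).

  The field for \<open>\<alpha>\<close> is built by well-founded recursion. Choose a nondecreasing sequence
  \<open>\<alpha>\<^sub>n < \<alpha>\<close> with supremum of \<open>\<alpha>\<^sub>n + 1\<close> equal to \<open>\<alpha>\<close>, and fields \<open>M\<^sub>n\<close> with charges
  \<open>\<mu>\<^sub>n\<close> of exact level \<open>\<alpha>\<^sub>n\<close> (uniform charges on finite sets where \<open>\<alpha>\<^sub>n = 0\<close>). The points of all
  these fields carry labels, infinite bit sequences for which each bit behaves like a fair coin.
  A sequence \<open>(A\<^sub>n)\<close> with \<open>A\<^sub>n \<in> M\<^sub>n\<close> belongs to the new field if for each \<open>\<epsilon>\<close> one and the same condition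
  on finitely many bits describes \<open>A\<^sub>n\<close> up to an error less than \<open>\<epsilon>\<close> in \<open>\<mu>\<^sub>n\<close>, for all large \<open>n\<close>. On
  such sequences \<open>\<mu>(A) = lim \<mu>\<^sub>n(A\<^sub>n)\<close> exists, and \<open>\<mu>\<close> has level at most \<open>\<alpha>\<close>. Modulo the ideal of
  sequences with limit 0 the field is the measure algebra of coin tossing. The proof uses this in the
  following form: the field is closed under countable unions that recede to infinity with summable
  measures (\<open>receding_UN\<close>), and this weak form of \<open>\<sigma>\<close>-completeness drives both bounds.

  Lower bound: each charge \<open>\<nu>\<close> of level below \<open>\<alpha>\<close> is singular to \<open>\<mu>\<close>, so \<open>\<mu>\<close> is not one of them. A finite
  combination of ultrafilters is singular to \<open>\<mu>\<close> because the label cells get small. If \<open>\<nu>\<close> is the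
  limit of charges \<open>\<nu>\<^sub>k\<close> that are singular to \<open>\<mu>\<close>, and whose restrictions to all late factors are
  singular to \<open>\<mu>\<^sub>n\<close> by induction, then small sets that nearly carry the \<open>\<nu>\<^sub>k\<close> can be united to a single
  small set that nearly carries \<open>\<nu>\<close> (\<open>lower_level_singular\<close>).

  Upper bound: let \<open>N\<close> be the closure of level \<open>\<alpha>\<close> under uniform limits; it is contained in level
  \<open>\<alpha> + 1\<close>. If a charge is absolutely continuous with respect to a member of \<open>N\<close>, then it is in \<open>N\<close>,
  by an elementary Radon-Nikodym approximation (\<open>ac_charge_density\<close>). And if \<open>\<nu>\<^sub>k \<longlongrightarrow> \<nu>\<close>, a gliding
  hump argument (\<open>gliding_hump\<close>) shows that \<open>\<nu>\<close> is absolutely continuous with respect to a sum of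
  small multiples of \<open>\<mu>\<close>, of the \<open>\<nu>\<^sub>k\<close>, and of the restrictions of \<open>\<nu>\<close> to the factors. Hence \<open>N\<close> contains
  all levels (\<open>lev_closure_all\<close>), and the hierarchy stops at \<open>\<alpha> + 1\<close>.
\<close>

section \<open>Charges on a field of sets\<close>

definition charge :: "'a set set \<Rightarrow> ('a set \<Rightarrow> real) \<Rightarrow> bool" where
  "charge M \<nu> \<longleftrightarrow> (\<forall>a\<in>M. 0 \<le> \<nu> a) \<and> (\<forall>a\<in>M. \<forall>b\<in>M. a \<inter> b = {} \<longrightarrow> \<nu> (a \<union> b) = \<nu> a + \<nu> b)"

lemma chargeI:
  assumes "\<And>a. a \<in> M \<Longrightarrow> 0 \<le> \<nu> a"
    and "\<And>a b. a \<in> M \<Longrightarrow> b \<in> M \<Longrightarrow> a \<inter> b = {} \<Longrightarrow> \<nu> (a \<union> b) = \<nu> a + \<nu> b"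
  shows "charge M \<nu>"
  using assms by (auto simp: charge_def)

lemma charge_nonneg: "charge M \<nu> \<Longrightarrow> a \<in> M \<Longrightarrow> 0 \<le> \<nu> a"
  by (simp add: charge_def)

lemma charge_Un: "charge M \<nu> \<Longrightarrow> a \<in> M \<Longrightarrow> b \<in> M \<Longrightarrow> a \<inter> b = {} \<Longrightarrow> \<nu> (a \<union> b) = \<nu> a + \<nu> b"
  by (simp add: charge_def)

lemma charge_cong: "charge M \<nu> \<Longrightarrow> (\<And>a. a \<in> M \<Longrightarrow> \<nu>' a = \<nu> a) \<Longrightarrow> algebra X M \<Longrightarrow> charge M \<nu>'"
  using ring_of_sets.Un[of X M] by (auto simp: charge_def algebra_def)

lemma charge_limit:
  assumes "algebra X M" "\<And>n::nat. charge M (m n)" "\<And>a. a \<in> M \<Longrightarrow> (\<lambda>n. m n a) \<longlonglongrightarrow> \<nu> a"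
  shows "charge M \<nu>"
proof (rule chargeI)
  interpret algebra X M by fact
  fix a assume a: "a \<in> M"
  show "0 \<le> \<nu> a"
    using assms(2) a by (intro LIMSEQ_le_const[OF assms(3)[OF a]]) (auto simp: charge_def)
  fix b assume b: "b \<in> M" "a \<inter> b = {}"
  have "(\<lambda>n. m n a + m n b) \<longlonglongrightarrow> \<nu> a + \<nu> b"
    using a b by (intro tendsto_add assms)
  moreover have "(\<lambda>n. m n a + m n b) = (\<lambda>n. m n (a \<union> b))"
    using charge_Un[OF assms(2)] a b by auto
  ultimately show "\<nu> (a \<union> b) = \<nu> a + \<nu> b"
    using assms(3)[of "a \<union> b"] a b LIMSEQ_unique by auto
qed

context algebra
begin

lemma charge_empty: "charge M \<nu> \<Longrightarrow> \<nu> {} = 0"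
  using charge_Un[of M \<nu> "{}" "{}"] by simp

lemma charge_Diff: "charge M \<nu> \<Longrightarrow> a \<in> M \<Longrightarrow> b \<in> M \<Longrightarrow> a \<subseteq> b \<Longrightarrow> \<nu> (b - a) = \<nu> b - \<nu> a"
  using charge_Un[of M \<nu> a "b - a"] Diff[of b a] by (auto simp: Un_absorb1)

lemma charge_split: "charge M \<nu> \<Longrightarrow> a \<in> M \<Longrightarrow> b \<in> M \<Longrightarrow> \<nu> b = \<nu> (b \<inter> a) + \<nu> (b - a)"
  using charge_Un[of M \<nu> "b \<inter> a" "b - a"] Diff[of b a] Int[of b a] by (auto simp: Int_Diff_Un)

lemma charge_mono: "charge M \<nu> \<Longrightarrow> a \<in> M \<Longrightarrow> b \<in> M \<Longrightarrow> a \<subseteq> b \<Longrightarrow> \<nu> a \<le> \<nu> b"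
  using charge_Diff[of \<nu> a b] charge_nonneg[of M \<nu> "b - a"] Diff[of b a] by auto

lemma charge_le_space: "charge M \<nu> \<Longrightarrow> a \<in> M \<Longrightarrow> \<nu> a \<le> \<nu> \<Omega>"
  by (rule charge_mono) (use sets_into_space in auto)

lemma charge_Un_le: "charge M \<nu> \<Longrightarrow> a \<in> M \<Longrightarrow> b \<in> M \<Longrightarrow> \<nu> (a \<union> b) \<le> \<nu> a + \<nu> b"
  using charge_Un[of M \<nu> a "b - a"] charge_mono[of \<nu> "b - a" b] Diff[of b a] by auto

lemma charge_UN_le:
  assumes "charge M \<nu>" "finite I" "\<And>i. i \<in> I \<Longrightarrow> f i \<in> M"
  shows "\<nu> (\<Union>i\<in>I. f i) \<le> (\<Sum>i\<in>I. \<nu> (f i))"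
  using assms(2,3)
proof (induction I rule: finite_induct)
  case empty
  then show ?case using charge_empty[OF assms(1)] by simp
next
  case (insert i I)
  then have "\<nu> (f i \<union> (\<Union>i\<in>I. f i)) \<le> \<nu> (f i) + \<nu> (\<Union>i\<in>I. f i)"
    by (intro charge_Un_le assms(1) finite_UN) auto
  with insert show ?case by auto
qed

lemma charge_UN_disjoint:
  assumes "charge M \<nu>" "finite I" "\<And>i. i \<in> I \<Longrightarrow> f i \<in> M" "disjoint_family_on f I"
  shows "\<nu> (\<Union>i\<in>I. f i) = (\<Sum>i\<in>I. \<nu> (f i))"
  using assms(2-)
proof (induction I rule: finite_induct)
  case empty
  then show ?case using charge_empty[OF assms(1)] by simp
next
  case (insert i I)
  then have "\<nu> (f i \<union> (\<Union>i\<in>I. f i)) = \<nu> (f i) + \<nu> (\<Union>i\<in>I. f i)"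
    by (intro charge_Un[of M] assms(1) finite_UN) (auto simp: disjoint_family_on_def)
  with insert show ?case by (auto simp: disjoint_family_on_def)
qed

lemma charge_add: "charge M \<nu> \<Longrightarrow> charge M \<nu>' \<Longrightarrow> charge M (\<lambda>a. \<nu> a + \<nu>' a)"
  by (auto simp: charge_def)

lemma charge_scale: "charge M \<nu> \<Longrightarrow> 0 \<le> c \<Longrightarrow> charge M (\<lambda>a. c * \<nu> a)"
  by (auto simp: charge_def algebra_simps)

text \<open>
  A charge is bounded, so along an increasing sequence of sets it converges: a finite stage
  captures all but little of what is still to come, although the union need not be in the field.
\<close>

lemma charge_incseq_tail:
  assumes \<nu>: "charge M \<nu>" and f: "\<And>k::nat. f k \<in> M" and inc: "incseq f" and \<epsilon>: "\<epsilon> > 0"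
  shows "\<exists>m\<ge>m0. \<forall>m'\<ge>m. \<nu> (f m' - f m) < \<epsilon>"
proof -
  have "incseq (\<lambda>m. \<nu> (f m))"
    by (rule incseq_SucI, rule charge_mono[OF \<nu> f f incseq_SucD[OF inc]])
  moreover have "\<nu> (f m) \<le> \<nu> \<Omega>" for m
    by (intro charge_le_space \<nu> f)
  ultimately have "convergent (\<lambda>m. \<nu> (f m))"
    using incseq_convergent convergentI by metis
  then have "Cauchy (\<lambda>m. \<nu> (f m))"
    by (simp add: Cauchy_convergent_iff)
  then obtain m1 where m1: "\<And>m m'. m \<ge> m1 \<Longrightarrow> m' \<ge> m1 \<Longrightarrow> \<bar>\<nu> (f m) - \<nu> (f m')\<bar> < \<epsilon>"
    using CauchyD[of "\<lambda>m. \<nu> (f m)" \<epsilon>] \<epsilon> by auto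
  show ?thesis
  proof (intro exI[of _ "max m0 m1"] conjI allI impI)
    fix m' assume m': "m' \<ge> max m0 m1"
    then have "f (max m0 m1) \<subseteq> f m'" by (intro monoD[OF inc]) auto
    then have "\<nu> (f m' - f (max m0 m1)) = \<nu> (f m') - \<nu> (f (max m0 m1))"
      by (intro charge_Diff \<nu> f)
    then show "\<nu> (f m' - f (max m0 m1)) < \<epsilon>"
      using m1[of m' "max m0 m1"] m' by auto
  qed simp
qed

end

section \<open>Absolute continuity and approximate densities\<close>

text \<open>
  The quantitative form. For charges it is strictly stronger than the requirement that null sets
  be null.
\<close>

definition ac_charge :: "'a set set \<Rightarrow> ('a set \<Rightarrow> real) \<Rightarrow> ('a set \<Rightarrow> real) \<Rightarrow> bool" where
  "ac_charge M \<nu> \<tau> \<longleftrightarrow> (\<forall>\<epsilon>>0. \<exists>\<delta>>0. \<forall>a\<in>M. \<tau> a < \<delta> \<longrightarrow> \<nu> a < \<epsilon>)"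

context algebra
begin

text \<open>
  Suppose \<open>\<tau>(E\<^sub>k) < 2\<^sup>-\<^sup>k\<close> while \<open>\<nu>(E\<^sub>k) \<ge> \<epsilon>\<close>. The sets \<open>E\<^sub>k \<union> E\<^sub>k\<^sub>+\<^sub>1 \<union> \<dots>\<close> would be the decreasing
  sequence that contradicts the assumption, but they are infinite unions. Finite pieces of them that
  are nearly \<open>\<nu>\<close>-full, intersected to make them decrease, do as well.
\<close>

lemma ac_charge_of_sequences:
  assumes \<nu>: "charge M \<nu>" and \<tau>: "charge M \<tau>"
    and seq: "\<And>g. (\<And>k::nat. g k \<in> M) \<Longrightarrow> decseq g \<Longrightarrow> (\<lambda>k. \<tau> (g k)) \<longlonglongrightarrow> 0 \<Longrightarrow> (\<lambda>k. \<nu> (g k)) \<longlonglongrightarrow> 0"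
  shows "ac_charge M \<nu> \<tau>"
  unfolding ac_charge_def
proof (rule ccontr)
  assume "\<not> (\<forall>\<epsilon>>0. \<exists>\<delta>>0. \<forall>a\<in>M. \<tau> a < \<delta> \<longrightarrow> \<nu> a < \<epsilon>)"
  then obtain \<epsilon> where \<epsilon>: "\<epsilon> > 0" and *: "\<And>\<delta>. \<delta> > 0 \<Longrightarrow> \<exists>a\<in>M. \<tau> a < \<delta> \<and> \<nu> a \<ge> \<epsilon>"
    by (metis not_le)
  have "\<exists>a. a \<in> M \<and> \<tau> a < (1/2)^k \<and> \<nu> a \<ge> \<epsilon>" for k :: nat
    using *[of "(1/2)^k"] by auto
  then obtain E where E: "\<And>k::nat. E k \<in> M" "\<And>k. \<tau> (E k) < (1/2)^k" "\<And>k. \<nu> (E k) \<ge> \<epsilon>"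
    by metis
  define G where "G k m = (\<Union>i\<in>{k..m}. E i)" for k m
  have G: "G k m \<in> M" for k m
    unfolding G_def using E by auto
  have "\<exists>m\<ge>k. \<forall>m'\<ge>m. \<nu> (G k m' - G k m) < \<epsilon> * (1/2)^(k+2)" for k
    by (rule charge_incseq_tail[OF \<nu> G]) (use \<epsilon> in \<open>force simp: incseq_def G_def\<close>)+
  then obtain m where mk: "\<And>k. m k \<ge> k"
    and m: "\<And>k m'. m' \<ge> m k \<Longrightarrow> \<nu> (G k m' - G k (m k)) < \<epsilon> * (1/2)^(k+2)"
    by metis
  define g where "g k = (\<Inter>i\<in>{..k}. G i (m i))" for k
  have gM: "g k \<in> M" for k
    unfolding g_def using G by (intro finite_INT) auto
  have dec: "decseq g"
    by (force simp: g_def decseq_def)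
  have sumhalf: "(\<Sum>i\<in>{k..n}. (1/2::real)^i) \<le> 2 * (1/2)^k" for k n
    by (simp add: sum_gp)
  have \<tau>g: "\<tau> (g k) \<le> 2 * (1/2)^k" for k
  proof -
    have "\<tau> (g k) \<le> \<tau> (G k (m k))"
      by (intro charge_mono \<tau> gM G) (auto simp: g_def)
    also have "\<dots> \<le> (\<Sum>i\<in>{k..m k}. \<tau> (E i))"
      unfolding G_def using E by (intro charge_UN_le \<tau>) auto
    also have "\<dots> \<le> (\<Sum>i\<in>{k..m k}. (1/2)^i)"
      using E(2) by (intro sum_mono) (simp add: less_imp_le)
    finally show ?thesis using sumhalf[of k "m k"] by linarith
  qed
  have half0: "(\<lambda>k. 2 * (1/2::real)^k) \<longlonglongrightarrow> 0"
    by (rule tendsto_mult_right_zero, rule LIMSEQ_realpow_zero) simp_all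
  have "norm (\<tau> (g k)) \<le> 2 * (1/2)^k" for k
    using \<tau>g[of k] charge_nonneg[OF \<tau> gM[of k]] by simp
  then have "(\<lambda>k. \<tau> (g k)) \<longlonglongrightarrow> 0"
    by (rule Lim_null_comparison[OF always_eventually[OF allI] half0])
  from seq[of g, OF gM dec this] have lim: "(\<lambda>k. \<nu> (g k)) \<longlonglongrightarrow> 0" .
  have "\<nu> (g k) \<ge> \<epsilon> / 2" for k
  proof -
    have sub: "E k \<subseteq> g k \<union> (\<Union>i\<in>{..k}. G i (Max (m ` {..k})) - G i (m i))"
    proof
      fix x assume x: "x \<in> E k"
      have "k \<le> Max (m ` {..k})"
        by (rule order_trans[OF mk[of k] Max_ge]) auto
      then have "x \<in> G i (Max (m ` {..k}))" if "i \<le> k" for i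
        using that x by (auto simp: G_def)
      then show "x \<in> g k \<union> (\<Union>i\<in>{..k}. G i (Max (m ` {..k})) - G i (m i))"
        by (auto simp: g_def)
    qed
    have "\<nu> (E k) \<le> \<nu> (g k \<union> (\<Union>i\<in>{..k}. G i (Max (m ` {..k})) - G i (m i)))"
      using sub by (intro charge_mono \<nu> E Un gM finite_UN Diff G) auto
    also have "\<dots> \<le> \<nu> (g k) + \<nu> (\<Union>i\<in>{..k}. G i (Max (m ` {..k})) - G i (m i))"
      by (intro charge_Un_le \<nu> gM finite_UN Diff G) auto
    also have "\<nu> (\<Union>i\<in>{..k}. G i (Max (m ` {..k})) - G i (m i)) \<le> (\<Sum>i\<in>{..k}. \<epsilon> * (1/2)^(i+2))"
    proof (rule order_trans)
      show "\<nu> (\<Union>i\<in>{..k}. G i (Max (m ` {..k})) - G i (m i)) \<le> (\<Sum>i\<in>{..k}. \<nu> (G i (Max (m ` {..k})) - G i (m i)))"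
        by (intro charge_UN_le \<nu> Diff G) auto
      show "\<dots> \<le> (\<Sum>i\<in>{..k}. \<epsilon> * (1/2)^(i+2))"
        by (intro sum_mono less_imp_le[OF m] Max_ge) auto
    qed
    also have "\<dots> = \<epsilon> / 4 * (\<Sum>i\<in>{0..k}. (1/2)^i)"
      by (simp add: sum_distrib_left atLeast0AtMost)
    also have "\<dots> \<le> \<epsilon> / 4 * 2"
      using sumhalf[of 0 k] \<epsilon> by (intro mult_left_mono) auto
    finally show ?thesis using E(3)[of k] by auto
  qed
  then have "\<epsilon> / 2 \<le> 0"
    by (intro LIMSEQ_le_const[OF lim]) auto
  then show False using \<epsilon> by simp
qed

text \<open>
  Finite partitions are lists, so that refining one produces empty or repeated parts without harm.
\<close>

definition refine :: "'a set list \<Rightarrow> 'a set \<Rightarrow> 'a set list" where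
  "refine \<pi> b = map (\<lambda>a. a \<inter> b) \<pi> @ map (\<lambda>a. a - b) \<pi>"

lemma charge_partition:
  assumes "set bs \<subseteq> M"
  shows "set (foldl refine [\<Omega>] bs) \<subseteq> M"
    and "charge M \<nu> \<Longrightarrow> b \<in> M \<Longrightarrow> (\<Sum>a\<leftarrow>foldl refine [\<Omega>] bs. \<nu> (a \<inter> b)) = \<nu> b"
  using assms
proof (induction bs rule: rev_induct)
  case Nil
  {
    case 1
    then show ?case by simp
  next
    case 2
    then show ?case using sets_into_space[of b] by (simp add: Int_absorb1 Int_absorb2)
  }
next
  case (snoc c bs)
  {
    case 1
    then show ?case using snoc.IH(1) by (auto simp: refine_def)
  next
    case 2
    let ?\<pi> = "foldl refine [\<Omega>] bs"
    have \<pi>: "set ?\<pi> \<subseteq> M" using 2 snoc.IH(1) by auto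
    have "(\<Sum>a\<leftarrow>refine ?\<pi> c. \<nu> (a \<inter> b)) = (\<Sum>a\<leftarrow>?\<pi>. \<nu> (a \<inter> c \<inter> b) + \<nu> ((a - c) \<inter> b))"
      by (simp add: refine_def o_def sum_list_addf)
    also have "\<dots> = (\<Sum>a\<leftarrow>?\<pi>. \<nu> (a \<inter> b))"
    proof (intro arg_cong[of _ _ sum_list] map_cong refl)
      fix a
      have eq: "a \<inter> c \<inter> b = a \<inter> b \<inter> c" "(a - c) \<inter> b = a \<inter> b - c" by auto
      assume "a \<in> set ?\<pi>"
      then have "\<nu> (a \<inter> b) = \<nu> (a \<inter> b \<inter> c) + \<nu> (a \<inter> b - c)"
        using \<pi> 2 by (intro charge_split) auto
      then show "\<nu> (a \<inter> c \<inter> b) + \<nu> ((a - c) \<inter> b) = \<nu> (a \<inter> b)"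
        unfolding eq by simp
    qed
    finally show ?case using snoc.IH(2) 2 by simp
  }
qed

text \<open>
  The energy of a partition is the sum of \<open>\<nu>(a)\<^sup>2/\<omega>(a)\<close> over its parts \<open>a\<close>: the squared norm of the
  conditional expectation of the density of \<open>\<nu>\<close>. Here one part is split into two, with \<open>\<nu>\<close>-masses
  \<open>x, y\<close> and \<open>\<omega>\<close>-masses \<open>u, v\<close>. The gain in energy is \<open>d\<^sup>2 (1/u + 1/v)\<close>, where \<open>d\<close> is the deviation on the
  left, and the linear bound follows by the inequality of the arithmetic and geometric means; unlike
  the Cauchy-Schwarz inequality it can be summed over the parts as it stands.
\<close>

lemma energy_gain:
  fixes x y u v t :: real
  assumes "0 \<le> x" "x \<le> u" "0 \<le> y" "y \<le> v" "t > 0"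
  shows "\<bar>x - (x + y) / (u + v) * u\<bar> \<le> (x\<^sup>2 / u + y\<^sup>2 / v - (x + y)\<^sup>2 / (u + v)) / (2 * t) + t * u / 2"
proof (cases "u = 0 \<or> v = 0")
  case True
  then show ?thesis using assms by (auto simp: power2_eq_square)
next
  case False
  then have uv: "u > 0" "v > 0" using assms by auto
  define d where "d = (x * v - y * u) / (u + v)"
  have d: "x - (x + y) / (u + v) * u = d"
    using uv by (simp add: d_def field_simps)
  have gain: "x\<^sup>2 / u + y\<^sup>2 / v - (x + y)\<^sup>2 / (u + v) = d\<^sup>2 * ((u + v) / (u * v))"
    using uv unfolding d_def by (simp add: divide_simps power2_eq_square) (simp add: algebra_simps)
  have "d\<^sup>2 / u \<le> d\<^sup>2 * ((u + v) / (u * v))"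
    using uv by (simp add: divide_simps) (simp add: algebra_simps mult_left_mono)
  then have "d\<^sup>2 / u / (2 * t) + t * u / 2 \<le> (x\<^sup>2 / u + y\<^sup>2 / v - (x + y)\<^sup>2 / (u + v)) / (2 * t) + t * u / 2"
    using assms(5) unfolding gain by (intro add_right_mono divide_right_mono) auto
  moreover have "\<bar>d\<bar> \<le> d\<^sup>2 / u / (2 * t) + t * u / 2"
  proof -
    have "0 \<le> (\<bar>d\<bar> - t * u)\<^sup>2" by simp
    then have "2 * (\<bar>d\<bar> * (t * u)) \<le> d\<^sup>2 + (t * u)\<^sup>2"
      by (simp add: power2_diff)
    then show ?thesis using uv assms(5)
      by (simp add: field_simps power2_eq_square)
  qed
  ultimately show ?thesis unfolding d by linarith
qed

text \<open>
  The energies of all finite partitions are bounded by the total mass. Take a partition whose energy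
  is almost maximal: refining it by any \<open>b\<close> gains almost nothing, so by the previous lemma the step
  function \<open>\<nu>(a)/\<omega>(a)\<close> on its parts is nearly a density of \<open>\<nu>\<close> on \<open>b\<close>. This is martingale convergence
  in the mean square, without a limit function.
\<close>

lemma charge_density_approx:
  assumes \<nu>: "charge M \<nu>" and \<omega>: "charge M \<omega>" and le: "\<And>a. a \<in> M \<Longrightarrow> \<nu> a \<le> \<omega> a" and \<epsilon>: "\<epsilon> > 0"
  shows "\<exists>bs. set bs \<subseteq> M \<and> (\<forall>b\<in>M. (\<Sum>a\<leftarrow>foldl refine [\<Omega>] bs. \<bar>\<nu> (a \<inter> b) - \<nu> a / \<omega> a * \<omega> (a \<inter> b)\<bar>) \<le> \<epsilon>)"
proof -
  let ?P = "\<lambda>bs. foldl refine [\<Omega>] bs"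
  define e where "e a = (\<nu> a)\<^sup>2 / \<omega> a" for a
  define EE where "EE \<pi> = (\<Sum>a\<leftarrow>\<pi>. e a)" for \<pi>
  have "EE (?P bs) \<le> \<nu> \<Omega>" if bs: "set bs \<subseteq> M" for bs
  proof -
    have "e a \<le> \<nu> (a \<inter> \<Omega>)" if "a \<in> set (?P bs)" for a
    proof -
      have a: "a \<in> M" using that charge_partition(1)[OF bs] by auto
      have 0: "0 \<le> \<nu> a" "\<nu> a \<le> \<omega> a" using a le charge_nonneg[OF \<nu>] by auto
      have "(\<nu> a)\<^sup>2 / \<omega> a \<le> \<nu> a"
        using 0 by (cases "\<omega> a = 0") (auto simp: divide_simps power2_eq_square mult_left_mono)
      then show ?thesis using a sets_into_space[of a] by (simp add: e_def Int_absorb2)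
    qed
    then have "EE (?P bs) \<le> (\<Sum>a\<leftarrow>?P bs. \<nu> (a \<inter> \<Omega>))"
      unfolding EE_def by (intro sum_list_mono) auto
    also have "\<dots> = \<nu> \<Omega>" using charge_partition(2)[OF bs \<nu>] by auto
    finally show ?thesis .
  qed
  then have bdd: "bdd_above ((\<lambda>bs. EE (?P bs)) ` {bs. set bs \<subseteq> M})"
    by (auto intro!: bdd_aboveI)
  define t where "t = \<epsilon> / (\<omega> \<Omega> + 1)"
  have \<omega>0: "\<omega> \<Omega> \<ge> 0" using charge_nonneg[OF \<omega>] by auto
  have t: "t > 0" using \<epsilon> \<omega>0 by (simp add: t_def)
  define s where "s = Sup ((\<lambda>bs. EE (?P bs)) ` {bs. set bs \<subseteq> M})"
  have "\<exists>y\<in>(\<lambda>bs. EE (?P bs)) ` {bs. set bs \<subseteq> M}. s - \<epsilon> * t < y"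
    unfolding s_def using \<epsilon> t by (intro less_cSupD) (auto intro: exI[of _ "[]"])
  then obtain bs where bs: "set bs \<subseteq> M" "s - \<epsilon> * t < EE (?P bs)" by auto
  have "(\<Sum>a\<leftarrow>?P bs. \<bar>\<nu> (a \<inter> b) - \<nu> a / \<omega> a * \<omega> (a \<inter> b)\<bar>) \<le> \<epsilon>" if b: "b \<in> M" for b
  proof -
    let ?\<pi> = "?P bs"
    have \<pi>: "set ?\<pi> \<subseteq> M" by (rule charge_partition(1)[OF bs(1)])
    have "EE (refine ?\<pi> b) \<le> s"
      unfolding s_def using bs(1) b bdd by (intro cSup_upper) (auto intro!: image_eqI[of _ _ "bs @ [b]"])
    then have gain: "EE (refine ?\<pi> b) - EE ?\<pi> \<le> \<epsilon> * t" using bs(2) by simp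
    have "\<bar>\<nu> (a \<inter> b) - \<nu> a / \<omega> a * \<omega> (a \<inter> b)\<bar>
        \<le> (e (a \<inter> b) + e (a - b) - e a) * (1 / (2 * t)) + (t / 2) * \<omega> (a \<inter> b)" if "a \<in> set ?\<pi>" for a
    proof -
      have a: "a \<in> M" using that \<pi> by auto
      have "\<nu> a = \<nu> (a \<inter> b) + \<nu> (a - b)" "\<omega> a = \<omega> (a \<inter> b) + \<omega> (a - b)"
        by (rule charge_split[OF \<nu> b a], rule charge_split[OF \<omega> b a])
      note eq = this
      have "\<bar>\<nu> (a \<inter> b) - (\<nu> (a \<inter> b) + \<nu> (a - b)) / (\<omega> (a \<inter> b) + \<omega> (a - b)) * \<omega> (a \<inter> b)\<bar>
        \<le> ((\<nu> (a \<inter> b))\<^sup>2 / \<omega> (a \<inter> b) + (\<nu> (a - b))\<^sup>2 / \<omega> (a - b)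
            - (\<nu> (a \<inter> b) + \<nu> (a - b))\<^sup>2 / (\<omega> (a \<inter> b) + \<omega> (a - b))) / (2 * t) + t * \<omega> (a \<inter> b) / 2"
        by (intro energy_gain le charge_nonneg[OF \<nu>] Int Diff a b t)
      then show ?thesis
        unfolding e_def eq(1)[symmetric] eq(2)[symmetric] by simp
    qed
    then have "(\<Sum>a\<leftarrow>?\<pi>. \<bar>\<nu> (a \<inter> b) - \<nu> a / \<omega> a * \<omega> (a \<inter> b)\<bar>)
        \<le> (\<Sum>a\<leftarrow>?\<pi>. (e (a \<inter> b) + e (a - b) - e a) * (1 / (2 * t)) + (t / 2) * \<omega> (a \<inter> b))"
      by (intro sum_list_mono) auto
    also have "\<dots> = (EE (refine ?\<pi> b) - EE ?\<pi>) * (1 / (2 * t)) + (t / 2) * (\<Sum>a\<leftarrow>?\<pi>. \<omega> (a \<inter> b))"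
      unfolding EE_def refine_def
      by (simp only: sum_list_addf sum_list_subtractf sum_list_mult_const sum_list_const_mult
          map_append sum_list_append map_map o_def)
    also have "(\<Sum>a\<leftarrow>?\<pi>. \<omega> (a \<inter> b)) = \<omega> b" by (rule charge_partition(2)[OF bs(1) \<omega> b])
    also have "(EE (refine ?\<pi> b) - EE ?\<pi>) * (1 / (2 * t)) + (t / 2) * \<omega> b
        \<le> \<epsilon> * t * (1 / (2 * t)) + (t / 2) * (\<omega> \<Omega> + 1)"
      using gain t charge_le_space[OF \<omega> b] by (intro add_mono mult_right_mono mult_left_mono) auto
    also have "\<dots> = \<epsilon> / 2 + t * (\<omega> \<Omega> + 1) / 2" using t by simp
    also have "t * (\<omega> \<Omega> + 1) = \<epsilon>" using \<omega>0 by (simp add: t_def)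
    finally show ?thesis by simp
  qed
  with bs(1) show ?thesis by (intro exI[of _ bs] conjI ballI)
qed

text \<open>
  Apply the previous lemma to \<open>\<omega> = \<nu> + \<tau>\<close>. A density \<open>s\<close> with respect to \<open>\<nu> + \<tau>\<close> yields the density
  \<open>s/(1-s)\<close> with respect to \<open>\<tau>\<close> wherever \<open>s\<close> stays away from 1; the parts with \<open>s\<close> close to 1 together have
  small \<open>\<tau>\<close>-mass, and then small \<open>\<nu>\<close>-mass by absolute continuity.
\<close>

lemma ac_charge_density:
  assumes \<nu>: "charge M \<nu>" and \<tau>: "charge M \<tau>" and ac: "ac_charge M \<nu> \<tau>" and \<epsilon>: "\<epsilon> > 0"
  shows "\<exists>\<pi> c. set \<pi> \<subseteq> M \<and> (\<forall>a. 0 \<le> c a) \<and> (\<forall>b\<in>M. \<bar>\<nu> b - (\<Sum>a\<leftarrow>\<pi>. c a * \<tau> (a \<inter> b))\<bar> \<le> \<epsilon>)"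
proof -
  from ac \<epsilon> obtain \<delta> where \<delta>: "\<delta> > 0" "\<And>a. a \<in> M \<Longrightarrow> \<tau> a < \<delta> \<Longrightarrow> \<nu> a < \<epsilon> / 2"
    unfolding ac_charge_def by (meson half_gt_zero)
  have \<nu>0: "\<nu> \<Omega> \<ge> 0" using charge_nonneg[OF \<nu>] by auto
  \<comment> \<open>\<open>\<theta>\<close> is so small that the union of the bad parts has \<open>\<tau>\<close>-mass at most \<open>2\<theta>\<nu>(\<Omega>) < \<delta>\<close>.\<close>
  define \<theta> where "\<theta> = min (1/2) (\<delta> / (2 * (\<nu> \<Omega> + 1)))"
  have \<theta>: "0 < \<theta>" "\<theta> \<le> 1/2" and \<theta>\<delta>: "2 * \<theta> * \<nu> \<Omega> < \<delta>"
  proof -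
    show "0 < \<theta>" using \<delta> \<nu>0 by (auto simp: \<theta>_def)
    show "\<theta> \<le> 1/2" unfolding \<theta>_def by (rule min.cobounded1)
    have "2 * \<theta> * \<nu> \<Omega> \<le> 2 * (\<delta> / (2 * (\<nu> \<Omega> + 1))) * \<nu> \<Omega>"
      using \<nu>0 by (intro mult_right_mono) (auto simp: \<theta>_def)
    also have "\<dots> < \<delta>" using \<nu>0 \<delta> by (simp add: field_simps)
    finally show "2 * \<theta> * \<nu> \<Omega> < \<delta>" .
  qed
  define \<omega> where "\<omega> a = \<nu> a + \<tau> a" for a
  have \<omega>: "charge M \<omega>" unfolding \<omega>_def by (intro charge_add \<nu> \<tau>)
  have "\<exists>bs. set bs \<subseteq> M \<and> (\<forall>b\<in>M. (\<Sum>a\<leftarrow>foldl refine [\<Omega>] bs. \<bar>\<nu> (a \<inter> b) - \<nu> a / \<omega> a * \<omega> (a \<inter> b)\<bar>) \<le> \<epsilon> * \<theta> / 2)"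
    using \<epsilon> \<theta> charge_nonneg[OF \<tau>] by (intro charge_density_approx \<nu> \<omega>) (auto simp: \<omega>_def)
  then obtain bs where bs: "set bs \<subseteq> M"
    and app: "\<And>b. b \<in> M \<Longrightarrow> (\<Sum>a\<leftarrow>foldl refine [\<Omega>] bs. \<bar>\<nu> (a \<inter> b) - \<nu> a / \<omega> a * \<omega> (a \<inter> b)\<bar>) \<le> \<epsilon> * \<theta> / 2"
    by auto
  define \<pi> where "\<pi> = foldl refine [\<Omega>] bs"
  have \<pi>: "set \<pi> \<subseteq> M" unfolding \<pi>_def by (rule charge_partition(1)[OF bs])
  define s where "s a = \<nu> a / \<omega> a" for a
  define bad where "bad a \<longleftrightarrow> s a > 1 - \<theta>" for a
  define c where "c a = (if a \<in> set \<pi> \<and> \<not> bad a then s a / (1 - s a) else 0)" for a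
  have s0: "0 \<le> s a" if "a \<in> M" for a
    using that charge_nonneg[OF \<nu>] charge_nonneg[OF \<omega>] by (simp add: s_def)
  have c0: "0 \<le> c a" for a
    using s0 \<pi> \<theta> by (auto simp: c_def bad_def intro!: divide_nonneg_nonneg)
  define E where "E = \<Union>(set (filter bad \<pi>))"
  have E: "E \<in> M" unfolding E_def using \<pi> by (intro finite_Union) auto
  have \<tau>bad: "\<tau> (a \<inter> E) \<le> 2 * \<theta> * \<nu> (a \<inter> E)" if "a \<in> set \<pi>" "bad a" for a
  proof -
    have a: "a \<in> M" "a \<inter> E = a" using that \<pi> by (auto simp: E_def)
    have "\<omega> a \<noteq> 0" using that(2) \<theta> by (auto simp: bad_def s_def)
    then have \<omega>a: "\<omega> a > 0" using charge_nonneg[OF \<omega>] a by fastforce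
    have "(1 - \<theta>) * \<omega> a < \<nu> a" using that(2) \<omega>a by (simp add: bad_def s_def pos_less_divide_eq)
    then have "(1 - \<theta>) * \<tau> a \<le> \<theta> * \<nu> a" by (simp add: \<omega>_def algebra_simps)
    moreover have "(1 - \<theta>) * \<tau> a \<ge> 1/2 * \<tau> a"
      using \<theta> charge_nonneg[OF \<tau> a(1)] by (intro mult_right_mono) auto
    ultimately show ?thesis using a by simp
  qed
  have badE: "(\<Sum>a\<leftarrow>filter bad \<pi>. \<nu> a) \<le> \<nu> E" "\<tau> E \<le> (\<Sum>a\<leftarrow>filter bad \<pi>. \<tau> a)"
  proof -
    have "(\<Sum>a\<leftarrow>filter bad \<pi>. \<nu> a) \<le> (\<Sum>a\<leftarrow>\<pi>. \<nu> (a \<inter> E))"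
      using \<pi> E charge_nonneg[OF \<nu>]
    proof -
      have "(\<Sum>a\<leftarrow>filter bad \<pi>. \<nu> a) = (\<Sum>a\<leftarrow>\<pi>. if bad a then \<nu> a else 0)"
        by (simp add: sum_list_map_filter')
      also have "\<dots> \<le> (\<Sum>a\<leftarrow>\<pi>. \<nu> (a \<inter> E))"
      proof (intro sum_list_mono)
        fix a assume a: "a \<in> set \<pi>"
        then have "bad a \<Longrightarrow> a \<inter> E = a" by (auto simp: E_def)
        then show "(if bad a then \<nu> a else 0) \<le> \<nu> (a \<inter> E)"
          using a \<pi> E charge_nonneg[OF \<nu>, of "a \<inter> E"] by auto
      qed
      finally show ?thesis .
    qed
    also have "\<dots> = \<nu> E" unfolding \<pi>_def by (rule charge_partition(2)[OF bs \<nu> E])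
    finally show "(\<Sum>a\<leftarrow>filter bad \<pi>. \<nu> a) \<le> \<nu> E" .
    have sub: "\<tau> (\<Union>(set as)) \<le> (\<Sum>a\<leftarrow>as. \<tau> a)" if "set as \<subseteq> M" for as
      using that
    proof (induction as)
      case Nil
      then show ?case using charge_empty[OF \<tau>] by simp
    next
      case (Cons a as)
      have "\<tau> (a \<union> \<Union>(set as)) \<le> \<tau> a + \<tau> (\<Union>(set as))"
        using Cons by (intro charge_Un_le \<tau> finite_Union) auto
      then show ?case using Cons by auto
    qed
    show "\<tau> E \<le> (\<Sum>a\<leftarrow>filter bad \<pi>. \<tau> a)"
    proof -
      from sub[of "filter bad \<pi>"] show ?thesis unfolding E_def using \<pi> by (simp add: subset_iff)
    qed
  qed
  have "\<tau> E \<le> 2 * \<theta> * \<nu> E"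
  proof -
    have "(\<Sum>a\<leftarrow>filter bad \<pi>. \<tau> a) \<le> (\<Sum>a\<leftarrow>filter bad \<pi>. 2 * \<theta> * \<nu> a)"
    proof (intro sum_list_mono)
      fix a assume a: "a \<in> set (filter bad \<pi>)"
      then have "a \<inter> E = a" by (auto simp: E_def)
      then show "\<tau> a \<le> 2 * \<theta> * \<nu> a" using \<tau>bad[of a] a by auto
    qed
    also have "\<dots> = 2 * \<theta> * (\<Sum>a\<leftarrow>filter bad \<pi>. \<nu> a)" by (simp add: sum_list_const_mult)
    also have "\<dots> \<le> 2 * \<theta> * \<nu> E" using badE(1) \<theta> by simp
    finally show ?thesis using badE(2) by simp
  qed
  also have "2 * \<theta> * \<nu> E \<le> 2 * \<theta> * \<nu> \<Omega>"
    using \<theta> charge_le_space[OF \<nu> E] by simp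
  finally have "\<tau> E < \<delta>" using \<theta>\<delta> by simp
  then have \<nu>E: "\<nu> E < \<epsilon> / 2" using \<delta>(2) E by auto
  have main: "\<bar>\<nu> b - (\<Sum>a\<leftarrow>\<pi>. c a * \<tau> (a \<inter> b))\<bar> \<le> \<epsilon>" if b: "b \<in> M" for b
  proof -
    let ?d = "\<lambda>a. \<bar>\<nu> (a \<inter> b) - s a * \<omega> (a \<inter> b)\<bar>"
    have "\<nu> b = (\<Sum>a\<leftarrow>\<pi>. \<nu> (a \<inter> b))"
      unfolding \<pi>_def by (rule charge_partition(2)[OF bs \<nu> b, symmetric])
    then have "\<bar>\<nu> b - (\<Sum>a\<leftarrow>\<pi>. c a * \<tau> (a \<inter> b))\<bar> = \<bar>\<Sum>a\<leftarrow>\<pi>. \<nu> (a \<inter> b) - c a * \<tau> (a \<inter> b)\<bar>"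
      by (simp add: sum_list_subtractf)
    also have "\<dots> \<le> (\<Sum>a\<leftarrow>\<pi>. \<bar>\<nu> (a \<inter> b) - c a * \<tau> (a \<inter> b)\<bar>)"
      using sum_list_abs[of "map (\<lambda>a. \<nu> (a \<inter> b) - c a * \<tau> (a \<inter> b)) \<pi>"] by (simp add: o_def)
    also have "\<dots> \<le> (\<Sum>a\<leftarrow>\<pi>. (1 / \<theta>) * ?d a + (if bad a then \<nu> a else 0))"
    proof (intro sum_list_mono)
      fix a assume a: "a \<in> set \<pi>"
      then have aM: "a \<in> M" using \<pi> by auto
      show "\<bar>\<nu> (a \<inter> b) - c a * \<tau> (a \<inter> b)\<bar> \<le> (1 / \<theta>) * ?d a + (if bad a then \<nu> a else 0)"
      proof (cases "bad a")
        case True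
        then show ?thesis
          using \<theta> charge_mono[OF \<nu> Int[OF aM b] aM] charge_nonneg[OF \<nu> Int[OF aM b]]
          by (auto simp: c_def intro!: add_increasing)
      next
        case False
        then have s: "1 - s a \<ge> \<theta>" by (simp add: bad_def)
        then have "1 - s a > 0" using \<theta> by linarith
        then have "\<nu> (a \<inter> b) - c a * \<tau> (a \<inter> b) = (\<nu> (a \<inter> b) - s a * \<omega> (a \<inter> b)) / (1 - s a)"
          using a False by (simp add: c_def \<omega>_def field_simps)
        then have "\<bar>\<nu> (a \<inter> b) - c a * \<tau> (a \<inter> b)\<bar> = ?d a / (1 - s a)"
          using \<open>1 - s a > 0\<close> by simp
        also have "\<dots> \<le> ?d a / \<theta>" using s \<theta> by (intro divide_left_mono) auto
        finally show ?thesis using False by simp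
      qed
    qed
    also have "\<dots> = (1 / \<theta>) * (\<Sum>a\<leftarrow>\<pi>. ?d a) + (\<Sum>a\<leftarrow>filter bad \<pi>. \<nu> a)"
      by (simp only: sum_list_addf sum_list_const_mult sum_list_map_filter')
    also have "\<dots> \<le> (1 / \<theta>) * (\<epsilon> * \<theta> / 2) + \<epsilon> / 2"
      using app[OF b] \<theta> badE(1) \<nu>E by (intro add_mono mult_left_mono) (auto simp: \<pi>_def s_def)
    also have "\<dots> = \<epsilon>" using \<theta> by simp
    finally show ?thesis .
  qed
  show ?thesis
    by (intro exI[of _ \<pi>] exI[of _ c] conjI \<pi> ballI allI c0 main)
qed

end

section \<open>Ultrafilters and the hierarchy of charges\<close>

definition ultra :: "'a set \<Rightarrow> 'a set set \<Rightarrow> 'a set set \<Rightarrow> bool" where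
  "ultra X M p \<longleftrightarrow> p \<subseteq> M \<and> X \<in> p \<and> {} \<notin> p \<and> (\<forall>a\<in>p. \<forall>b\<in>p. a \<inter> b \<in> p) \<and>
     (\<forall>a\<in>p. \<forall>b\<in>M. a \<subseteq> b \<longrightarrow> b \<in> p) \<and> (\<forall>a\<in>M. a \<in> p \<or> X - a \<in> p)"

lemma ultra_Int: "ultra X M p \<Longrightarrow> algebra X M \<Longrightarrow> a \<in> M \<Longrightarrow> b \<in> M \<Longrightarrow> a \<inter> b \<in> p \<longleftrightarrow> a \<in> p \<and> b \<in> p"
  unfolding ultra_def by (meson Int_lower1 Int_lower2)

lemma ultra_Compl:
  assumes "ultra X M p" "a \<in> M"
  shows "X - a \<in> p \<longleftrightarrow> a \<notin> p"
proof
  assume "X - a \<in> p"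
  show "a \<notin> p"
  proof
    assume "a \<in> p"
    then have "a \<inter> (X - a) \<in> p" using assms \<open>X - a \<in> p\<close> unfolding ultra_def by blast
    moreover have "a \<inter> (X - a) = {}" by auto
    ultimately show False using assms by (simp add: ultra_def)
  qed
qed (use assms in \<open>auto simp: ultra_def\<close>)

lemma ultra_Un:
  assumes "ultra X M p" "algebra X M" "a \<in> M" "b \<in> M"
  shows "a \<union> b \<in> p \<longleftrightarrow> a \<in> p \<or> b \<in> p"
proof -
  interpret algebra X M by fact
  have "X - (a \<union> b) = (X - a) \<inter> (X - b)" by auto
  then have "X - (a \<union> b) \<in> p \<longleftrightarrow> X - a \<in> p \<and> X - b \<in> p"
    using ultra_Int[OF assms(1,2) compl_sets compl_sets] assms(3,4) by simp
  then show ?thesis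
    using ultra_Compl[OF assms(1)] assms(3,4) Un[OF assms(3,4)] by blast
qed

lemma ultra_finite_UN:
  assumes "ultra X M p" "algebra X M" "finite I" "\<And>i. i \<in> I \<Longrightarrow> f i \<in> M" "(\<Union>i\<in>I. f i) \<in> p"
  shows "\<exists>i\<in>I. f i \<in> p"
  using assms(3-)
proof (induction I rule: finite_induct)
  case empty
  then show ?case using assms(1) by (simp add: ultra_def)
next
  case (insert i I)
  interpret algebra X M by fact
  have "f i \<union> (\<Union>i\<in>I. f i) \<in> p" using insert by simp
  then have "f i \<in> p \<or> (\<Union>i\<in>I. f i) \<in> p"
    using ultra_Un[OF assms(1,2), of "f i" "\<Union>i\<in>I. f i"] insert by auto
  then show ?case using insert by auto
qed

text \<open>
  Adding one ultrafilter at a time, with the values outside the field left open: closure under sums,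
  multiples and transport is then a plain induction.
\<close>

inductive atomic :: "'a set \<Rightarrow> 'a set set \<Rightarrow> ('a set \<Rightarrow> real) \<Rightarrow> bool" for X M where
  zero: "(\<And>a. a \<in> M \<Longrightarrow> \<nu> a = 0) \<Longrightarrow> atomic X M \<nu>"
| add: "atomic X M \<nu>' \<Longrightarrow> ultra X M p \<Longrightarrow> 0 \<le> w \<Longrightarrow>
    (\<And>a. a \<in> M \<Longrightarrow> \<nu> a = \<nu>' a + w * of_bool (a \<in> p)) \<Longrightarrow> atomic X M \<nu>"

inductive lev :: "'a set \<Rightarrow> 'a set set \<Rightarrow> ordinal \<Rightarrow> ('a set \<Rightarrow> real) \<Rightarrow> bool" for X M where
  base: "atomic X M \<nu> \<Longrightarrow> lev X M 0 \<nu>"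
| lim: "0 < \<alpha> \<Longrightarrow> (\<And>n. \<gamma> n < \<alpha>) \<Longrightarrow> (\<And>n::nat. lev X M (\<gamma> n) (m n)) \<Longrightarrow>
    (\<And>a. a \<in> M \<Longrightarrow> (\<lambda>n. m n a) \<longlonglongrightarrow> \<nu> a) \<Longrightarrow> lev X M \<alpha> \<nu>"

lemma atomic_cong: "atomic X M \<nu> \<Longrightarrow> (\<And>a. a \<in> M \<Longrightarrow> \<nu>' a = \<nu> a) \<Longrightarrow> atomic X M \<nu>'"
proof (induction rule: atomic.induct)
  case (zero \<nu>)
  then show ?case by (intro atomic.zero) auto
next
  case (add \<nu>'' p w \<nu>)
  show ?case by (rule atomic.add[OF add(1-3)]) (use add in auto)
qed

lemma lev_0_iff: "lev X M 0 \<nu> \<longleftrightarrow> atomic X M \<nu>"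
  by (auto elim: lev.cases intro: lev.base)

lemma lev_cong: "lev X M \<alpha> \<nu> \<Longrightarrow> (\<And>a. a \<in> M \<Longrightarrow> \<nu>' a = \<nu> a) \<Longrightarrow> lev X M \<alpha> \<nu>'"
proof (induction rule: lev.induct)
  case (base \<nu>)
  then show ?case by (auto intro: lev.base atomic_cong)
next
  case (lim \<alpha> \<gamma> m \<nu>)
  show ?case by (rule lev.lim[OF lim(1,2,3)]) (use lim in auto)
qed

lemma lev_mono:
  assumes "lev X M \<beta> \<nu>" "\<beta> \<le> \<alpha>"
  shows "lev X M \<alpha> \<nu>"
proof (cases "\<beta> = \<alpha>")
  case False
  then have "\<beta> < \<alpha>" using assms by simp
  moreover have "0 < \<alpha>" using \<open>\<beta> < \<alpha>\<close> zero_le_ordinal[of \<beta>] by simp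
  ultimately show ?thesis
    using assms by (intro lev.lim[of \<alpha> "\<lambda>_. \<beta>" X M "\<lambda>_. \<nu>"]) auto
qed (use assms in auto)

lemma lev_limI:
  assumes "\<And>n::nat. lev X M \<beta> (m n)" "\<And>a. a \<in> M \<Longrightarrow> (\<lambda>n. m n a) \<longlonglongrightarrow> \<nu> a" "\<beta> < \<alpha>"
  shows "lev X M \<alpha> \<nu>"
  using assms zero_le_ordinal[of \<beta>] by (intro lev.lim[of \<alpha> "\<lambda>_. \<beta>" X M m]) auto

lemma lev_posD:
  assumes "lev X M \<alpha> \<nu>" "0 < \<alpha>"
  shows "\<exists>\<gamma> m. (\<forall>n::nat. \<gamma> n < \<alpha>) \<and> (\<forall>n. lev X M (\<gamma> n) (m n)) \<and>
    (\<forall>a\<in>M. (\<lambda>n. m n a) \<longlonglongrightarrow> \<nu> a)"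
  using assms(1)
proof cases
  case base
  then show ?thesis using assms(2) by simp
next
  case (lim \<gamma> m)
  then show ?thesis by (intro exI[of _ \<gamma>] exI[of _ m]) simp
qed

lemma charge_ultra:
  assumes "algebra X M" "ultra X M p"
  shows "charge M (\<lambda>a. of_bool (a \<in> p))"
proof (rule chargeI)
  fix a b assume *: "a \<in> M" "b \<in> M" "a \<inter> b = {}"
  then have "\<not> (a \<in> p \<and> b \<in> p)"
    using ultra_Int[OF assms(2,1) *(1,2)] assms(2) by (auto simp: ultra_def)
  then show "of_bool (a \<union> b \<in> p) = of_bool (a \<in> p) + (of_bool (b \<in> p)::real)"
    using ultra_Un[OF assms(2,1) *(1,2)] by auto
qed auto

lemma charge_atomic:
  assumes "algebra X M" "atomic X M \<nu>"
  shows "charge M \<nu>"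
  using assms(2)
proof (induction rule: atomic.induct)
  case (zero \<nu>)
  interpret algebra X M by fact
  show ?case using zero by (auto intro!: chargeI simp: Un)
next
  case (add \<nu>' p w \<nu>)
  interpret algebra X M by fact
  have "charge M (\<lambda>a. \<nu>' a + w * of_bool (a \<in> p))"
    by (intro charge_add charge_scale charge_ultra[OF assms(1)] add)
  then show ?case using add assms by (auto elim!: charge_cong)
qed

lemma charge_lev:
  assumes "algebra X M" "lev X M \<alpha> \<nu>"
  shows "charge M \<nu>"
  using assms(2)
proof (induction rule: lev.induct)
  case (base \<nu>)
  then show ?case by (rule charge_atomic[OF assms(1)])
next
  case (lim \<alpha> \<gamma> m \<nu>)
  show ?case by (rule charge_limit[OF assms(1) lim(5,4)])
qed

lemma atomic_add: "atomic X M \<nu> \<Longrightarrow> atomic X M \<nu>' \<Longrightarrow> atomic X M (\<lambda>a. \<nu> a + \<nu>' a)"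
proof (induction rule: atomic.induct)
  case (zero \<nu>)
  then show ?case by (auto elim: atomic_cong)
next
  case (add \<nu>'' p w \<nu>)
  show ?case by (rule atomic.add[OF add(5)[OF add(6)] add(2,3)]) (simp add: add(4))
qed

lemma atomic_scale: "atomic X M \<nu> \<Longrightarrow> 0 \<le> c \<Longrightarrow> atomic X M (\<lambda>a. c * \<nu> a)"
proof (induction rule: atomic.induct)
  case (zero \<nu>)
  then show ?case by (auto intro: atomic.zero)
next
  case (add \<nu>'' p w \<nu>)
  show ?case
    by (rule atomic.add[OF add(5)[OF add(6)] add(2), of "c * w"]) (use add in \<open>auto simp: algebra_simps\<close>)
qed

lemma atomic_sum:
  assumes "finite F" "\<And>p. p \<in> F \<Longrightarrow> ultra X M p \<and> 0 \<le> w p"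
  shows "atomic X M (\<lambda>a. \<Sum>p\<in>F. w p * of_bool (a \<in> p))"
  using assms
proof (induction F rule: finite_induct)
  case empty
  then show ?case by (auto intro: atomic.zero)
next
  case (insert p F)
  have "atomic X M (\<lambda>a. \<Sum>p\<in>F. w p * of_bool (a \<in> p))" by (rule insert(3)) (use insert in auto)
  then show ?case by (rule atomic.add[of X M _ p "w p"]) (use insert in auto)
qed

lemma atomicE_sum:
  assumes "atomic X M \<nu>"
  shows "\<exists>F w. finite F \<and> (\<forall>p\<in>F. ultra X M p) \<and> (\<forall>p. 0 \<le> w p) \<and>
    (\<forall>a\<in>M. \<nu> a = (\<Sum>p\<in>F. w p * of_bool (a \<in> p)))"
  using assms
proof (induction rule: atomic.induct)
  case (zero \<nu>)
  show ?case by (intro exI[of _ "{}"] exI[of _ "\<lambda>_. 0"]) (simp add: zero)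
next
  case (add \<nu>' p c \<nu>)
  then obtain F w where F: "finite F" "\<forall>p\<in>F. ultra X M p" "\<forall>p. 0 \<le> w p"
    "\<forall>a\<in>M. \<nu>' a = (\<Sum>p\<in>F. w p * of_bool (a \<in> p))" by blast
  define w' where "w' q = (if q \<in> F then w q else 0) + (if q = p then c else 0)" for q
  have "\<nu> a = (\<Sum>q\<in>insert p F. w' q * of_bool (a \<in> q))" if "a \<in> M" for a
  proof -
    have "(\<Sum>q\<in>insert p F. w' q * of_bool (a \<in> q))
        = (\<Sum>q\<in>insert p F. (if q \<in> F then w q else 0) * of_bool (a \<in> q))
        + (\<Sum>q\<in>insert p F. (if q = p then c else 0) * of_bool (a \<in> q))"
      by (simp add: w'_def distrib_right sum.distrib)
    also have "(\<Sum>q\<in>insert p F. (if q \<in> F then w q else 0) * of_bool (a \<in> q)) = (\<Sum>q\<in>F. w q * of_bool (a \<in> q))"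
      using F(1) by (intro sum.mono_neutral_cong_right) auto
    also have "(\<Sum>q\<in>insert p F. (if q = p then c else 0) * of_bool (a \<in> q)) = c * of_bool (a \<in> p)"
      using F(1) by (subst sum.mono_neutral_cong_right[of _ "{p}" _ "\<lambda>q. c * of_bool (a \<in> q)"]) auto
    finally show ?thesis using F(4) add(4)[OF that] that by simp
  qed
  then show ?case
    using F add(2,3) by (intro exI[of _ "insert p F"] exI[of _ w']) (auto simp: w'_def)
qed

lemma lev_scale: "lev X M \<alpha> \<nu> \<Longrightarrow> 0 \<le> c \<Longrightarrow> lev X M \<alpha> (\<lambda>a. c * \<nu> a)"
proof (induction rule: lev.induct)
  case (base \<nu>)
  then show ?case by (auto intro: lev.base atomic_scale)
next
  case (lim \<alpha> \<gamma> m \<nu>)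
  show ?case
    by (rule lev.lim[of \<alpha> \<gamma> X M "\<lambda>n a. c * m n a"]) (use lim in \<open>auto intro: tendsto_mult\<close>)
qed

lemma lev_add: "lev X M \<alpha> \<nu> \<Longrightarrow> lev X M \<alpha> \<nu>' \<Longrightarrow> lev X M \<alpha> (\<lambda>a. \<nu> a + \<nu>' a)"
proof (induction \<alpha> arbitrary: \<nu> \<nu>' rule: less_induct)
  case (less \<alpha>)
  show ?case
  proof (cases "\<alpha> = 0")
    case True
    then show ?thesis using less(2,3) by (auto simp: lev_0_iff atomic_add)
  next
    case False
    then have pos: "0 < \<alpha>" using zero_le_ordinal[of \<alpha>] by simp
    from lev_posD[OF less(2) pos] obtain \<gamma> m where m: "\<forall>n. \<gamma> n < \<alpha>" "\<forall>n. lev X M (\<gamma> n) (m n)"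
      "\<forall>a\<in>M. (\<lambda>n. m n a) \<longlonglongrightarrow> \<nu> a"
      by (elim exE conjE)
    from lev_posD[OF less(3) pos] obtain \<gamma>' m' where m': "\<forall>n. \<gamma>' n < \<alpha>" "\<forall>n. lev X M (\<gamma>' n) (m' n)"
      "\<forall>a\<in>M. (\<lambda>n. m' n a) \<longlonglongrightarrow> \<nu>' a"
      by (elim exE conjE)
    show ?thesis
    proof (rule lev.lim[of \<alpha> "\<lambda>n. max (\<gamma> n) (\<gamma>' n)" X M "\<lambda>n a. m n a + m' n a"])
      show "lev X M (max (\<gamma> n) (\<gamma>' n)) (\<lambda>a. m n a + m' n a)" for n
        by (intro less(1) lev_mono[OF m(2)[rule_format]] lev_mono[OF m'(2)[rule_format]]) (use m m' in auto)
    qed (use m m' pos in \<open>auto intro: tendsto_add\<close>)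
  qed
qed

lemma lev_zero: "lev X M \<alpha> (\<lambda>a. 0)"
  by (rule lev_mono[OF lev.base zero_le_ordinal]) (auto intro: atomic.zero)

text \<open>
  The map \<open>f\<close> need not preserve the top element: the preimage of an ultrafilter is an ultrafilter if
  it contains \<open>f Y\<close>, and otherwise empty. This covers restriction to a member of the field as well as
  transport in both directions between a product field and one of its factors.
\<close>

lemma atomic_pullback:
  assumes alg: "algebra X M" "algebra Y M'"
    and f: "\<And>b. b \<in> M' \<Longrightarrow> f b \<in> M" "f {} = {}"
      "\<And>b c. b \<in> M' \<Longrightarrow> c \<in> M' \<Longrightarrow> f (b \<inter> c) = f b \<inter> f c"
      "\<And>b c. b \<in> M' \<Longrightarrow> c \<in> M' \<Longrightarrow> f (b \<union> c) = f b \<union> f c"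
    and "atomic X M \<nu>"
  shows "atomic Y M' (\<lambda>b. \<nu> (f b))"
  using assms(7)
proof (induction rule: atomic.induct)
  case (zero \<nu>)
  then show ?case using f by (auto intro: atomic.zero)
next
  case (add \<nu>' p w \<nu>)
  interpret Y: algebra Y M' by fact
  have mono: "f b \<subseteq> f c" if "b \<in> M'" "c \<in> M'" "b \<subseteq> c" for b c
    using f(4)[of b c] that by (auto simp: Un_absorb1)
  show ?case
  proof (cases "f Y \<in> p")
    case True
    define q where "q = {b \<in> M'. f b \<in> p}"
    have "ultra Y M' q"
      unfolding ultra_def
    proof (intro conjI ballI impI)
      show "q \<subseteq> M'" "Y \<in> q" "{} \<notin> q"
        using True f add(2) by (auto simp: q_def ultra_def)
      show "a \<inter> b \<in> q" if "a \<in> q" "b \<in> q" for a b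
        using that add(2) f by (auto simp: q_def ultra_def)
      show "b \<in> q" if "a \<in> q" "b \<in> M'" "a \<subseteq> b" for a b
        using that add(2) f mono[of a b] by (auto simp: q_def ultra_def)
      show "a \<in> q \<or> Y - a \<in> q" if "a \<in> M'" for a
      proof -
        have "f a \<union> f (Y - a) = f Y"
          using f(4)[of a "Y - a"] that Y.sets_into_space[of a] by (auto simp: Un_absorb1)
        then show ?thesis
          using ultra_Un[OF add(2) alg(1), of "f a" "f (Y - a)"] that True f by (auto simp: q_def)
      qed
    qed
    then show ?thesis
      by (rule atomic.add[OF add(5) _ add(3)]) (use add f in \<open>auto simp: q_def\<close>)
  next
    case False
    have "f b \<notin> p" if "b \<in> M'" for b
      using that False mono[of b Y] f add(2) Y.sets_into_space[of b] by (auto simp: ultra_def)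
    then show ?thesis using add f by (intro atomic_cong[OF add(5)]) auto
  qed
qed

lemma lev_pullback:
  assumes alg: "algebra X M" "algebra Y M'"
    and f: "\<And>b. b \<in> M' \<Longrightarrow> f b \<in> M" "f {} = {}"
      "\<And>b c. b \<in> M' \<Longrightarrow> c \<in> M' \<Longrightarrow> f (b \<inter> c) = f b \<inter> f c"
      "\<And>b c. b \<in> M' \<Longrightarrow> c \<in> M' \<Longrightarrow> f (b \<union> c) = f b \<union> f c"
    and "lev X M \<alpha> \<nu>"
  shows "lev Y M' \<alpha> (\<lambda>b. \<nu> (f b))"
  using assms(7)
proof (induction rule: lev.induct)
  case (base \<nu>)
  then show ?case by (auto intro!: lev.base atomic_pullback[OF alg] f)
next
  case (lim \<alpha> \<gamma> m \<nu>)
  show ?case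
    by (rule lev.lim[of \<alpha> \<gamma> Y M' "\<lambda>n a. m n (f a)"]) (use lim f in auto)
qed

lemma lev_Int_left:
  assumes "algebra X M" "c \<in> M" "lev X M \<alpha> \<nu>"
  shows "lev X M \<alpha> (\<lambda>a. \<nu> (c \<inter> a))"
proof -
  interpret algebra X M by fact
  show ?thesis by (rule lev_pullback[OF assms(1,1) _ _ _ _ assms(3)]) (use assms(2) in auto)
qed

section \<open>Uniform closure of a level\<close>

text \<open>
  Uniform distance on the field is equivalent to the total variation norm. The closure lies between
  the level and its successor, and it is stable under absolute continuity.
\<close>

definition lev_closure :: "'a set \<Rightarrow> 'a set set \<Rightarrow> ordinal \<Rightarrow> ('a set \<Rightarrow> real) \<Rightarrow> bool" where
  "lev_closure X M \<alpha> \<nu> \<longleftrightarrow> (\<forall>\<epsilon>>0. \<exists>\<nu>'. lev X M \<alpha> \<nu>' \<and> (\<forall>a\<in>M. \<bar>\<nu> a - \<nu>' a\<bar> \<le> \<epsilon>))"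

lemma lev_imp_closure: "lev X M \<alpha> \<nu> \<Longrightarrow> lev_closure X M \<alpha> \<nu>"
  unfolding lev_closure_def by (auto intro!: exI[of _ \<nu>])

lemma lev_closure_imp_lev:
  assumes "lev_closure X M \<alpha> \<nu>"
  shows "lev X M (osuc \<alpha>) \<nu>"
proof -
  have "\<exists>\<nu>'. lev X M \<alpha> \<nu>' \<and> (\<forall>a\<in>M. \<bar>\<nu> a - \<nu>' a\<bar> \<le> 1 / real (Suc n))" for n :: nat
    using assms[unfolded lev_closure_def, rule_format, of "1 / real (Suc n)"] by simp
  then obtain m where m: "\<And>n. lev X M \<alpha> (m n)" "\<And>n a. a \<in> M \<Longrightarrow> \<bar>\<nu> a - m n a\<bar> \<le> 1 / real (Suc n)"
    by metis
  have "(\<lambda>n. m n a) \<longlonglongrightarrow> \<nu> a" if "a \<in> M" for a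
  proof (rule LIMSEQ_I)
    fix r :: real assume "r > 0"
    then obtain n0 where n0: "1 / real (Suc n0) < r" using nat_approx_posE by blast
    have "norm (m n a - \<nu> a) < r" if "n \<ge> n0" for n
    proof -
      have "1 / real (Suc n) \<le> 1 / real (Suc n0)" using that by (simp add: frac_le)
      then show ?thesis using m(2)[OF \<open>a \<in> M\<close>, of n] n0 by (simp add: abs_minus_commute)
    qed
    then show "\<exists>no. \<forall>n\<ge>no. norm (m n a - \<nu> a) < r" by blast
  qed
  then show ?thesis by (rule lev_limI[OF m(1) _ less_osuc])
qed

lemma lev_closure_approx:
  assumes "\<And>\<epsilon>. \<epsilon> > 0 \<Longrightarrow> \<exists>\<nu>'. lev_closure X M \<alpha> \<nu>' \<and> (\<forall>a\<in>M. \<bar>\<nu> a - \<nu>' a\<bar> \<le> \<epsilon>)"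
  shows "lev_closure X M \<alpha> \<nu>"
  unfolding lev_closure_def
proof (intro allI impI)
  fix \<epsilon> :: real assume "\<epsilon> > 0"
  then have e: "\<epsilon> / 2 > 0" by simp
  obtain \<nu>1 where 1: "lev_closure X M \<alpha> \<nu>1" "\<forall>a\<in>M. \<bar>\<nu> a - \<nu>1 a\<bar> \<le> \<epsilon> / 2" using assms[OF e] by auto
  obtain \<nu>2 where 2: "lev X M \<alpha> \<nu>2" "\<forall>a\<in>M. \<bar>\<nu>1 a - \<nu>2 a\<bar> \<le> \<epsilon> / 2"
    using 1(1) e unfolding lev_closure_def by blast
  show "\<exists>\<nu>'. lev X M \<alpha> \<nu>' \<and> (\<forall>a\<in>M. \<bar>\<nu> a - \<nu>' a\<bar> \<le> \<epsilon>)"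
  proof (intro exI[of _ \<nu>2] conjI 2 ballI)
    fix a assume "a \<in> M"
    then show "\<bar>\<nu> a - \<nu>2 a\<bar> \<le> \<epsilon>"
      using 1(2)[rule_format, of a] 2(2)[rule_format, of a] by linarith
  qed
qed

lemma lev_closure_add:
  assumes "lev_closure X M \<alpha> \<nu>" "lev_closure X M \<alpha> \<mu>"
  shows "lev_closure X M \<alpha> (\<lambda>a. \<nu> a + \<mu> a)"
  unfolding lev_closure_def
proof (intro allI impI)
  fix \<epsilon> :: real assume "\<epsilon> > 0"
  then have e: "\<epsilon> / 2 > 0" by simp
  obtain \<nu>' where 1: "lev X M \<alpha> \<nu>'" "\<forall>a\<in>M. \<bar>\<nu> a - \<nu>' a\<bar> \<le> \<epsilon> / 2" using assms(1) e unfolding lev_closure_def by blast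
  obtain \<mu>' where 2: "lev X M \<alpha> \<mu>'" "\<forall>a\<in>M. \<bar>\<mu> a - \<mu>' a\<bar> \<le> \<epsilon> / 2" using assms(2) e unfolding lev_closure_def by blast
  show "\<exists>\<nu>'. lev X M \<alpha> \<nu>' \<and> (\<forall>a\<in>M. \<bar>\<nu> a + \<mu> a - \<nu>' a\<bar> \<le> \<epsilon>)"
  proof (intro exI[of _ "\<lambda>a. \<nu>' a + \<mu>' a"] conjI lev_add 1 2 ballI)
    fix a assume "a \<in> M"
    then show "\<bar>\<nu> a + \<mu> a - (\<nu>' a + \<mu>' a)\<bar> \<le> \<epsilon>"
      using 1(2)[rule_format, of a] 2(2)[rule_format, of a] by linarith
  qed
qed

lemma lev_closure_scale:
  assumes "lev_closure X M \<alpha> \<nu>" "0 \<le> c"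
  shows "lev_closure X M \<alpha> (\<lambda>a. c * \<nu> a)"
  unfolding lev_closure_def
proof (intro allI impI)
  fix \<epsilon> :: real assume \<epsilon>: "\<epsilon> > 0"
  then have e: "\<epsilon> / (c + 1) > 0" using assms by simp
  obtain \<nu>' where 1: "lev X M \<alpha> \<nu>'" "\<forall>a\<in>M. \<bar>\<nu> a - \<nu>' a\<bar> \<le> \<epsilon> / (c + 1)" using assms(1) e unfolding lev_closure_def by blast
  show "\<exists>\<nu>'. lev X M \<alpha> \<nu>' \<and> (\<forall>a\<in>M. \<bar>c * \<nu> a - \<nu>' a\<bar> \<le> \<epsilon>)"
  proof (intro exI[of _ "\<lambda>a. c * \<nu>' a"] conjI lev_scale 1 assms ballI)
    fix a assume "a \<in> M"
    have "\<bar>c * \<nu> a - c * \<nu>' a\<bar> = c * \<bar>\<nu> a - \<nu>' a\<bar>"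
      using assms(2) by (simp add: abs_mult right_diff_distrib[symmetric])
    also have "\<dots> \<le> c * (\<epsilon> / (c + 1))" using 1(2) \<open>a \<in> M\<close> assms(2) by (intro mult_left_mono) auto
    also have "\<dots> \<le> \<epsilon>" using assms(2) \<epsilon> by (simp add: field_simps)
    finally show "\<bar>c * \<nu> a - c * \<nu>' a\<bar> \<le> \<epsilon>" .
  qed
qed

lemma lev_closure_Int_left:
  assumes "algebra X M" "lev_closure X M \<alpha> \<nu>" "c \<in> M"
  shows "lev_closure X M \<alpha> (\<lambda>a. \<nu> (c \<inter> a))"
  unfolding lev_closure_def
proof (intro allI impI)
  interpret algebra X M by fact
  fix \<epsilon> :: real assume \<epsilon>: "\<epsilon> > 0"
  obtain \<nu>' where 1: "lev X M \<alpha> \<nu>'" "\<forall>a\<in>M. \<bar>\<nu> a - \<nu>' a\<bar> \<le> \<epsilon>" using assms(2) \<epsilon> unfolding lev_closure_def by blast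
  show "\<exists>\<nu>'. lev X M \<alpha> \<nu>' \<and> (\<forall>a\<in>M. \<bar>\<nu> (c \<inter> a) - \<nu>' a\<bar> \<le> \<epsilon>)"
    using 1 assms by (intro exI[of _ "\<lambda>a. \<nu>' (c \<inter> a)"] conjI lev_Int_left[OF assms(1)]) auto
qed

lemma lev_closure_step:
  assumes "algebra X M" "lev_closure X M \<alpha> \<tau>" "set \<pi> \<subseteq> M" "\<And>a. 0 \<le> c a"
  shows "lev_closure X M \<alpha> (\<lambda>b. \<Sum>a\<leftarrow>\<pi>. c a * \<tau> (a \<inter> b))"
  using assms(3)
proof (induction \<pi>)
  case Nil
  then show ?case by (auto intro!: lev_imp_closure lev_zero)
next
  case (Cons a \<pi>)
  then show ?case
    by (auto intro!: lev_closure_add lev_closure_scale lev_closure_Int_left assms)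
qed

lemma lev_closure_ac:
  assumes "algebra X M" "lev_closure X M \<alpha> \<tau>" "charge M \<tau>" "charge M \<nu>" "ac_charge M \<nu> \<tau>"
  shows "lev_closure X M \<alpha> \<nu>"
proof (rule lev_closure_approx)
  interpret algebra X M by fact
  fix \<epsilon> :: real assume "\<epsilon> > 0"
  from ac_charge_density[OF assms(4,3,5) this] obtain \<pi> c where
    "set \<pi> \<subseteq> M" "\<And>a. 0 \<le> c a" "\<forall>b\<in>M. \<bar>\<nu> b - (\<Sum>a\<leftarrow>\<pi>. c a * \<tau> (a \<inter> b))\<bar> \<le> \<epsilon>" by blast
  then show "\<exists>\<nu>'. lev_closure X M \<alpha> \<nu>' \<and> (\<forall>a\<in>M. \<bar>\<nu> a - \<nu>' a\<bar> \<le> \<epsilon>)"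
    using lev_closure_step[OF assms(1,2)] by blast
qed

text \<open>
  The weights \<open>2\<^sup>-\<^sup>k / (1 + \<eta>\<^sub>k(X))\<close> make the sum of all \<open>\<eta>\<^sub>k\<close> converge uniformly.
\<close>

lemma lev_closure_dominating:
  assumes alg: "algebra X M" and "\<And>k::nat. lev_closure X M \<alpha> (\<eta> k)" and ch: "\<And>k. charge M (\<eta> k)"
  shows "\<exists>\<tau>. lev_closure X M \<alpha> \<tau> \<and> charge M \<tau> \<and> (\<forall>k. \<exists>C>0. \<forall>a\<in>M. \<eta> k a \<le> C * \<tau> a)"
proof -
  interpret algebra X M by fact
  define c where "c k = (1/2)^k / (1 + \<eta> k X)" for k
  have \<eta>X: "\<eta> k X \<ge> 0" for k using charge_nonneg[OF ch] by auto
  have c: "c k > 0" for k using \<eta>X[of k] by (auto simp: c_def add_pos_nonneg)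
  have bound: "c k * \<eta> k a \<le> (1/2)^k" if "a \<in> M" for k a
  proof -
    have "c k * \<eta> k a \<le> c k * (1 + \<eta> k X)"
      using charge_le_space[OF ch that, of k] c[of k] by (intro mult_left_mono) linarith+
    also have "\<dots> = (1/2)^k" using \<eta>X[of k] by (simp add: c_def)
    finally show ?thesis .
  qed
  have nn: "0 \<le> c k * \<eta> k a" if "a \<in> M" for k a
    using c[of k] charge_nonneg[OF ch that, of k] by simp
  have summ: "summable (\<lambda>k. c k * \<eta> k a)" if "a \<in> M" for a
    by (rule summable_comparison_test'[of "\<lambda>k. (1/2)^k" 0])
      (use bound[OF that] nn[OF that] in auto)
  define \<tau> where "\<tau> a = (\<Sum>k. c k * \<eta> k a)" for a
  have tail: "\<bar>\<tau> a - (\<Sum>k<n. c k * \<eta> k a)\<bar> \<le> 2 * (1/2)^n" if "a \<in> M" for a n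
  proof -
    have "\<tau> a - (\<Sum>k<n. c k * \<eta> k a) = (\<Sum>k. c (k + n) * \<eta> (k + n) a)"
      unfolding \<tau>_def using suminf_minus_initial_segment[OF summ[OF that], of n] by simp
    moreover have "(\<Sum>k. c (k + n) * \<eta> (k + n) a) \<le> (\<Sum>k. (1/2)^(k + n))"
      by (rule suminf_le[OF bound[OF that] summable_ignore_initial_segment[OF summ[OF that]]
            summable_ignore_initial_segment]) simp
    moreover have "(\<Sum>k. (1/2::real)^(k + n)) = 2 * (1/2)^n"
      by (simp add: power_add suminf_geometric flip: suminf_mult2)
    moreover have "0 \<le> (\<Sum>k. c (k + n) * \<eta> (k + n) a)"
      by (rule suminf_nonneg[OF summable_ignore_initial_segment[OF summ[OF that]] nn[OF that]])
    ultimately show ?thesis by linarith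
  qed
  have "charge M \<tau>"
  proof (rule chargeI)
    show "0 \<le> \<tau> a" if "a \<in> M" for a
      unfolding \<tau>_def using nn[OF that] summ[OF that] by (intro suminf_nonneg) auto
    fix a b assume ab: "a \<in> M" "b \<in> M" "a \<inter> b = {}"
    then have "\<tau> (a \<union> b) = (\<Sum>k. c k * \<eta> k a + c k * \<eta> k b)"
      unfolding \<tau>_def using charge_Un[OF ch] by (simp add: algebra_simps)
    also have "\<dots> = \<tau> a + \<tau> b" unfolding \<tau>_def using summ ab by (intro suminf_add[symmetric]) auto
    finally show "\<tau> (a \<union> b) = \<tau> a + \<tau> b" .
  qed
  moreover have "lev_closure X M \<alpha> \<tau>"
  proof (rule lev_closure_approx)
    fix \<epsilon> :: real assume "\<epsilon> > 0"
    then obtain n where n: "(1/2)^n < \<epsilon> / 2" using real_arch_pow_inv[of "\<epsilon> / 2" "1/2"] by auto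
    have "lev_closure X M \<alpha> (\<lambda>a. \<Sum>k<n. c k * \<eta> k a)"
    proof (induction n)
      case 0
      then show ?case by (auto intro!: lev_imp_closure lev_zero)
    next
      case (Suc n)
      then show ?case using c by (auto intro!: lev_closure_add lev_closure_scale assms less_imp_le)
    qed
    then show "\<exists>\<nu>'. lev_closure X M \<alpha> \<nu>' \<and> (\<forall>a\<in>M. \<bar>\<tau> a - \<nu>' a\<bar> \<le> \<epsilon>)"
      using tail[of _ n] n by (intro exI[of _ "\<lambda>a. \<Sum>k<n. c k * \<eta> k a"]) fastforce
  qed
  moreover have "\<exists>C>0. \<forall>a\<in>M. \<eta> k a \<le> C * \<tau> a" for k
  proof (intro exI[of _ "1 / c k"] conjI ballI)
    fix a assume a: "a \<in> M"
    have "c k * \<eta> k a \<le> \<tau> a"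
      unfolding \<tau>_def using sum_le_suminf[OF summ[OF a], of "{k}"] nn[OF a] by auto
    then show "\<eta> k a \<le> 1 / c k * \<tau> a" using c[of k] by (simp add: field_simps)
  qed (use c in auto)
  ultimately show ?thesis by (intro exI[of _ \<tau>] conjI allI)
qed

section \<open>Singularity and the inductive invariant\<close>

definition singular :: "'a set \<Rightarrow> 'a set set \<Rightarrow> ('a set \<Rightarrow> real) \<Rightarrow> ('a set \<Rightarrow> real) \<Rightarrow> bool" where
  "singular X M \<nu> \<mu> \<longleftrightarrow> (\<forall>\<epsilon>>0. \<exists>a\<in>M. \<mu> a < \<epsilon> \<and> \<nu> (X - a) < \<epsilon>)"

definition cell :: "'a set \<Rightarrow> ('a \<Rightarrow> nat \<Rightarrow> bool) \<Rightarrow> nat \<Rightarrow> (nat \<Rightarrow> bool) \<Rightarrow> 'a set" where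
  "cell X t i s = {x \<in> X. \<forall>k<i. t x k = s k}"

text \<open>
  The invariant of the construction. The clause on singularity is the lower bound: it makes \<open>\<mu>\<close> miss
  all levels below \<open>\<alpha>\<close>. The clause on \<open>osuc \<alpha>\<close> is the upper bound. The last one says that the first \<open>j\<close> bits of the label
  \<open>t\<close> are independent and fair under \<open>\<mu>\<close>; the bound \<open>j\<close> is there because the construction starts, at level
  0, from finite fields, which have room for finitely many such bits only.
\<close>

definition exact_level :: "ordinal \<Rightarrow> nat \<Rightarrow> 'a set \<Rightarrow> 'a set set \<Rightarrow> ('a set \<Rightarrow> real) \<Rightarrow> ('a \<Rightarrow> nat \<Rightarrow> bool) \<Rightarrow> bool" where
  "exact_level \<alpha> j X M \<mu> t \<longleftrightarrow> algebra X M \<and> lev X M \<alpha> \<mu> \<and> \<mu> X = 1 \<and>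
     (\<forall>\<beta> \<nu>. \<beta> < \<alpha> \<longrightarrow> lev X M \<beta> \<nu> \<longrightarrow> singular X M \<nu> \<mu>) \<and>
     (\<forall>\<beta> \<nu>. lev X M \<beta> \<nu> \<longrightarrow> lev X M (osuc \<alpha>) \<nu>) \<and>
     (\<forall>i s. cell X t i s \<in> M) \<and> (\<forall>i s. i \<le> j \<longrightarrow> \<mu> (cell X t i s) = (1/2)^i)"

text \<open>
  These predicates define the clopen subsets of the space of bit sequences.
\<close>

definition tame :: "((nat \<Rightarrow> bool) \<Rightarrow> bool) \<Rightarrow> bool" where
  "tame Q \<longleftrightarrow> (\<exists>i. \<forall>u v. (\<forall>k<i. u k = v k) \<longrightarrow> Q u = Q v)"

lemma tame_False: "tame (\<lambda>u. False)" and tame_prefix: "tame (\<lambda>u. \<forall>k<i. u k = s k)"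
  and tame_not: "tame Q \<Longrightarrow> tame (\<lambda>u. \<not> Q u)"
  unfolding tame_def by auto

lemma tame_or:
  assumes "tame Q" "tame R"
  shows "tame (\<lambda>u. Q u \<or> R u)"
proof -
  from assms obtain i j where "\<And>u v. (\<forall>k<i. u k = v k) \<Longrightarrow> Q u = Q v" "\<And>u v. (\<forall>k<j. u k = v k) \<Longrightarrow> R u = R v"
    unfolding tame_def by metis
  then show ?thesis unfolding tame_def by (intro exI[of _ "max i j"]) (metis max.strict_coboundedI1 max.strict_coboundedI2)
qed

lemma finite_prefixes: "finite {s::nat \<Rightarrow> bool. \<forall>k\<ge>i. \<not> s k}"
proof -
  have "{s::nat \<Rightarrow> bool. \<forall>k\<ge>i. \<not> s k} \<subseteq> (\<lambda>S k. k \<in> S) ` Pow {..<i}"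
  proof
    fix s :: "nat \<Rightarrow> bool" assume "s \<in> {s. \<forall>k\<ge>i. \<not> s k}"
    then have "s = (\<lambda>k. k \<in> {k. s k})" "{k. s k} \<in> Pow {..<i}" by (auto simp: not_le[symmetric])
    then show "s \<in> (\<lambda>S k. k \<in> S) ` Pow {..<i}" by (rule image_eqI)
  qed
  then show ?thesis by (rule finite_subset) auto
qed

section \<open>The product construction\<close>

text \<open>
  The pairing \<open>e\<close> realises the disjoint union of the spaces \<open>Xs n\<close> inside the type they live in, so that
  the construction can be iterated transfinitely.
\<close>

locale tower =
  fixes e :: "nat \<times> 'a \<Rightarrow> 'a" and Xs :: "nat \<Rightarrow> 'a set" and Ms :: "nat \<Rightarrow> 'a set set"
    and \<mu>s :: "nat \<Rightarrow> 'a set \<Rightarrow> real" and ts :: "nat \<Rightarrow> 'a \<Rightarrow> nat \<Rightarrow> bool"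
    and \<alpha>s :: "nat \<Rightarrow> ordinal" and \<alpha> :: ordinal
  assumes inj: "inj e"
    and exact_level: "\<And>n. exact_level (\<alpha>s n) n (Xs n) (Ms n) (\<mu>s n) (ts n)"
    and mono: "mono \<alpha>s" and less: "\<And>n. \<alpha>s n < \<alpha>" and cofinal: "\<And>\<beta>. \<beta> < \<alpha> \<Longrightarrow> \<exists>n. \<beta> \<le> \<alpha>s n"
begin

lemma alg: "algebra (Xs n) (Ms n)" and lev_\<mu>s: "lev (Xs n) (Ms n) (\<alpha>s n) (\<mu>s n)"
  and \<mu>s_1: "\<mu>s n (Xs n) = 1"
  and singular_s: "\<beta> < \<alpha>s n \<Longrightarrow> lev (Xs n) (Ms n) \<beta> \<nu> \<Longrightarrow> singular (Xs n) (Ms n) \<nu> (\<mu>s n)"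
  and stable: "lev (Xs n) (Ms n) \<beta> \<nu> \<Longrightarrow> lev (Xs n) (Ms n) (osuc (\<alpha>s n)) \<nu>"
  and cell_s: "cell (Xs n) (ts n) i s \<in> Ms n"
  and \<mu>s_cell: "i \<le> n \<Longrightarrow> \<mu>s n (cell (Xs n) (ts n) i s) = (1/2)^i"
  using exact_level[of n] unfolding exact_level_def by blast+

lemma charge_\<mu>s: "charge (Ms n) (\<mu>s n)"
  by (rule charge_lev[OF alg lev_\<mu>s])

sublocale s: algebra "Xs n" "Ms n" for n
  by (rule alg)

definition emb :: "nat \<Rightarrow> 'a set \<Rightarrow> 'a set" where "emb n a = (\<lambda>x. e (n, x)) ` a"
definition slice :: "nat \<Rightarrow> 'a set \<Rightarrow> 'a set" where "slice n A = {x \<in> Xs n. e (n, x) \<in> A}"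
definition X :: "'a set" where "X = (\<Union>n. emb n (Xs n))"
definition t :: "'a \<Rightarrow> nat \<Rightarrow> bool" where "t y = (case inv e y of (n, x) \<Rightarrow> ts n x)"
definition lab :: "nat \<Rightarrow> ((nat \<Rightarrow> bool) \<Rightarrow> bool) \<Rightarrow> 'a set" where "lab n Q = {x \<in> Xs n. Q (ts n x)}"
text \<open>
  A predicate on labels approximates all late members at the same time.
  This is what makes the measures of the members converge, and it ties the different factors
  together.
\<close>

definition M :: "'a set set" where
  "M = {A. A \<subseteq> X \<and> (\<forall>n. slice n A \<in> Ms n) \<and>
     (\<forall>\<epsilon>>0. \<exists>Q. tame Q \<and> (\<forall>\<^sub>F n in sequentially. \<mu>s n (sym_diff (slice n A) (lab n Q)) < \<epsilon>))}"
definition \<mu> :: "'a set \<Rightarrow> real" where "\<mu> A = lim (\<lambda>n. \<mu>s n (slice n A))"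

lemma e_eq [simp]: "e p = e q \<longleftrightarrow> p = q"
  using inj by (auto dest: injD)

lemma t_e [simp]: "t (e (n, x)) = ts n x"
  by (simp add: t_def inv_f_f[OF inj])

lemma slice_Un: "slice n (A \<union> B) = slice n A \<union> slice n B"
  and slice_Int: "slice n (A \<inter> B) = slice n A \<inter> slice n B"
  and slice_Diff: "slice n (A - B) = slice n A - slice n B"
  and slice_empty: "slice n {} = {}"
  and slice_UN: "slice n (\<Union>i\<in>I. f i) = (\<Union>i\<in>I. slice n (f i))"
  and slice_X: "slice n X = Xs n"
  and slice_sub: "slice n A \<subseteq> Xs n"
  and slice_emb: "a \<subseteq> Xs m \<Longrightarrow> slice n (emb m a) = (if n = m then a else {})"
  by (auto simp: slice_def X_def emb_def cell_def)

lemma slice_cell: "slice n (cell X t i s) = cell (Xs n) (ts n) i s"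
  by (auto simp: slice_def cell_def X_def emb_def)

lemma emb_sub: "a \<subseteq> Xs n \<Longrightarrow> emb n a \<subseteq> X"
  by (auto simp: X_def emb_def)

lemma emb_slice: "emb n (slice n A) = emb n (Xs n) \<inter> A"
  by (auto simp: emb_def slice_def)

lemma X_E:
  assumes "y \<in> X"
  obtains n x where "y = e (n, x)" "x \<in> Xs n"
  using assms by (auto simp: X_def emb_def)

lemma slice_mono: "A \<subseteq> B \<Longrightarrow> slice n A \<subseteq> slice n B"
  by (auto simp: slice_def)

lemma M_sub: "A \<in> M \<Longrightarrow> A \<subseteq> X" and M_slice: "A \<in> M \<Longrightarrow> slice n A \<in> Ms n"
  by (auto simp: M_def)

lemma M_approx:
  "A \<in> M \<Longrightarrow> \<epsilon> > 0 \<Longrightarrow> \<exists>Q. tame Q \<and> (\<forall>\<^sub>F n in sequentially. \<mu>s n (sym_diff (slice n A) (lab n Q)) < \<epsilon>)"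
  by (simp add: M_def)

lemma sym_diff_Ms: "a \<in> Ms n \<Longrightarrow> b \<in> Ms n \<Longrightarrow> sym_diff a b \<in> Ms n"
  by auto

text \<open>
  A predicate on the first \<open>i\<close> bits is a finite union of cells, each of mass \<open>2\<^sup>-\<^sup>i\<close> in all factors from
  the \<open>i\<close>-th on.
\<close>

lemma lab_tame:
  assumes "tame Q"
  shows "\<exists>c. \<forall>n. lab n Q \<in> Ms n \<and> (\<forall>\<^sub>F n in sequentially. \<mu>s n (lab n Q) = c)"
proof -
  from assms obtain i where i: "\<And>u v. (\<forall>k<i. u k = v k) \<Longrightarrow> Q u = Q v"
    unfolding tame_def by metis
  define R where "R = {s::nat \<Rightarrow> bool. (\<forall>k\<ge>i. \<not> s k) \<and> Q s}"
  have R: "finite R" unfolding R_def by (rule finite_subset[OF _ finite_prefixes[of i]]) auto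
  have lab: "lab n Q = (\<Union>s\<in>R. cell (Xs n) (ts n) i s)" for n
  proof (intro set_eqI iffI)
    fix x assume x: "x \<in> lab n Q"
    define s where "s k \<longleftrightarrow> k < i \<and> ts n x k" for k
    have "Q s = Q (ts n x)" by (rule i) (simp add: s_def)
    then show "x \<in> (\<Union>s\<in>R. cell (Xs n) (ts n) i s)"
      using x by (intro UN_I[of s]) (auto simp: R_def cell_def lab_def s_def)
  next
    fix x assume "x \<in> (\<Union>s\<in>R. cell (Xs n) (ts n) i s)"
    then obtain s where s: "s \<in> R" "x \<in> cell (Xs n) (ts n) i s" by auto
    then have "Q (ts n x) = Q s" by (intro i) (auto simp: cell_def)
    then show "x \<in> lab n Q" using s by (auto simp: lab_def R_def cell_def)
  qed
  have disj: "disjoint_family_on (cell (Xs n) (ts n) i) R" for n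
    unfolding disjoint_family_on_def
  proof (intro ballI impI)
    fix s s' assume *: "s \<in> R" "s' \<in> R" "s \<noteq> s'"
    then obtain k where k: "s k \<noteq> s' k" by auto
    then have "k < i" using *(1,2) by (force simp: R_def not_le[symmetric])
    then show "cell (Xs n) (ts n) i s \<inter> cell (Xs n) (ts n) i s' = {}" using k by (auto simp: cell_def)
  qed
  have "lab n Q \<in> Ms n" for n
    unfolding lab using R cell_s by (intro s.finite_UN) auto
  moreover have "\<forall>\<^sub>F n in sequentially. \<mu>s n (lab n Q) = real (card R) * (1/2)^i"
    using eventually_ge_at_top[of i]
  proof eventually_elim
    case (elim n)
    have "\<mu>s n (lab n Q) = (\<Sum>s\<in>R. \<mu>s n (cell (Xs n) (ts n) i s))"
      unfolding lab by (rule s.charge_UN_disjoint[OF charge_\<mu>s R cell_s disj])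
    then show ?case using \<mu>s_cell[OF elim] by simp
  qed
  ultimately show ?thesis by (intro exI conjI allI)
qed

lemma lab_Ms: "tame Q \<Longrightarrow> lab n Q \<in> Ms n"
  by (drule lab_tame) auto

lemma M_memI:
  assumes "A \<subseteq> X" "\<And>n. slice n A \<in> Ms n"
    and "\<And>\<epsilon>. \<epsilon> > 0 \<Longrightarrow> \<exists>B\<in>M. \<forall>\<^sub>F n in sequentially. \<mu>s n (sym_diff (slice n A) (slice n B)) < \<epsilon>"
  shows "A \<in> M"
  unfolding M_def
proof (intro CollectI conjI allI impI assms(1,2))
  fix \<epsilon> :: real assume "\<epsilon> > 0"
  then have e: "\<epsilon> / 2 > 0" by simp
  from assms(3)[OF e] obtain B where B: "B \<in> M"
    "\<forall>\<^sub>F n in sequentially. \<mu>s n (sym_diff (slice n A) (slice n B)) < \<epsilon> / 2" by auto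
  from M_approx[OF B(1) e] obtain Q where Q: "tame Q"
    "\<forall>\<^sub>F n in sequentially. \<mu>s n (sym_diff (slice n B) (lab n Q)) < \<epsilon> / 2" by auto
  show "\<exists>Q. tame Q \<and> (\<forall>\<^sub>F n in sequentially. \<mu>s n (sym_diff (slice n A) (lab n Q)) < \<epsilon>)"
  proof (intro exI[of _ Q] conjI Q(1))
    show "\<forall>\<^sub>F n in sequentially. \<mu>s n (sym_diff (slice n A) (lab n Q)) < \<epsilon>"
      using B(2) Q(2)
    proof eventually_elim
      case (elim n)
      have Ms: "slice n A \<in> Ms n" "slice n B \<in> Ms n" "lab n Q \<in> Ms n"
        using assms(2) M_slice[OF B(1)] lab_Ms[OF Q(1)] by auto
      have "\<mu>s n (sym_diff (slice n A) (lab n Q))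
          \<le> \<mu>s n (sym_diff (slice n A) (slice n B) \<union> sym_diff (slice n B) (lab n Q))"
        using Ms by (intro s.charge_mono[OF charge_\<mu>s] s.Un sym_diff_Ms) auto
      also have "\<dots> \<le> \<mu>s n (sym_diff (slice n A) (slice n B)) + \<mu>s n (sym_diff (slice n B) (lab n Q))"
        using Ms by (intro s.charge_Un_le[OF charge_\<mu>s] sym_diff_Ms)
      finally show ?case using elim by linarith
    qed
  qed
qed

lemma emb_M: "a \<in> Ms m \<Longrightarrow> emb m a \<in> M"
  unfolding M_def
proof (intro CollectI conjI allI impI)
  assume a: "a \<in> Ms m"
  then have sub: "a \<subseteq> Xs m" by (rule s.sets_into_space)
  show "emb m a \<subseteq> X" by (rule emb_sub[OF sub])
  show "slice n (emb m a) \<in> Ms n" for n using a by (auto simp: slice_emb[OF sub])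
  fix \<epsilon> :: real assume "\<epsilon> > 0"
  have "\<forall>\<^sub>F n in sequentially. \<mu>s n (sym_diff (slice n (emb m a)) (lab n (\<lambda>u. False))) < \<epsilon>"
    using eventually_gt_at_top[of m]
    by eventually_elim (use \<open>\<epsilon> > 0\<close> s.charge_empty[OF charge_\<mu>s] in \<open>auto simp: slice_emb[OF sub] lab_def\<close>)
  then show "\<exists>Q. tame Q \<and> (\<forall>\<^sub>F n in sequentially. \<mu>s n (sym_diff (slice n (emb m a)) (lab n Q)) < \<epsilon>)"
    using tame_False by blast
qed

lemma cell_M: "cell X t i s \<in> M"
  unfolding M_def
proof (intro CollectI conjI allI impI)
  show "cell X t i s \<subseteq> X" by (auto simp: cell_def)
  show "slice n (cell X t i s) \<in> Ms n" for n by (simp add: slice_cell cell_s)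
  fix \<epsilon> :: real assume "\<epsilon> > 0"
  have eq: "slice n (cell X t i s) = lab n (\<lambda>u. \<forall>k<i. u k = s k)" for n
    unfolding slice_cell by (auto simp: lab_def cell_def)
  show "\<exists>Q. tame Q \<and> (\<forall>\<^sub>F n in sequentially. \<mu>s n (sym_diff (slice n (cell X t i s)) (lab n Q)) < \<epsilon>)"
    using tame_prefix[of i s] \<open>\<epsilon> > 0\<close> s.charge_empty[OF charge_\<mu>s]
    by (intro exI[of _ "\<lambda>u. \<forall>k<i. u k = s k"]) (simp add: eq)
qed

lemma algebra_M: "algebra X M"
  unfolding algebra_iff_Un
proof (intro conjI ballI)
  show "M \<subseteq> Pow X" using M_sub by auto
  show "{} \<in> M" using emb_M[OF s.empty_sets] by (simp add: emb_def)
  show "X - A \<in> M" if A: "A \<in> M" for A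
    unfolding M_def
  proof (intro CollectI conjI allI impI)
    show "slice n (X - A) \<in> Ms n" for n
      using M_slice[OF A] by (auto simp: slice_Diff slice_X)
    fix \<epsilon> :: real assume "\<epsilon> > 0"
    from M_approx[OF A this] obtain Q where Q: "tame Q"
      "\<forall>\<^sub>F n in sequentially. \<mu>s n (sym_diff (slice n A) (lab n Q)) < \<epsilon>" by auto
    have "sym_diff (slice n (X - A)) (lab n (\<lambda>u. \<not> Q u)) = sym_diff (slice n A) (lab n Q)" for n
      using slice_sub[of n A] by (auto simp: slice_Diff slice_X lab_def)
    then show "\<exists>Q. tame Q \<and> (\<forall>\<^sub>F n in sequentially. \<mu>s n (sym_diff (slice n (X - A)) (lab n Q)) < \<epsilon>)"
      using Q tame_not[OF Q(1)] by (intro exI[of _ "\<lambda>u. \<not> Q u"]) simp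
  qed auto
  show "A \<union> B \<in> M" if AB: "A \<in> M" "B \<in> M" for A B
    unfolding M_def
  proof (intro CollectI conjI allI impI)
    show "A \<union> B \<subseteq> X" using M_sub AB by auto
    show "slice n (A \<union> B) \<in> Ms n" for n
      using M_slice[OF AB(1)] M_slice[OF AB(2)] by (auto simp: slice_Un)
    fix \<epsilon> :: real assume "\<epsilon> > 0"
    then have e: "\<epsilon> / 2 > 0" by simp
    from M_approx[OF AB(1) e] obtain Q where Q: "tame Q"
      "\<forall>\<^sub>F n in sequentially. \<mu>s n (sym_diff (slice n A) (lab n Q)) < \<epsilon> / 2" by auto
    from M_approx[OF AB(2) e] obtain R where R: "tame R"
      "\<forall>\<^sub>F n in sequentially. \<mu>s n (sym_diff (slice n B) (lab n R)) < \<epsilon> / 2" by auto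
    have "\<forall>\<^sub>F n in sequentially. \<mu>s n (sym_diff (slice n (A \<union> B)) (lab n (\<lambda>u. Q u \<or> R u))) < \<epsilon>"
      using Q(2) R(2)
    proof eventually_elim
      case (elim n)
      have Ms: "slice n A \<in> Ms n" "slice n B \<in> Ms n" "slice n (A \<union> B) \<in> Ms n"
          "lab n Q \<in> Ms n" "lab n R \<in> Ms n" "lab n (\<lambda>u. Q u \<or> R u) \<in> Ms n"
        using M_slice[OF AB(1), of n] M_slice[OF AB(2), of n] lab_Ms Q(1) R(1) tame_or
        by (auto simp: slice_Un)
      have "\<mu>s n (sym_diff (slice n (A \<union> B)) (lab n (\<lambda>u. Q u \<or> R u)))
          \<le> \<mu>s n (sym_diff (slice n A) (lab n Q) \<union> sym_diff (slice n B) (lab n R))"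
        using Ms by (intro s.charge_mono[OF charge_\<mu>s] s.Un sym_diff_Ms) (auto simp: slice_Un lab_def)
      also have "\<dots> \<le> \<mu>s n (sym_diff (slice n A) (lab n Q)) + \<mu>s n (sym_diff (slice n B) (lab n R))"
        using Ms by (intro s.charge_Un_le[OF charge_\<mu>s] sym_diff_Ms)
      finally show ?case using elim by linarith
    qed
    then show "\<exists>Q. tame Q \<and> (\<forall>\<^sub>F n in sequentially. \<mu>s n (sym_diff (slice n (A \<union> B)) (lab n Q)) < \<epsilon>)"
      using tame_or[OF Q(1) R(1)] by (intro exI[of _ "\<lambda>u. Q u \<or> R u"] conjI)
  qed
qed

sublocale algebra X M
  by (rule algebra_M)

lemma charge_sym_diff:
  assumes "a \<in> Ms n" "b \<in> Ms n"
  shows "\<bar>\<mu>s n a - \<mu>s n b\<bar> \<le> \<mu>s n (sym_diff a b)"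
proof -
  have "\<mu>s n a \<le> \<mu>s n (b \<union> sym_diff a b)" "\<mu>s n b \<le> \<mu>s n (a \<union> sym_diff a b)"
    by (rule s.charge_mono[OF charge_\<mu>s], use assms in auto)+
  moreover have "\<mu>s n (b \<union> sym_diff a b) \<le> \<mu>s n b + \<mu>s n (sym_diff a b)"
    "\<mu>s n (a \<union> sym_diff a b) \<le> \<mu>s n a + \<mu>s n (sym_diff a b)"
    by (rule s.charge_Un_le[OF charge_\<mu>s], use assms in auto)+
  ultimately show ?thesis by linarith
qed

lemma tendsto_\<mu>:
  assumes A: "A \<in> M"
  shows "(\<lambda>n. \<mu>s n (slice n A)) \<longlonglongrightarrow> \<mu> A"
proof -
  have "Cauchy (\<lambda>n. \<mu>s n (slice n A))"
  proof (rule CauchyI)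
    fix \<epsilon> :: real assume "\<epsilon> > 0"
    then have e: "\<epsilon> / 2 > 0" by simp
    from M_approx[OF A e] obtain Q where Q: "tame Q"
      "\<forall>\<^sub>F n in sequentially. \<mu>s n (sym_diff (slice n A) (lab n Q)) < \<epsilon> / 2" by auto
    from lab_tame[OF Q(1)] obtain c where c: "\<forall>\<^sub>F n in sequentially. \<mu>s n (lab n Q) = c" by auto
    have "\<forall>\<^sub>F n in sequentially. \<bar>\<mu>s n (slice n A) - c\<bar> < \<epsilon> / 2"
      using Q(2) c
    proof eventually_elim
      case (elim n)
      then show ?case using charge_sym_diff[OF M_slice[OF A] lab_Ms[OF Q(1)], of n] by auto
    qed
    then obtain N where N: "\<And>n. n \<ge> N \<Longrightarrow> \<bar>\<mu>s n (slice n A) - c\<bar> < \<epsilon> / 2"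
      by (auto simp: eventually_sequentially)
    show "\<exists>N. \<forall>m\<ge>N. \<forall>n\<ge>N. norm (\<mu>s m (slice m A) - \<mu>s n (slice n A)) < \<epsilon>"
    proof (intro exI[of _ N] allI impI)
      fix m n assume "m \<ge> N" "n \<ge> N"
      then show "norm (\<mu>s m (slice m A) - \<mu>s n (slice n A)) < \<epsilon>"
        using N[of m] N[of n] unfolding real_norm_def by linarith
    qed
  qed
  then show ?thesis
    unfolding \<mu>_def by (simp add: Cauchy_convergent_iff convergent_LIMSEQ_iff)
qed

lemma lev_\<mu>: "lev X M \<alpha> \<mu>"
proof (rule lev.lim[of \<alpha> \<alpha>s X M "\<lambda>n A. \<mu>s n (slice n A)" \<mu>])
  show "0 < \<alpha>" using less[of 0] zero_le_ordinal[of "\<alpha>s 0"] by simp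
  show "lev X M (\<alpha>s n) (\<lambda>A. \<mu>s n (slice n A))" for n
    by (rule lev_pullback[OF alg algebra_M _ _ _ _ lev_\<mu>s])
      (auto simp: M_slice slice_empty slice_Int slice_Un)
qed (auto intro: less tendsto_\<mu>)

lemma charge_\<mu>: "charge M \<mu>"
  by (rule charge_lev[OF algebra_M lev_\<mu>])

lemma \<mu>_eventually_const:
  assumes "A \<in> M" "\<forall>\<^sub>F n in sequentially. \<mu>s n (slice n A) = c"
  shows "\<mu> A = c"
  using LIMSEQ_unique[OF tendsto_\<mu>[OF assms(1)] tendsto_eventually[OF assms(2)]] .

lemma \<mu>_X: "\<mu> X = 1"
  by (rule \<mu>_eventually_const) (auto simp: slice_X \<mu>s_1)

lemma \<mu>_cell: "\<mu> (cell X t i s) = (1/2)^i"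
  by (rule \<mu>_eventually_const[OF cell_M])
    (use eventually_ge_at_top[of i] in eventually_elim, simp add: slice_cell \<mu>s_cell)

text \<open>
  A null set for \<open>\<mu>\<close>, which ignores any finite number of factors.
\<close>

definition low :: "nat \<Rightarrow> 'a set" where "low m = (\<Union>n\<in>{..<m}. emb n (Xs n))"

lemma low_M: "low m \<in> M"
  unfolding low_def by (intro finite_UN emb_M) auto

lemma slice_low: "slice n (low m) = (if n < m then Xs n else {})"
  by (auto simp: slice_def low_def emb_def)

lemma incseq_low: "incseq low"
  by (force simp: incseq_def low_def)

lemma e_in_low: "x \<in> Xs n \<Longrightarrow> e (n, x) \<in> low m \<longleftrightarrow> n < m"
  by (auto simp: low_def emb_def)

lemma \<mu>_low: "\<mu> (low m) = 0"
  by (rule \<mu>_eventually_const[OF low_M])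
    (use eventually_ge_at_top[of m] in eventually_elim, simp add: slice_low s.charge_empty[OF charge_\<mu>s])

text \<open>
  In each factor the union is finite, because the sets recede to infinity. Uniformly in the factor
  it is within \<open>2\<delta>2\<^sup>-\<^sup>K\<close> of the union of the first \<open>K\<close> sets, which is in the field. So the union is
  approximated by members of the field and belongs to it.
\<close>

lemma receding_UN:
  assumes d: "\<And>k. d k \<in> M" and sl: "\<And>k n. n < k \<Longrightarrow> slice n (d k) = {}"
    and small: "\<And>k n. \<mu>s n (slice n (d k)) \<le> \<delta> * (1/2)^k" and \<delta>: "\<delta> > 0"
  shows "(\<Union>k. d k) \<in> M" "\<mu> (\<Union>k. d k) \<le> 2 * \<delta>"
proof -
  have slU: "slice n (\<Union>k. d k) = (\<Union>k\<in>{..n}. slice n (d k))" for n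
  proof (intro set_eqI iffI)
    fix x assume "x \<in> slice n (\<Union>k. d k)"
    then obtain k where k: "x \<in> slice n (d k)" by (auto simp: slice_UN)
    then have "k \<le> n" using sl[of n k] by (cases "n < k") auto
    then show "x \<in> (\<Union>k\<in>{..n}. slice n (d k))" using k by auto
  qed (auto simp: slice_UN)
  have sumhalf: "(\<Sum>i\<in>{K..n}. \<delta> * (1/2::real)^i) \<le> 2 * \<delta> * (1/2)^K" for K n
  proof -
    have "(\<Sum>i\<in>{K..n}. (1/2::real)^i) \<le> 2 * (1/2)^K" by (simp add: sum_gp)
    then have "\<delta> * (\<Sum>i\<in>{K..n}. (1/2::real)^i) \<le> \<delta> * (2 * (1/2)^K)" using \<delta> by (intro mult_left_mono) auto
    then show ?thesis by (simp add: sum_distrib_left)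
  qed
  have tail: "\<mu>s n (\<Union>k\<in>{K..n}. slice n (d k)) \<le> 2 * \<delta> * (1/2)^K" for K n
  proof -
    have "\<mu>s n (\<Union>k\<in>{K..n}. slice n (d k)) \<le> (\<Sum>k\<in>{K..n}. \<mu>s n (slice n (d k)))"
      by (intro s.charge_UN_le[OF charge_\<mu>s] M_slice d) auto
    also have "\<dots> \<le> (\<Sum>i\<in>{K..n}. \<delta> * (1/2::real)^i)" by (intro sum_mono small)
    finally show ?thesis using sumhalf[of K n] by linarith
  qed
  show U: "(\<Union>k. d k) \<in> M"
  proof (rule M_memI)
    show "(\<Union>k. d k) \<subseteq> X" using d M_sub by auto
    show "slice n (\<Union>k. d k) \<in> Ms n" for n
      unfolding slU by (intro s.finite_UN M_slice d) auto
    fix \<epsilon> :: real assume "\<epsilon> > 0"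
    then obtain K where K: "(1/2)^K < \<epsilon> / (2 * \<delta>)"
      using real_arch_pow_inv[of "\<epsilon> / (2 * \<delta>)" "1/2"] \<delta> by auto
    then have K: "2 * \<delta> * (1/2)^K < \<epsilon>" using \<delta> by (simp add: field_simps)
    show "\<exists>B\<in>M. \<forall>\<^sub>F n in sequentially. \<mu>s n (sym_diff (slice n (\<Union>k. d k)) (slice n B)) < \<epsilon>"
    proof (intro bexI[of _ "\<Union>k\<in>{..<K}. d k"] always_eventually allI)
      fix n
      have "\<mu>s n (sym_diff (slice n (\<Union>k. d k)) (slice n (\<Union>k\<in>{..<K}. d k))) \<le> \<mu>s n (\<Union>k\<in>{K..n}. slice n (d k))"
      proof (intro s.charge_mono[OF charge_\<mu>s] sym_diff_Ms)
        show "slice n (\<Union>k. d k) \<in> Ms n"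
          unfolding slU by (intro s.finite_UN M_slice d) auto
        show "slice n (\<Union>k\<in>{..<K}. d k) \<in> Ms n" "(\<Union>k\<in>{K..n}. slice n (d k)) \<in> Ms n"
          by (auto intro!: M_slice d)
        show "sym_diff (slice n (\<Union>k. d k)) (slice n (\<Union>k\<in>{..<K}. d k)) \<subseteq> (\<Union>k\<in>{K..n}. slice n (d k))"
        proof
          fix x assume x: "x \<in> sym_diff (slice n (\<Union>k. d k)) (slice n (\<Union>k\<in>{..<K}. d k))"
          then have "x \<in> slice n (\<Union>k. d k)" by (auto simp: slice_UN)
          then obtain k where k: "k \<le> n" "x \<in> slice n (d k)" unfolding slU by auto
          then have "\<not> k < K" using x by (auto simp: slice_UN)
          then show "x \<in> (\<Union>k\<in>{K..n}. slice n (d k))" using k by auto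
        qed
      qed
      also have "\<dots> < \<epsilon>" using tail[where n=n and K=K] K by linarith
      finally show "\<mu>s n (sym_diff (slice n (\<Union>k. d k)) (slice n (\<Union>k\<in>{..<K}. d k))) < \<epsilon>" .
    qed (use d in auto)
  qed
  have "\<mu>s n (slice n (\<Union>k. d k)) \<le> 2 * \<delta>" for n
    unfolding slU using tail[of n 0] by (simp add: atLeast0AtMost)
  then show "\<mu> (\<Union>k. d k) \<le> 2 * \<delta>"
    by (intro LIMSEQ_le_const2[OF tendsto_\<mu>[OF U]]) auto
qed

text \<open>
  An ultrafilter contains one of the finitely many cells of the first \<open>i\<close> bits, and each of these has
  mass \<open>2\<^sup>-\<^sup>i\<close>.
\<close>

lemma atomic_singular:
  assumes "atomic X M \<nu>" "\<epsilon> > 0"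
  shows "\<exists>a\<in>M. \<mu> a < \<epsilon> \<and> \<nu> (X - a) = 0"
  using assms
proof (induction arbitrary: \<epsilon> rule: atomic.induct)
  case (zero \<nu>)
  then show ?case using charge_empty[OF charge_\<mu>] by (intro bexI[of _ "{}"]) auto
next
  case (add \<nu>' p w \<nu>)
  from add(5)[of "\<epsilon> / 2"] add(6) obtain a where a: "a \<in> M" "\<mu> a < \<epsilon> / 2" "\<nu>' (X - a) = 0" by auto
  obtain i where i: "(1/2)^i < \<epsilon> / 2" using real_arch_pow_inv[of "\<epsilon> / 2" "1/2"] add(6) by auto
  have "X = (\<Union>s\<in>{s. \<forall>k\<ge>i. \<not> s k}. cell X t i s)"
  proof (intro set_eqI iffI)
    fix x assume "x \<in> X"
    then show "x \<in> (\<Union>s\<in>{s. \<forall>k\<ge>i. \<not> s k}. cell X t i s)"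
      by (intro UN_I[of "\<lambda>k. k < i \<and> t x k"]) (auto simp: cell_def)
  qed (auto simp: cell_def)
  moreover have "X \<in> p" using add(2) by (simp add: ultra_def)
  ultimately have "(\<Union>s\<in>{s. \<forall>k\<ge>i. \<not> s k}. cell X t i s) \<in> p" by simp
  from ultra_finite_UN[OF add(2) algebra_M finite_prefixes cell_M this]
  obtain s where s: "cell X t i s \<in> p" by auto
  define b where "b = a \<union> cell X t i s"
  have b: "b \<in> M" unfolding b_def using a cell_M by auto
  have "\<mu> b \<le> \<mu> a + \<mu> (cell X t i s)"
    unfolding b_def by (intro charge_Un_le charge_\<mu> a cell_M)
  then have "\<mu> b < \<epsilon>" using a(2) i by (simp add: \<mu>_cell)
  moreover have "\<nu> (X - b) = 0"
  proof -
    have "\<nu>' (X - b) \<le> \<nu>' (X - a)"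
      using a b by (intro charge_mono[OF charge_atomic[OF algebra_M add(1)]]) (auto simp: b_def)
    moreover have "0 \<le> \<nu>' (X - b)"
      using b by (intro charge_nonneg[OF charge_atomic[OF algebra_M add(1)]]) auto
    moreover have "b \<in> p" using add(2) s b by (auto simp: ultra_def b_def)
    then have "X - b \<notin> p" using ultra_Compl[OF add(2) b] by simp
    ultimately show ?thesis using add(4)[of "X - b"] b a(3) by auto
  qed
  ultimately show ?case using b by blast
qed

section \<open>Lower levels are singular to the limit charge\<close>

lemma lev_emb: "lev X M \<beta> \<nu> \<Longrightarrow> lev (Xs n) (Ms n) \<beta> (\<lambda>a. \<nu> (emb n a))"
  by (rule lev_pullback[OF algebra_M alg]) (erule emb_M, auto simp: emb_def)

lemma lev_slice: "lev (Xs n) (Ms n) \<beta> \<nu> \<Longrightarrow> lev X M \<beta> (\<lambda>A. \<nu> (slice n A))"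
  by (rule lev_pullback[OF alg algebra_M]) (auto simp: M_slice slice_empty slice_Int slice_Un)

text \<open>
  One step of the lower bound. A small set \<open>b\<close> that carries most of \<open>\<eta>\<close> is small in all factors from
  some \<open>N\<close> on. In the factors between \<open>i\<close> and \<open>N\<close> it is replaced by small sets \<open>C\<^sub>n\<close> that carry most of
  \<open>\<eta>\<close> there, and below \<open>i\<close> it is discarded. Then only the factors between \<open>m\<^sub>0\<close> and \<open>i\<close> can be lost, and
  these have small \<open>\<eta>\<close>-mass by assumption.
\<close>

lemma singular_step_set:
  assumes \<eta>: "charge M \<eta>" and s: "singular X M \<eta> \<mu>"
    and ss: "\<And>n. n \<ge> m0 \<Longrightarrow> singular (Xs n) (Ms n) (\<lambda>a. \<eta> (emb n a)) (\<mu>s n)"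
    and \<delta>: "\<delta> > 0" and low: "\<eta> (low i - low m0) < \<delta>"
  shows "\<exists>a\<in>M. (\<forall>n<i. slice n a = {}) \<and> (\<forall>n. \<mu>s n (slice n a) \<le> \<delta> * (1/2)^i) \<and> \<eta> (X - (a \<union> low m0)) \<le> 4 * \<delta>"
proof -
  have small: "min (\<delta> * (1/2)^i) (\<delta> * (1/2)^n) > 0" for n using \<delta> by simp
  obtain b where b: "b \<in> M" "\<mu> b < \<delta> * (1/2)^i" "\<eta> (X - b) < \<delta> * (1/2)^i"
    using s \<delta> unfolding singular_def by (meson mult_pos_pos zero_less_power half_gt_zero zero_less_one)
  have "\<eta> (X - b) < \<delta>"
  proof -
    have "\<delta> * (1/2)^i \<le> \<delta> * 1" using \<delta> by (intro mult_left_mono power_le_one) auto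
    then show ?thesis using b(3) by simp
  qed
  have "\<forall>\<^sub>F n in sequentially. \<mu>s n (slice n b) < \<delta> * (1/2)^i"
    using order_tendstoD(2)[OF tendsto_\<mu>[OF b(1)] b(2)] .
  then obtain N where N: "\<And>n. n \<ge> N \<Longrightarrow> \<mu>s n (slice n b) < \<delta> * (1/2)^i"
    by (auto simp: eventually_sequentially)
  have "\<exists>C. n \<ge> m0 \<longrightarrow> C \<in> Ms n \<and> \<mu>s n C < \<delta> * (1/2)^i \<and> \<eta> (emb n (Xs n - C)) < \<delta> * (1/2)^n" for n
  proof (cases "n \<ge> m0")
    case True
    then show ?thesis using ss[OF True, unfolded singular_def, rule_format, OF small[of n]] by auto
  qed auto
  then obtain C where C: "\<And>n. n \<ge> m0 \<Longrightarrow> C n \<in> Ms n" "\<And>n. n \<ge> m0 \<Longrightarrow> \<mu>s n (C n) < \<delta> * (1/2)^i"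
      "\<And>n. n \<ge> m0 \<Longrightarrow> \<eta> (emb n (Xs n - C n)) < \<delta> * (1/2)^n"
    by metis
  define I where "I = {max i m0..<N}"
  define a where "a = (\<Union>n\<in>I. emb n (C n)) \<union> (b - low (max N (max i m0)))"
  have CX: "C n \<subseteq> Xs n" if "n \<ge> m0" for n using s.sets_into_space C(1)[OF that] .
  have a: "a \<in> M"
    unfolding a_def using b low_M by (intro Un finite_UN Diff emb_M C) (auto simp: I_def)
  have sl: "slice n a = (if n \<in> I then C n else if n < max N (max i m0) then {} else slice n b)" for n
  proof -
    have "slice n (\<Union>n\<in>I. emb n (C n)) = (if n \<in> I then C n else {})"
      unfolding slice_UN using CX by (auto simp: slice_emb I_def split: if_splits)
    moreover have "slice n (b - low (max N (max i m0))) = (if n < max N (max i m0) then {} else slice n b)"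
      using slice_sub[of n b] by (auto simp: slice_Diff slice_low)
    ultimately show ?thesis unfolding a_def slice_Un by (auto simp: I_def)
  qed
  have "\<eta> (X - (a \<union> low m0)) \<le> 4 * \<delta>"
  proof -
    define R where "R = (\<Union>n\<in>I. emb n (Xs n - C n))"
    have R: "R \<in> M" unfolding R_def using C(1) by (intro finite_UN emb_M s.Diff s.top) (auto simp: I_def)
    have "\<eta> R \<le> (\<Sum>n\<in>I. \<eta> (emb n (Xs n - C n)))"
      unfolding R_def using C(1) by (intro charge_UN_le \<eta> emb_M s.Diff s.top) (auto simp: I_def)
    also have "\<dots> \<le> (\<Sum>n\<in>I. \<delta> * (1/2)^n)"
      using C(3) by (intro sum_mono less_imp_le) (auto simp: I_def)
    also have "\<dots> \<le> (\<Sum>n<N. \<delta> * (1/2)^n)"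
      using \<delta> by (intro sum_mono2) (auto simp: I_def)
    also have "\<dots> = \<delta> * (\<Sum>n<N. (1/2)^n)" by (simp add: sum_distrib_left)
    also have "\<dots> \<le> \<delta> * 2" using \<delta> by (intro mult_left_mono) (auto simp: sum_gp_strict)
    finally have "\<eta> R \<le> 2 * \<delta>" by simp
    have "X - (a \<union> low m0) \<subseteq> (X - b) \<union> ((low i - low m0) \<union> R)"
    proof
      fix y assume y: "y \<in> X - (a \<union> low m0)"
      then obtain n x where nx: "y = e (n, x)" "x \<in> Xs n" by (auto elim: X_E)
      then have "x \<notin> slice n a" "n \<ge> m0" using y by (auto simp: slice_def e_in_low)
      then show "y \<in> (X - b) \<union> ((low i - low m0) \<union> R)"
        using nx y unfolding sl by (auto simp: R_def I_def e_in_low emb_def slice_def split: if_splits)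
    qed
    then have "\<eta> (X - (a \<union> low m0)) \<le> \<eta> ((X - b) \<union> ((low i - low m0) \<union> R))"
      by (rule charge_mono[OF \<eta>, rotated 2]) (use a b low_M R in auto)
    also have "\<dots> \<le> \<eta> (X - b) + \<eta> ((low i - low m0) \<union> R)"
      by (rule charge_Un_le[OF \<eta>]) (use b low_M R in auto)
    also have "\<eta> ((low i - low m0) \<union> R) \<le> \<eta> (low i - low m0) + \<eta> R"
      by (rule charge_Un_le[OF \<eta>]) (use low_M R in auto)
    finally show ?thesis using \<open>\<eta> R \<le> 2 * \<delta>\<close> \<open>\<eta> (X - b) < \<delta>\<close> low by linarith
  qed
  moreover have "\<mu>s n (slice n a) \<le> \<delta> * (1/2)^i" for n
    unfolding sl using C(2)[of n] N[of n] \<delta> s.charge_empty[OF charge_\<mu>s] by (auto simp: I_def)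
  moreover have "slice n a = {}" if "n < i" for n
    unfolding sl using that by (auto simp: I_def)
  ultimately show ?thesis using a by blast
qed

text \<open>
  Let \<open>\<nu>\<close> be the limit of charges \<open>m\<^sub>k\<close>. Choose \<open>m\<^sub>0\<close> beyond which the factors carry little of \<open>\<nu>\<close>, and pass
  to a subsequence \<open>m\<^sub>\<kappa>\<^sub>(\<^sub>i\<^sub>)\<close> that has little mass on the factors between \<open>m\<^sub>0\<close> and \<open>i\<close>. The sets of the
  previous lemma, with measures at most \<open>\<delta>2\<^sup>-\<^sup>i\<close> and starting at factor \<open>i\<close>, have a union in the field
  that is small for \<open>\<mu>\<close> and carries most of every member of the subsequence, hence most of \<open>\<nu>\<close>. Factors
  before \<open>m\<^sub>0\<close> are covered outright, at no cost since they are null for \<open>\<mu>\<close>.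
\<close>

lemma lower_level_singular:
  assumes "lev X M \<beta> \<nu>" "\<beta> < \<alpha>"
  shows "singular X M \<nu> \<mu>"
  using assms
proof (induction rule: lev.induct)
  case (base \<nu>)
  show ?case unfolding singular_def
  proof (intro allI impI)
    fix \<epsilon> :: real assume "\<epsilon> > 0"
    then show "\<exists>a\<in>M. \<mu> a < \<epsilon> \<and> \<nu> (X - a) < \<epsilon>"
      using atomic_singular[OF base(1), of \<epsilon>] by auto
  qed
next
  case (lim \<beta> \<gamma> m \<nu>)
  have chm: "charge M (m k)" for k by (rule charge_lev[OF algebra_M lim(3)])
  have ch\<nu>: "charge M \<nu>" by (rule charge_limit[OF algebra_M chm lim(4)])
  have singm: "singular X M (m k) \<mu>" for k
    using lim(5)[of k] less_trans[OF lim(2) lim(6)] by blast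
  \<comment> \<open>From this index on the levels \<open>\<alpha>s n\<close> exceed all \<open>\<gamma> k\<close>, so the invariant of the factors applies.\<close>
  obtain M0 where M0: "\<beta> \<le> \<alpha>s M0" using cofinal[OF lim(6)] by auto
  have sings: "singular (Xs n) (Ms n) (\<lambda>a. m k (emb n a)) (\<mu>s n)" if "n \<ge> M0" for n k
  proof -
    have "\<alpha>s M0 \<le> \<alpha>s n" using mono that by (rule monoD)
    then have "\<gamma> k < \<alpha>s n" using lim(2)[of k] M0 by (meson less_le_trans)
    then show ?thesis by (rule singular_s[OF _ lev_emb[OF lim(3)]])
  qed
  show ?case unfolding singular_def
  proof (intro allI impI)
    fix \<epsilon> :: real assume \<epsilon>: "\<epsilon> > 0"
    define \<delta> where "\<delta> = \<epsilon> / 5"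
    have \<delta>: "\<delta> > 0" using \<epsilon> by (simp add: \<delta>_def)
    obtain m0 where m0: "m0 \<ge> M0" "\<And>m'. m' \<ge> m0 \<Longrightarrow> \<nu> (low m' - low m0) < \<delta>"
      using charge_incseq_tail[OF ch\<nu> low_M incseq_low \<delta>] by blast
    have "\<exists>k\<ge>i. m k (low i - low m0) < \<delta>" for i
    proof -
      have lt: "\<nu> (low i - low m0) < \<delta>"
      proof (cases "i \<ge> m0")
        case False
        then have "i \<le> m0" by simp
        then have 0: "low i - low m0 = {}" using monoD[OF incseq_low, of i m0] by blast
        show ?thesis unfolding 0 using charge_empty[OF ch\<nu>] \<delta> by simp
      qed (rule m0)
      have "\<forall>\<^sub>F k in sequentially. m k (low i - low m0) < \<delta>"
        by (rule order_tendstoD(2)[OF lim(4) lt]) (use low_M in auto)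
      then obtain K where "\<And>k. k \<ge> K \<Longrightarrow> m k (low i - low m0) < \<delta>"
        by (auto simp: eventually_sequentially)
      then show ?thesis by (intro exI[of _ "max i K"]) auto
    qed
    then obtain \<kappa> where \<kappa>: "\<And>i. \<kappa> i \<ge> i" "\<And>i. m (\<kappa> i) (low i - low m0) < \<delta>" by metis
    have "\<exists>a\<in>M. (\<forall>n<i. slice n a = {}) \<and> (\<forall>n. \<mu>s n (slice n a) \<le> \<delta> * (1/2)^i)
        \<and> m (\<kappa> i) (X - (a \<union> low m0)) \<le> 4 * \<delta>" for i
      by (rule singular_step_set[OF chm singm sings \<delta> \<kappa>(2)]) (use m0(1) in auto)
    then obtain a where a: "\<And>i. a i \<in> M" "\<And>i n. n < i \<Longrightarrow> slice n (a i) = {}"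
      "\<And>i n. \<mu>s n (slice n (a i)) \<le> \<delta> * (1/2)^i"
      "\<And>i. m (\<kappa> i) (X - (a i \<union> low m0)) \<le> 4 * \<delta>"
      by metis
    define D where "D = (\<Union>i. a i)"
    have D: "D \<in> M" "\<mu> D \<le> 2 * \<delta>"
      unfolding D_def by (rule receding_UN[OF a(1-3) \<delta>]; assumption)+
    have mD: "m (\<kappa> i) (X - (D \<union> low m0)) \<le> 4 * \<delta>" for i
    proof -
      have "m (\<kappa> i) (X - (D \<union> low m0)) \<le> m (\<kappa> i) (X - (a i \<union> low m0))"
        by (rule charge_mono[OF chm]) (use D(1) a(1) low_M in \<open>auto simp: D_def\<close>)
      then show ?thesis using a(4)[of i] by linarith
    qed
    have "filterlim \<kappa> at_top sequentially"
      by (rule filterlim_at_top_mono[OF filterlim_ident]) (simp add: \<kappa>(1))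
    moreover have "(\<lambda>k. m k (X - (D \<union> low m0))) \<longlonglongrightarrow> \<nu> (X - (D \<union> low m0))"
      by (rule lim(4)) (use D low_M in auto)
    ultimately have "(\<lambda>i. m (\<kappa> i) (X - (D \<union> low m0))) \<longlonglongrightarrow> \<nu> (X - (D \<union> low m0))"
      by (rule filterlim_compose[rotated])
    then have "\<nu> (X - (D \<union> low m0)) \<le> 4 * \<delta>"
      by (rule LIMSEQ_le_const2) (use mD in auto)
    moreover have "\<mu> (D \<union> low m0) \<le> 2 * \<delta>"
      using charge_Un_le[OF charge_\<mu> D(1) low_M[of m0]] D(2) by (simp add: \<mu>_low)
    ultimately show "\<exists>a\<in>M. \<mu> a < \<epsilon> \<and> \<nu> (X - a) < \<epsilon>"
      using D(1) low_M \<epsilon> by (intro bexI[of _ "D \<union> low m0"]) (auto simp: \<delta>_def)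
  qed
qed

section \<open>Sequential limits stay in the closure of the level\<close>

text \<open>
  Suppose \<open>\<nu>(g\<^sub>k)\<close> decreases to \<open>c > 0\<close>. Select sets \<open>a\<^sub>0 \<supseteq> a\<^sub>1 \<supseteq> \<dots>\<close>, each some \<open>g\<^sub>p\<close> without its first factors,
  and indices \<open>J\<^sub>0 < J\<^sub>1 < \<dots>\<close> such that inside \<open>g\<^sub>p\<^sub>0\<close> the charge \<open>m\<^sub>J\<^sub>i\<close> has almost all its mass on
  \<open>a\<^sub>i - a\<^sub>i\<^sub>+\<^sub>1\<close>, a mass of about \<open>c\<close>. The union \<open>E\<close> of these differences for even \<open>i\<close> is in the field, as
  they recede and have summable measures. But \<open>m\<^sub>J\<^sub>i(E)\<close> is close to \<open>c\<close> for even \<open>i\<close> and close to 0 for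
  odd \<open>i\<close>, so \<open>m\<^sub>j(E)\<close> cannot converge.
\<close>

lemma gliding_hump:
  assumes chm: "\<And>j. charge M (m j)" and lim: "\<And>a. a \<in> M \<Longrightarrow> (\<lambda>j. m j a) \<longlonglongrightarrow> \<nu> a"
    and g: "\<And>k::nat. g k \<in> M" "decseq g"
    and \<mu>0: "(\<lambda>k. \<mu> (g k)) \<longlonglongrightarrow> 0" and m0: "\<And>j. (\<lambda>k. m j (g k)) \<longlonglongrightarrow> 0"
    and low0: "\<And>n. (\<lambda>k. \<nu> (emb n (Xs n) \<inter> g k)) \<longlonglongrightarrow> 0"
  shows "(\<lambda>k. \<nu> (g k)) \<longlonglongrightarrow> 0"
proof -
  have ch\<nu>: "charge M \<nu>" by (rule charge_limit[OF algebra_M chm lim])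
  have g_anti: "g p' \<subseteq> g p" if "p \<le> p'" for p p' using g(2) that by (rule decseqD)
  have "decseq (\<lambda>k. \<nu> (g k))"
    unfolding decseq_def by (intro allI impI charge_mono[OF ch\<nu>] g g_anti)
  moreover have "0 \<le> \<nu> (g k)" for k by (rule charge_nonneg[OF ch\<nu> g(1)])
  ultimately obtain c where c: "(\<lambda>k. \<nu> (g k)) \<longlonglongrightarrow> c" "\<And>k. c \<le> \<nu> (g k)"
    using decseq_convergent[of "\<lambda>k. \<nu> (g k)" 0] by auto
  have c0: "c \<ge> 0" by (rule LIMSEQ_le_const[OF c(1)]) (use charge_nonneg[OF ch\<nu> g(1)] in auto)
  have "\<not> c > 0"
  proof
    assume "c > 0"
    define \<delta> where "\<delta> = c / 10"
    have \<delta>: "\<delta> > 0" "c = 10 * \<delta>" using \<open>c > 0\<close> by (auto simp: \<delta>_def)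
    have "\<forall>\<^sub>F k in sequentially. \<nu> (g k) < c + \<delta>"
      by (rule order_tendstoD(2)[OF c(1)]) (use \<delta> in simp)
    then obtain p0 where p0: "\<nu> (g p0) < c + \<delta>" by (auto simp: eventually_sequentially)
    have lowN: "(\<lambda>k. \<nu> (g k \<inter> low N)) \<longlonglongrightarrow> 0" for N
    proof (rule Lim_null_comparison)
      show "(\<lambda>k. \<Sum>n<N. \<nu> (emb n (Xs n) \<inter> g k)) \<longlonglongrightarrow> 0"
        by (rule tendsto_null_sum) (rule low0)
      have "norm (\<nu> (g k \<inter> low N)) \<le> (\<Sum>n<N. \<nu> (emb n (Xs n) \<inter> g k))" for k
      proof -
        have "g k \<inter> low N = (\<Union>n\<in>{..<N}. emb n (Xs n) \<inter> g k)" by (auto simp: low_def)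
        moreover have "emb n (Xs n) \<inter> g k \<in> M" for n using emb_M[OF s.top] g(1) by auto
        ultimately have "\<nu> (g k \<inter> low N) \<le> (\<Sum>n<N. \<nu> (emb n (Xs n) \<inter> g k))"
          using charge_UN_le[OF ch\<nu>, of "{..<N}" "\<lambda>n. emb n (Xs n) \<inter> g k"] by simp
        moreover have "0 \<le> \<nu> (g k \<inter> low N)" by (rule charge_nonneg[OF ch\<nu>]) (use g low_M in auto)
        ultimately show ?thesis by simp
      qed
      then show "\<forall>\<^sub>F k in sequentially. norm (\<nu> (g k \<inter> low N)) \<le> (\<Sum>n<N. \<nu> (emb n (Xs n) \<inter> g k))"
        by simp
    qed
    \<comment> \<open>A triple \<open>(p, N, j)\<close> stands for the set \<open>g p - low N\<close> and the charge \<open>m j\<close>: \<open>P\<close> describes a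
      single stage of the selection and \<open>Q\<close> two consecutive stages.\<close>
    define A where "A = (\<lambda>(p, N, j::nat). g p - low N)"
    have AM: "A x \<in> M" for x using g low_M by (auto simp: A_def split: prod.splits)
    define P where "P i x = (case x of (p, N, j) \<Rightarrow> p0 \<le> p \<and> i \<le> N \<and> (\<forall>n. \<mu>s n (slice n (A x)) \<le> 1 * (1/2)^i)
        \<and> m j (A x) > c - 2 * \<delta> \<and> m j (g p0 - A x) < 3 * \<delta>)" for i :: nat and x
    define Q where "Q i x x' = (case (x, x') of ((p, N, j), (p', N', j')) \<Rightarrow>
        p \<le> p' \<and> N \<le> N' \<and> j < j' \<and> m j (A x') < \<delta>)" for i :: nat and x x'
    have step: "\<exists>x'. P i x' \<and> Q i' x x'" for i i' x
    proof -
      obtain p1 N1 j1 where x: "x = (p1, N1, j1)" by (cases x)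
      have "\<forall>\<^sub>F k in sequentially. \<mu> (g k) < (1/2)^i"
        by (rule order_tendstoD(2)[OF \<mu>0]) simp
      then obtain q where q: "\<And>k. k \<ge> q \<Longrightarrow> \<mu> (g k) < (1/2)^i" by (auto simp: eventually_sequentially)
      \<comment> \<open>First \<open>q'\<close>, then \<open>N\<close>, then \<open>p\<close>: the cut \<open>N\<close> that makes all factors small depends on the set, and
        the \<open>\<nu>\<close>-mass that is cut off can be made small only by shrinking the set once more.\<close>
      define q' where "q' = max q (max p0 p1)"
      have "\<forall>\<^sub>F n in sequentially. \<mu>s n (slice n (g q')) < (1/2)^i"
        by (rule order_tendstoD(2)[OF tendsto_\<mu>[OF g(1)]]) (simp add: q q'_def)
      then obtain N2 where N2: "\<And>n. n \<ge> N2 \<Longrightarrow> \<mu>s n (slice n (g q')) < (1/2)^i"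
        by (auto simp: eventually_sequentially)
      define N where "N = max N2 (max i N1)"
      have "\<forall>\<^sub>F k in sequentially. \<nu> (g k \<inter> low N) < \<delta>"
        by (rule order_tendstoD(2)[OF lowN \<delta>(1)])
      moreover have "\<forall>\<^sub>F k in sequentially. m j1 (g k) < \<delta>"
        by (rule order_tendstoD(2)[OF m0 \<delta>(1)])
      ultimately have "\<forall>\<^sub>F k in sequentially. q' \<le> k \<and> \<nu> (g k \<inter> low N) < \<delta> \<and> m j1 (g k) < \<delta>"
        using eventually_ge_at_top[of q'] by eventually_elim auto
      then obtain p where p: "q' \<le> p" "\<nu> (g p \<inter> low N) < \<delta>" "m j1 (g p) < \<delta>"
        by (auto simp: eventually_sequentially)
      define B where "B = g p - low N"
      have B: "B \<in> M" "B \<subseteq> g p" using g low_M by (auto simp: B_def)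
      have gp: "g p \<subseteq> g q'" "g p \<subseteq> g p0" using p(1) by (auto intro!: g_anti simp: q'_def)
      have \<nu>B: "\<nu> B > c - \<delta>"
        using charge_split[OF ch\<nu> low_M[of N] g(1)[of p]] p(2) c(2)[of p] by (simp add: B_def)
      have "\<nu> (g p0 - B) = \<nu> (g p0) - \<nu> B"
        using B gp g by (intro charge_Diff ch\<nu>) auto
      then have \<nu>D: "\<nu> (g p0 - B) < 2 * \<delta>" using \<nu>B p0 by simp
      have "\<forall>\<^sub>F j in sequentially. m j B > c - 2 * \<delta>"
        by (rule order_tendstoD(1)[OF lim[OF B(1)]]) (use \<nu>B \<delta> in simp)
      moreover have "\<forall>\<^sub>F j in sequentially. m j (g p0 - B) < 3 * \<delta>"
        by (rule order_tendstoD(2)[OF lim]) (use \<nu>D \<delta> B g in auto)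
      ultimately have "\<forall>\<^sub>F j in sequentially. j1 < j \<and> m j B > c - 2 * \<delta> \<and> m j (g p0 - B) < 3 * \<delta>"
        using eventually_gt_at_top[of j1] by eventually_elim auto
      then obtain j where j: "j1 < j" "m j B > c - 2 * \<delta>" "m j (g p0 - B) < 3 * \<delta>"
        by (auto simp: eventually_sequentially)
      have "\<mu>s n (slice n B) \<le> (1/2)^i" for n
      proof (cases "n < N")
        case True
        then have "slice n B = {}" using slice_sub[of n "g p"] by (auto simp: B_def slice_Diff slice_low)
        then show ?thesis by (simp add: s.charge_empty[OF charge_\<mu>s])
      next
        case False
        have "\<mu>s n (slice n B) \<le> \<mu>s n (slice n (g q'))"
          using B gp g by (intro s.charge_mono[OF charge_\<mu>s] M_slice slice_mono) auto
        moreover have "N2 \<le> n" using False by (simp add: N_def)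
        ultimately show ?thesis using N2[of n] by linarith
      qed
      moreover have "m j1 B < \<delta>"
        using charge_mono[OF chm B(1) g(1) B(2), of j1] p(3) by linarith
      moreover have "A (p, N, j) = B" by (simp add: A_def B_def)
      moreover have "p0 \<le> p" "p1 \<le> p" "i \<le> N" "N1 \<le> N" using p(1) by (auto simp: N_def q'_def)
      ultimately show ?thesis
        using j unfolding x by (intro exI[of _ "(p, N, j)"]) (simp add: P_def Q_def)
    qed
    obtain f where f: "\<And>i. P i (f i)" "\<And>i. Q i (f i) (f (Suc i))"
      using dependent_nat_choice[of P Q] step by metis
    define a where "a i = A (f i)" for i
    define J where "J i = snd (snd (f i))" for i
    have aM: "a i \<in> M" for i by (simp add: a_def AM)
    have "a (Suc i) \<subseteq> a i" for i
      using f(2)[of i] g_anti incseq_low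
      by (fastforce simp: Q_def a_def A_def incseq_def split: prod.splits)
    then have a_anti: "a i' \<subseteq> a i" if "i \<le> i'" for i i'
      using that by (intro decseqD[of a]) (auto intro: decseq_SucI)
    have a_low: "slice n (a i) = {}" if "n < i" for n i
      using f(1)[of i] that slice_sub[of n]
      by (fastforce simp: P_def a_def A_def slice_Diff slice_low split: prod.splits)
    have a_small: "\<mu>s n (slice n (a i)) \<le> 1 * (1/2)^i" for n i
      using f(1)[of i] by (auto simp: P_def a_def split: prod.splits)
    have a_big: "m (J i) (a i) > c - 2 * \<delta>" "m (J i) (g p0 - a i) < 3 * \<delta>" "m (J i) (a (Suc i)) < \<delta>" for i
      using f(1)[of i] f(2)[of i] by (auto simp: P_def Q_def a_def J_def split: prod.splits)
    have a_g: "a i \<subseteq> g p0" for i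
      using f(1)[of i] g_anti[of p0] by (fastforce simp: P_def a_def A_def split: prod.splits)
    have J: "strict_mono J"
      unfolding strict_mono_Suc_iff J_def
    proof
      fix i show "snd (snd (f i)) < snd (snd (f (Suc i)))"
        using f(2)[of i] by (auto simp: Q_def split: prod.splits)
    qed
    define d where "d i = (if even i then a i - a (Suc i) else {})" for i
    define E where "E = (\<Union>i. d i)"
    have d_sub: "d i \<subseteq> a i" for i by (auto simp: d_def)
    have dM: "d i \<in> M" for i using aM by (auto simp: d_def)
    have E: "E \<in> M"
      unfolding E_def
    proof (rule receding_UN(1)[OF dM])
      show "slice n (d k) = {}" if "n < k" for n k
        using a_low[OF that] slice_mono[OF d_sub] by blast
      show "\<mu>s n (slice n (d k)) \<le> 1 * (1/2)^k" for n k
        using s.charge_mono[OF charge_\<mu>s M_slice[OF dM] M_slice[OF aM] slice_mono[OF d_sub], of n k]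
          a_small[of n k] by linarith
    qed simp
    have J2: "filterlim (\<lambda>i. J (2 * i)) at_top sequentially" "filterlim (\<lambda>i. J (2 * i + 1)) at_top sequentially"
      by (auto intro!: filterlim_subseq simp: strict_mono_def strict_monoD[OF J])
    have "\<nu> E \<ge> 7 * \<delta>"
    proof (rule LIMSEQ_le_const[OF filterlim_compose[OF lim[OF E] J2(1)]], intro exI allI impI)
      fix i :: nat
      have "m (J (2 * i)) (a (2 * i) - a (Suc (2 * i))) = m (J (2 * i)) (a (2 * i)) - m (J (2 * i)) (a (Suc (2 * i)))"
        by (intro charge_Diff chm aM a_anti) simp
      moreover have "m (J (2 * i)) (a (2 * i) - a (Suc (2 * i))) \<le> m (J (2 * i)) E"
        by (rule charge_mono[OF chm _ E]) (use aM in \<open>auto simp: E_def d_def intro!: exI[of _ "2 * i"]\<close>)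
      ultimately show "7 * \<delta> \<le> m (J (2 * i)) E"
        using a_big(1)[of "2 * i"] a_big(3)[of "2 * i"] \<delta> by linarith
    qed
    moreover have "\<nu> E \<le> 4 * \<delta>"
    proof (rule LIMSEQ_le_const2[OF filterlim_compose[OF lim[OF E] J2(2)]], intro exI allI impI)
      fix i :: nat
      let ?k = "2 * i + 1"
      have "E \<subseteq> (g p0 - a ?k) \<union> a (Suc ?k)"
      proof
        fix y assume "y \<in> E"
        then obtain l where l: "even l" "y \<in> a l - a (Suc l)" by (auto simp: E_def d_def split: if_splits)
        then have "l \<noteq> ?k" by auto
        then consider "Suc l \<le> ?k" | "Suc ?k \<le> l" by linarith
        then show "y \<in> (g p0 - a ?k) \<union> a (Suc ?k)"
          using l a_anti a_g by cases blast+
      qed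
      then have "m (J ?k) E \<le> m (J ?k) ((g p0 - a ?k) \<union> a (Suc ?k))"
        by (rule charge_mono[OF chm E, rotated]) (use aM g in auto)
      also have "\<dots> \<le> m (J ?k) (g p0 - a ?k) + m (J ?k) (a (Suc ?k))"
        by (rule charge_Un_le[OF chm]) (use aM g in auto)
      finally show "m (J ?k) E \<le> 4 * \<delta>" using a_big(2,3)[of ?k] by linarith
    qed
    ultimately show False using \<delta> by simp
  qed
  then show ?thesis using c(1) c0 by simp
qed

text \<open>
  Let \<open>\<nu>\<close> be the limit of charges \<open>m\<^sub>k\<close>. A single charge \<open>\<tau>\<close> in the closure dominates \<open>\<mu>\<close>, all \<open>m\<^sub>k\<close>, and
  the parts \<open>r\<^sub>k\<close> of \<open>\<nu>\<close> on the factors. The latter belong to the closure because on a factor every level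
  is contained in \<open>osuc (\<alpha>s k) \<le> \<alpha>\<close>. The gliding hump then makes \<open>\<nu>\<close> absolutely continuous with
  respect to \<open>\<tau>\<close>.
\<close>

lemma lev_closure_all:
  assumes "lev X M \<beta> \<nu>"
  shows "lev_closure X M \<alpha> \<nu>"
  using assms
proof (induction rule: lev.induct)
  case (base \<nu>)
  then show ?case by (intro lev_imp_closure lev_mono[OF lev.base zero_le_ordinal])
next
  case (lim \<beta> \<gamma> m \<nu>)
  have chm: "charge M (m k)" for k by (rule charge_lev[OF algebra_M lim(3)])
  have ch\<nu>: "charge M \<nu>" by (rule charge_limit[OF algebra_M chm lim(4)])
  have lev\<nu>: "lev X M \<beta> \<nu>" by (rule lev.lim[OF lim(1-4)])
  define r where "r k a = \<nu> (emb k (Xs k) \<inter> a)" for k a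
  have r: "lev X M \<alpha> (r k)" for k
  proof -
    have "lev X M (osuc (\<alpha>s k)) (\<lambda>A. \<nu> (emb k (slice k A)))"
      by (rule lev_slice[OF stable[OF lev_emb[OF lev\<nu>]]])
    then have "lev X M \<alpha> (\<lambda>A. \<nu> (emb k (slice k A)))"
      by (rule lev_mono) (simp add: osuc_le_iff less)
    then show ?thesis unfolding r_def emb_slice .
  qed
  define \<eta> where "\<eta> k a = m k a + (r k a + \<mu> a)" for k a
  have chr: "charge M (r k)" for k by (rule charge_lev[OF algebra_M r])
  have "lev_closure X M \<alpha> (\<eta> k)" for k
    unfolding \<eta>_def by (intro lev_closure_add lim(5) lev_imp_closure r lev_\<mu>)
  moreover have "charge M (\<eta> k)" for k
    unfolding \<eta>_def by (intro charge_add chm chr charge_\<mu>)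
  ultimately obtain \<tau> where \<tau>: "lev_closure X M \<alpha> \<tau>" "charge M \<tau>"
    "\<And>k. \<exists>C>0. \<forall>a\<in>M. \<eta> k a \<le> C * \<tau> a"
    using lev_closure_dominating[OF algebra_M, of \<alpha> \<eta>] by auto
  have "ac_charge M \<nu> \<tau>"
  proof (rule ac_charge_of_sequences[OF ch\<nu> \<tau>(2)])
    fix g :: "nat \<Rightarrow> 'a set" assume g: "\<And>k. g k \<in> M" "decseq g" "(\<lambda>k. \<tau> (g k)) \<longlonglongrightarrow> 0"
    have \<eta>0: "(\<lambda>k. \<eta> j (g k)) \<longlonglongrightarrow> 0" for j
    proof -
      obtain C where C: "\<forall>a\<in>M. \<eta> j a \<le> C * \<tau> a" using \<tau>(3)[of j] by auto
      have "0 \<le> \<eta> j (g k)" for k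
        unfolding \<eta>_def by (intro add_nonneg_nonneg charge_nonneg[OF chm] charge_nonneg[OF chr] charge_nonneg[OF charge_\<mu>] g)
      then have "norm (\<eta> j (g k)) \<le> C * \<tau> (g k)" for k using C g(1)[of k] by simp
      then show ?thesis
        by (rule Lim_null_comparison[OF always_eventually[OF allI] tendsto_mult_right_zero[OF g(3)]])
    qed
    have sq: "(\<lambda>k. h (g k)) \<longlonglongrightarrow> 0" if "\<And>a. a \<in> M \<Longrightarrow> 0 \<le> h a" "\<And>a. a \<in> M \<Longrightarrow> h a \<le> \<eta> j a" for h j
    proof -
      have "norm (h (g k)) \<le> \<eta> j (g k)" for k using that g(1)[of k] by simp
      then show ?thesis by (rule Lim_null_comparison[OF always_eventually[OF allI] \<eta>0])
    qed
    show "(\<lambda>k. \<nu> (g k)) \<longlonglongrightarrow> 0"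
    proof (rule gliding_hump[OF chm lim(4) g(1,2)])
      note nn = charge_nonneg[OF chm] charge_nonneg[OF chr] charge_nonneg[OF charge_\<mu>]
      show "(\<lambda>k. \<mu> (g k)) \<longlonglongrightarrow> 0" by (rule sq[of _ 0]) (auto simp: \<eta>_def nn)
      show "(\<lambda>k. m j (g k)) \<longlonglongrightarrow> 0" for j by (rule sq[of _ j]) (auto simp: \<eta>_def nn)
      show "(\<lambda>k. \<nu> (emb n (Xs n) \<inter> g k)) \<longlonglongrightarrow> 0" for n
        by (rule sq[of "r n" n, unfolded r_def]) (auto simp: \<eta>_def nn[unfolded r_def] r_def)
    qed
  qed
  then show ?case by (rule lev_closure_ac[OF algebra_M \<tau>(1,2) ch\<nu>])
qed

theorem exact_level_product: "exact_level \<alpha> j X M \<mu> t"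
  unfolding exact_level_def
  using algebra_M lev_\<mu> \<mu>_X lower_level_singular lev_closure_imp_lev[OF lev_closure_all] cell_M \<mu>_cell by auto

end

section \<open>The Stone space of a field of sets\<close>

definition hat :: "'a set \<Rightarrow> 'a set set \<Rightarrow> 'a set \<Rightarrow> 'a set set set" where
  "hat X M a = {p. ultra X M p \<and> a \<in> p}"

definition stone :: "'a set \<Rightarrow> 'a set set \<Rightarrow> 'a set set topology" where
  "stone X M = topology (\<lambda>U. U \<subseteq> hat X M X \<and> (\<forall>p\<in>U. \<exists>a\<in>p. hat X M a \<subseteq> U))"

locale field_of_sets = algebra X M for X :: "'a set" and M
begin

abbreviation "h \<equiv> hat X M"
abbreviation "K \<equiv> stone X M"

lemma openin_stone: "openin K U \<longleftrightarrow> U \<subseteq> h X \<and> (\<forall>p\<in>U. \<exists>a\<in>p. h a \<subseteq> U)"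
proof -
  define T where "T U \<longleftrightarrow> U \<subseteq> h X \<and> (\<forall>p\<in>U. \<exists>a\<in>p. h a \<subseteq> U)" for U
  have Int: "T (U \<inter> V)" if T: "T U" "T V" for U V
    unfolding T_def
  proof (rule conjI, goal_cases)
    case 1
    show ?case using T(1) unfolding T_def by (meson inf.coboundedI1)
  next
    case 2
    show ?case
    proof
      fix p assume p: "p \<in> U \<inter> V"
      from T(1) p obtain a where a: "a \<in> p" "h a \<subseteq> U" unfolding T_def by (meson IntD1)
      from T(2) p obtain b where b: "b \<in> p" "h b \<subseteq> V" unfolding T_def by (meson IntD2)
      have "p \<in> h X" using T(1) p unfolding T_def by (meson IntD1 subsetD)
      then have u: "ultra X M p" by (simp add: hat_def)
      then have M: "a \<in> M" "b \<in> M" and ab: "a \<inter> b \<in> p" using a b by (auto simp: ultra_def)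
      have "h (a \<inter> b) \<subseteq> h a \<inter> h b"
        using ultra_Int[OF _ algebra_axioms M] by (auto simp: hat_def)
      then have "h (a \<inter> b) \<subseteq> U \<inter> V" using a(2) b(2) by (meson Int_mono order_trans)
      with ab show "\<exists>a\<in>p. h a \<subseteq> U \<inter> V" by (rule bexI[rotated])
    qed
  qed
  have Un: "T (\<Union>\<K>)" if \<K>: "\<And>U. U \<in> \<K> \<Longrightarrow> T U" for \<K>
    unfolding T_def
  proof (rule conjI, goal_cases)
    case 1
    show ?case using \<K> unfolding T_def by (simp add: Sup_le_iff)
  next
    case 2
    show ?case
    proof
      fix p assume "p \<in> \<Union>\<K>"
      then obtain U where U: "U \<in> \<K>" "p \<in> U" by (rule UnionE)
      then obtain a where a: "a \<in> p" "h a \<subseteq> U" using \<K>[OF U(1)] unfolding T_def by (meson)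
      have "h a \<subseteq> \<Union>\<K>" using a(2) U(1) by (meson Union_upper order_trans)
      with a(1) show "\<exists>a\<in>p. h a \<subseteq> \<Union>\<K>" by (rule bexI[rotated])
    qed
  qed
  have "istopology T" unfolding istopology_def using Int Un by simp
  then have "openin (topology T) U = T U" by (simp only: topology_inverse')
  then show ?thesis unfolding stone_def T_def .
qed

lemma hat_ultra: "p \<in> h a \<Longrightarrow> ultra X M p" and hatD: "p \<in> h a \<Longrightarrow> a \<in> p"
  by (auto simp: hat_def)

lemma hat_top: "ultra X M p \<Longrightarrow> p \<in> h X"
  by (auto simp: hat_def ultra_def)

lemma ultra_sets: "ultra X M p \<Longrightarrow> a \<in> p \<Longrightarrow> a \<in> M"
  by (auto simp: ultra_def)

lemma hat_sub: "h a \<subseteq> h X"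
  by (auto simp: hat_def ultra_def)

lemma topspace_stone: "topspace K = h X"
proof
  have "openin K (h X)"
    unfolding openin_stone by (intro conjI ballI bexI[of _ X] subset_refl) (rule hatD)
  then show "h X \<subseteq> topspace K" by (rule openin_subset)
  show "topspace K \<subseteq> h X" by (rule conjunct1[OF openin_stone[THEN iffD1, OF openin_topspace]])
qed

lemma hat_Int: "a \<in> M \<Longrightarrow> b \<in> M \<Longrightarrow> h (a \<inter> b) = h a \<inter> h b"
  using ultra_Int[OF _ algebra_axioms] by (auto simp: hat_def)

lemma hat_Un: "a \<in> M \<Longrightarrow> b \<in> M \<Longrightarrow> h (a \<union> b) = h a \<union> h b"
  using ultra_Un[OF _ algebra_axioms] by (auto simp: hat_def)

lemma hat_empty: "h {} = {}"
  by (auto simp: hat_def ultra_def)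

lemma hat_Compl: "a \<in> M \<Longrightarrow> h (X - a) = h X - h a"
  using ultra_Compl[of X M _ a] by (auto simp: hat_def ultra_def)

lemma hat_mono: "a \<in> M \<Longrightarrow> b \<in> M \<Longrightarrow> a \<subseteq> b \<Longrightarrow> h a \<subseteq> h b"
  by (auto simp: hat_def ultra_def)

lemma hat_UN:
  "finite I \<Longrightarrow> (\<And>i. i \<in> I \<Longrightarrow> f i \<in> M) \<Longrightarrow> h (\<Union>i\<in>I. f i) = (\<Union>i\<in>I. h (f i))"
proof (induction I rule: finite_induct)
  case (insert i I)
  then have "h (f i \<union> (\<Union>i\<in>I. f i)) = h (f i) \<union> h (\<Union>i\<in>I. f i)"
    by (intro hat_Un finite_UN) auto
  then show ?case using insert by simp
qed (simp add: hat_empty)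

lemma hat_subD:
  assumes "a \<in> M" "b \<in> M" "h a \<subseteq> h b"
  shows "a \<subseteq> b"
proof
  fix x assume x: "x \<in> a"
  then have "x \<in> X" using sets_into_space[OF assms(1)] by auto
  then have "ultra X M {c \<in> M. x \<in> c}" by (auto simp: ultra_def)
  then have "{c \<in> M. x \<in> c} \<in> h a" using x assms by (auto simp: hat_def)
  then show "x \<in> b" using assms by (auto simp: hat_def)
qed

lemma openin_hat: "openin K (h a)"
  unfolding openin_stone by (intro conjI ballI bexI[of _ a] subset_refl hat_sub) (rule hatD)

lemma closedin_hat: "a \<in> M \<Longrightarrow> closedin K (h a)"
  using openin_hat[of "X - a"] hat_sub[of a] by (auto simp: closedin_def topspace_stone hat_Compl)

lemma openin_stoneD:
  assumes "openin K U" "p \<in> U"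
  shows "\<exists>a\<in>M. p \<in> h a \<and> h a \<subseteq> U"
proof -
  obtain a where a: "a \<in> p" "h a \<subseteq> U" using assms unfolding openin_stone by blast
  have p: "ultra X M p" using assms unfolding openin_stone by (auto simp: hat_def)
  show ?thesis
    by (rule bexI[of _ a]) (use a p ultra_sets[OF p] in \<open>auto simp: hat_def\<close>)
qed

text \<open>
  A family that is maximal among those with the finite intersection property is an ultrafilter of the
  field.
\<close>

lemma ultra_extend:
  assumes "F \<subseteq> M" and fip: "\<And>F'. finite F' \<Longrightarrow> F' \<subseteq> F \<Longrightarrow> X \<inter> \<Inter>F' \<noteq> {}"
  shows "\<exists>p. ultra X M p \<and> F \<subseteq> p"
proof -
  define Z where "Z = {G. F \<subseteq> G \<and> G \<subseteq> M \<and> (\<forall>F'. finite F' \<longrightarrow> F' \<subseteq> G \<longrightarrow> X \<inter> \<Inter>F' \<noteq> {})}"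
  have "\<exists>G\<in>Z. \<forall>H\<in>Z. G \<subseteq> H \<longrightarrow> H = G"
  proof (rule subset_Zorn_nonempty)
    show "Z \<noteq> {}" using assms by (auto simp: Z_def)
    fix \<C> assume C: "\<C> \<noteq> {}" "subset.chain Z \<C>"
    then have CZ: "\<C> \<subseteq> Z" by (auto simp: subset.chain_def)
    show "\<Union>\<C> \<in> Z"
      unfolding Z_def
    proof (intro CollectI conjI allI impI)
      have FC: "F \<subseteq> G \<and> G \<subseteq> M" if "G \<in> \<C>" for G
        using CZ that unfolding Z_def by blast
      then show "F \<subseteq> \<Union>\<C>" "\<Union>\<C> \<subseteq> M" using C(1) by blast+
      fix F' assume "finite F'" "F' \<subseteq> \<Union>\<C>"
      then obtain G where "G \<in> \<C>" "F' \<subseteq> G"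
        using finite_subset_Union_chain[OF _ _ C] by metis
      moreover from \<open>G \<in> \<C>\<close> have "\<forall>F'. finite F' \<longrightarrow> F' \<subseteq> G \<longrightarrow> X \<inter> \<Inter>F' \<noteq> {}"
        using CZ unfolding Z_def by blast
      ultimately show "X \<inter> \<Inter>F' \<noteq> {}" using \<open>finite F'\<close> by blast
    qed
  qed
  then obtain G where GZ: "G \<in> Z" and max: "\<forall>H\<in>Z. G \<subseteq> H \<longrightarrow> H = G" by (rule bexE)
  have G: "F \<subseteq> G" "G \<subseteq> M" "\<And>F'. finite F' \<Longrightarrow> F' \<subseteq> G \<Longrightarrow> X \<inter> \<Inter>F' \<noteq> {}"
    using GZ unfolding Z_def by simp_all
  have memI: "c \<in> G" if c: "c \<in> M" "\<And>F'. finite F' \<Longrightarrow> F' \<subseteq> G \<Longrightarrow> c \<inter> (X \<inter> \<Inter>F') \<noteq> {}" for c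
  proof -
    have "insert c G \<in> Z"
      unfolding Z_def
    proof (intro CollectI conjI allI impI)
      fix F' assume F': "finite F'" "F' \<subseteq> insert c G"
      have "c \<inter> (X \<inter> \<Inter>(F' - {c})) \<noteq> {}" using F' by (intro c) auto
      moreover have "c \<inter> (X \<inter> \<Inter>(F' - {c})) \<subseteq> X \<inter> \<Inter>F'" by auto
      ultimately show "X \<inter> \<Inter>F' \<noteq> {}" by blast
    qed (use G c in auto)
    then have "insert c G = G" using max subset_insertI by metis
    then show ?thesis by (metis insertI1)
  qed
  have "ultra X M G"
    unfolding ultra_def
  proof (intro conjI ballI impI)
    show "G \<subseteq> M" by fact
    show "X \<in> G" using G(3) by (intro memI) (auto simp: Int_absorb1)
    show "{} \<notin> G" using G(3)[of "{{}}"] by auto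
    show "a \<inter> b \<in> G" if "a \<in> G" "b \<in> G" for a b
    proof (rule memI)
      show "a \<inter> b \<in> M" using that G(2) by auto
      fix F' assume "finite F'" "F' \<subseteq> G"
      then have "X \<inter> \<Inter>(insert a (insert b F')) \<noteq> {}" using that by (intro G(3)) auto
      then show "a \<inter> b \<inter> (X \<inter> \<Inter>F') \<noteq> {}" by auto
    qed
    show "b \<in> G" if "a \<in> G" "b \<in> M" "a \<subseteq> b" for a b
    proof (rule memI)
      fix F' assume "finite F'" "F' \<subseteq> G"
      then have "X \<inter> \<Inter>(insert a F') \<noteq> {}" using that by (intro G(3)) auto
      then show "b \<inter> (X \<inter> \<Inter>F') \<noteq> {}" using that by auto
    qed fact
    show "a \<in> G \<or> X - a \<in> G" if a: "a \<in> M" for a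
    proof (rule ccontr)
      assume "\<not> (a \<in> G \<or> X - a \<in> G)"
      then have "\<not> (\<forall>F'. finite F' \<longrightarrow> F' \<subseteq> G \<longrightarrow> a \<inter> (X \<inter> \<Inter>F') \<noteq> {})"
        "\<not> (\<forall>F'. finite F' \<longrightarrow> F' \<subseteq> G \<longrightarrow> (X - a) \<inter> (X \<inter> \<Inter>F') \<noteq> {})"
        using memI[of a] memI[of "X - a"] a compl_sets[OF a] by blast+
      then obtain F1 F2 where F: "finite F1" "F1 \<subseteq> G" "a \<inter> (X \<inter> \<Inter>F1) = {}"
        "finite F2" "F2 \<subseteq> G" "(X - a) \<inter> (X \<inter> \<Inter>F2) = {}" by blast
      then have "X \<inter> \<Inter>(F1 \<union> F2) = {}" by blast
      then show False using G(3)[of "F1 \<union> F2"] F by auto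
    qed
  qed
  then show ?thesis using G by blast
qed

text \<open>
  If no finite subfamily of an open cover is a cover, the complements of the sets \<open>a\<close> for which \<open>h a\<close> lies
  in a member of the cover have the finite intersection property, and an ultrafilter containing them
  is not covered.
\<close>

lemma compact_stone: "compact_space K"
  unfolding compact_space_def compactin_def
proof (intro conjI allI impI)
  fix \<U> assume U: "(\<forall>U\<in>\<U>. openin K U) \<and> topspace K \<subseteq> \<Union>\<U>"
  show "\<exists>\<F>. finite \<F> \<and> \<F> \<subseteq> \<U> \<and> topspace K \<subseteq> \<Union>\<F>"
  proof (rule ccontr)
    assume no: "\<not> ?thesis"
    define F where "F = {b \<in> M. \<exists>U\<in>\<U>. h (X - b) \<subseteq> U}"
    have "\<exists>p. ultra X M p \<and> F \<subseteq> p"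
    proof (rule ultra_extend)
      show "F \<subseteq> M" by (auto simp: F_def)
      fix F' assume F': "finite F'" "F' \<subseteq> F"
      show "X \<inter> \<Inter>F' \<noteq> {}"
      proof
        assume "X \<inter> \<Inter>F' = {}"
        then have "X = (\<Union>b\<in>F'. X - b)" by auto
        from arg_cong[where f = h, OF this] have "h X = h (\<Union>b\<in>F'. X - b)" .
        also have "h (\<Union>b\<in>F'. X - b) = (\<Union>b\<in>F'. h (X - b))"
          by (rule hat_UN[OF F'(1)]) (use F' in \<open>auto simp: F_def\<close>)
        finally have "h X = (\<Union>b\<in>F'. h (X - b))" .
        moreover have "\<forall>b\<in>F'. \<exists>V. V \<in> \<U> \<and> h (X - b) \<subseteq> V" using F'(2) unfolding F_def by blast
        then obtain u where u: "\<forall>b\<in>F'. u b \<in> \<U> \<and> h (X - b) \<subseteq> u b" by (rule bchoice[THEN exE])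
        then have "(\<Union>b\<in>F'. h (X - b)) \<subseteq> \<Union>(u ` F')" by blast
        ultimately have "topspace K \<subseteq> \<Union>(u ` F')" unfolding topspace_stone by (simp only:)
        moreover have "u ` F' \<subseteq> \<U>" using u by blast
        ultimately show False using no F'(1) by (meson finite_imageI)
      qed
    qed
    then obtain p where p: "ultra X M p" "F \<subseteq> p" by blast
    then have "p \<in> topspace K" using hat_top by (simp add: topspace_stone)
    then obtain U1 where U1: "U1 \<in> \<U>" "p \<in> U1" using U by blast
    moreover have "openin K U1" using U1(1) U by blast
    ultimately obtain a where aM: "a \<in> M" and "p \<in> h a" "h a \<subseteq> U1" using openin_stoneD by blast
    then have a: "a \<in> p" "h a \<subseteq> U1" by (auto dest: hatD)
    have "X - (X - a) = a" using sets_into_space[OF aM] by blast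
    then have "X - a \<in> F" using a U1 aM by (auto simp: F_def)
    then show False using p ultra_Compl[OF p(1) aM] a by auto
  qed
qed simp

lemma Hausdorff_stone: "Hausdorff_space K"
  unfolding Hausdorff_space_def
proof (intro allI impI)
  fix p q assume pq: "p \<in> topspace K \<and> q \<in> topspace K \<and> p \<noteq> q"
  then have u: "ultra X M p" "ultra X M q" by (auto simp: topspace_stone hat_def)
  obtain a where a: "a \<in> M" "a \<in> p \<longleftrightarrow> a \<notin> q"
    using pq ultra_sets[OF u(1)] ultra_sets[OF u(2)] by blast
  define b where "b = (if a \<in> p then a else X - a)"
  have b: "b \<in> M" "b \<in> p" "X - b \<in> q"
    using a ultra_Compl[OF u(1) a(1)] ultra_Compl[OF u(2) a(1)] sets_into_space[OF a(1)]
    by (auto simp: b_def double_diff)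
  have "p \<in> h b" "q \<in> h (X - b)" using b u by (auto simp: hat_def)
  moreover have "disjnt (h b) (h (X - b))" unfolding hat_Compl[OF b(1)] disjnt_def by blast
  ultimately show "\<exists>U V. openin K U \<and> openin K V \<and> p \<in> U \<and> q \<in> V \<and> disjnt U V"
    using openin_hat[of b] openin_hat[of "X - b"] by (intro exI[of _ "h b"] exI[of _ "h (X - b)"]) simp
qed

lemma stone_space_stone: "stone_space K"
  unfolding stone_space_def
proof (intro conjI compact_stone Hausdorff_stone allI impI)
  fix U p assume U: "openin K U \<and> p \<in> U"
  then obtain a where "a \<in> M" "p \<in> h a" "h a \<subseteq> U" using openin_stoneD by blast
  then show "\<exists>V. openin K V \<and> closedin K V \<and> p \<in> V \<and> V \<subseteq> U"
    using openin_hat[of a] closedin_hat[of a] by (intro exI[of _ "h a"]) simp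
qed

text \<open>
  This is what reduces statements on compact sets to statements on the field.
\<close>

lemma clopen_between:
  assumes "compactin K C" "openin K U" "C \<subseteq> U"
  shows "\<exists>a\<in>M. C \<subseteq> h a \<and> h a \<subseteq> U"
proof -
  let ?V = "{h a |a. a \<in> M \<and> h a \<subseteq> U}"
  have "C \<subseteq> \<Union>?V"
  proof
    fix p assume "p \<in> C"
    then have "p \<in> U" using assms by auto
    then obtain a where "a \<in> M" "p \<in> h a" "h a \<subseteq> U" using openin_stoneD[OF assms(2)] by blast
    then show "p \<in> \<Union>?V" by blast
  qed
  moreover have "\<forall>V\<in>?V. openin K V" using openin_hat by auto
  ultimately obtain \<F> where F: "finite \<F>" "\<F> \<subseteq> ?V" "C \<subseteq> \<Union>\<F>"
    using assms(1) unfolding compactin_def by meson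
  then have "\<forall>V\<in>\<F>. \<exists>a. a \<in> M \<and> h a = V \<and> V \<subseteq> U" by blast
  then obtain f where f': "\<And>V. V \<in> \<F> \<Longrightarrow> f V \<in> M \<and> h (f V) = V \<and> V \<subseteq> U" by metis
  have f: "f V \<in> M" "h (f V) = V" "V \<subseteq> U" if "V \<in> \<F>" for V
    using f'[OF that] by simp_all
  have "h (\<Union>V\<in>\<F>. f V) = (\<Union>V\<in>\<F>. h (f V))" using F(1) f(1) by (intro hat_UN) auto
  also have "\<dots> = \<Union>\<F>" using f(2) by auto
  finally have "h (\<Union>V\<in>\<F>. f V) = \<Union>\<F>" .
  moreover have "(\<Union>V\<in>\<F>. f V) \<in> M" using F(1) f(1) by (intro finite_UN) auto
  moreover have "\<Union>\<F> \<subseteq> U" using f(3) by (simp add: Sup_le_iff)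
  ultimately show ?thesis using F(3) by (intro bexI[of _ "\<Union>V\<in>\<F>. f V"]) simp_all
qed

lemma hat_borel: "h a \<in> sets (borel_on K)"
  unfolding sets_borel_on by (intro sigma_sets.Basic) (simp add: openin_hat)

section \<open>The Radon measure of a charge\<close>

text \<open>
  The Borel sets of a Stone space can be many more than those generated by its clopen sets, so
  extending the charge to the latter would not suffice. Approximating open sets from inside by
  clopen sets, and then arbitrary sets from outside by open ones, reaches all Borel sets and gives
  regularity at the same time.
\<close>

definition inner_content :: "('a set \<Rightarrow> real) \<Rightarrow> 'a set set set \<Rightarrow> ennreal" where
  "inner_content \<nu> U = (SUP a\<in>{a\<in>M. h a \<subseteq> U}. ennreal (\<nu> a))"

definition outer_content :: "('a set \<Rightarrow> real) \<Rightarrow> 'a set set set \<Rightarrow> ennreal" where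
  "outer_content \<nu> E = (INF U\<in>{U. openin K U \<and> E \<subseteq> U}. inner_content \<nu> U)"

lemma inner_content_mono: "U \<subseteq> V \<Longrightarrow> inner_content \<nu> U \<le> inner_content \<nu> V"
  unfolding inner_content_def by (intro SUP_subset_mono) auto

lemma inner_content_ge: "a \<in> M \<Longrightarrow> h a \<subseteq> U \<Longrightarrow> ennreal (\<nu> a) \<le> inner_content \<nu> U"
  unfolding inner_content_def by (intro SUP_upper) auto

lemma inner_content_hat:
  assumes "charge M \<nu>" "a \<in> M"
  shows "inner_content \<nu> (h a) = ennreal (\<nu> a)"
proof (rule antisym)
  show "inner_content \<nu> (h a) \<le> ennreal (\<nu> a)"
    unfolding inner_content_def
    by (intro SUP_least ennreal_leI charge_mono[OF assms(1)] hat_subD) (use assms(2) in auto)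
qed (use assms inner_content_ge in auto)

lemma outer_content_open: "openin K U \<Longrightarrow> outer_content \<nu> U = inner_content \<nu> U"
  unfolding outer_content_def by (intro antisym INF_lower INF_greatest inner_content_mono) auto

lemma outer_content_mono: "E \<subseteq> F \<Longrightarrow> outer_content \<nu> E \<le> outer_content \<nu> F"
  unfolding outer_content_def by (intro INF_superset_mono) auto

lemma outer_content_hat: "charge M \<nu> \<Longrightarrow> a \<in> M \<Longrightarrow> outer_content \<nu> (h a) = ennreal (\<nu> a)"
  by (simp add: outer_content_open openin_hat inner_content_hat)

lemma outer_content_empty: "charge M \<nu> \<Longrightarrow> outer_content \<nu> {} = 0"
  using outer_content_hat[of \<nu> "{}"] by (simp add: hat_empty charge_empty)

text \<open>
  A clopen subset of the union is compact, hence a finite union of clopen sets each of which lies in one of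
  the given open sets. At this point compactness replaces countable additivity of the charge.
\<close>

lemma inner_content_UN_le:
  assumes \<nu>: "charge M \<nu>" and U: "\<And>i::nat. openin K (U i)"
  shows "inner_content \<nu> (\<Union>i. U i) \<le> (\<Sum>i. inner_content \<nu> (U i))"
  unfolding inner_content_def[of \<nu> "\<Union>i. U i"]
proof (rule SUP_least)
  fix a assume "a \<in> {a \<in> M. h a \<subseteq> (\<Union>i. U i)}"
  then have a: "a \<in> M" "h a \<subseteq> (\<Union>i. U i)" by auto
  have "compactin K (h a)"
    by (rule closedin_compact_space[OF compact_stone closedin_hat[OF a(1)]])
  moreover have "h a \<subseteq> \<Union>{h b |b. b \<in> M \<and> (\<exists>i. h b \<subseteq> U i)}"
  proof
    fix p assume p: "p \<in> h a"
    then obtain i where i: "p \<in> U i" using a by auto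
    then obtain b where "b \<in> M" "p \<in> h b" "h b \<subseteq> U i" using openin_stoneD[OF U] by blast
    then show "p \<in> \<Union>{h b |b. b \<in> M \<and> (\<exists>i. h b \<subseteq> U i)}" by blast
  qed
  moreover have "\<forall>V\<in>{h b |b. b \<in> M \<and> (\<exists>i. h b \<subseteq> U i)}. openin K V" using openin_hat by auto
  ultimately obtain \<F> where F: "finite \<F>" "\<F> \<subseteq> {h b |b. b \<in> M \<and> (\<exists>i. h b \<subseteq> U i)}" "h a \<subseteq> \<Union>\<F>"
    unfolding compactin_def by meson
  then have "\<forall>V\<in>\<F>. \<exists>b i. b \<in> M \<and> h b = V \<and> V \<subseteq> U i" by blast
  then obtain f \<iota> where f': "\<And>V. V \<in> \<F> \<Longrightarrow> f V \<in> M \<and> h (f V) = V \<and> V \<subseteq> U (\<iota> V)" by metis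
  have f: "f V \<in> M" "h (f V) = V" "V \<subseteq> U (\<iota> V)" if "V \<in> \<F>" for V
    using f'[OF that] by simp_all
  define c where "c i = (\<Union>V\<in>{V\<in>\<F>. \<iota> V = i}. f V)" for i
  have cM: "c i \<in> M" for i unfolding c_def using F(1) f(1) by (intro finite_UN) auto
  have hc: "h (c i) \<subseteq> U i" for i
  proof -
    have "h (c i) = (\<Union>V\<in>{V\<in>\<F>. \<iota> V = i}. h (f V))" unfolding c_def using F(1) f(1) by (intro hat_UN) auto
    also have "\<dots> = \<Union>{V\<in>\<F>. \<iota> V = i}" using f(2) by auto
    finally show ?thesis using f(3) by blast
  qed
  have fin: "finite (\<iota> ` \<F>)" using F by auto
  have "h (\<Union>i\<in>\<iota> ` \<F>. c i) = (\<Union>i\<in>\<iota> ` \<F>. h (c i))" by (intro hat_UN fin cM)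
  moreover have "V \<subseteq> h (c (\<iota> V))" if V: "V \<in> \<F>" for V
  proof -
    have "f V \<subseteq> c (\<iota> V)" using V by (auto simp: c_def)
    then have "h (f V) \<subseteq> h (c (\<iota> V))" by (rule hat_mono[OF f(1)[OF V] cM])
    then show ?thesis using f(2)[OF V] by simp
  qed
  then have "\<Union>\<F> \<subseteq> (\<Union>i\<in>\<iota> ` \<F>. h (c i))" by (intro Union_least) (meson UN_upper imageI order_trans)
  ultimately have "h a \<subseteq> h (\<Union>i\<in>\<iota> ` \<F>. c i)" using F(3) by (simp only:)
  then have "a \<subseteq> (\<Union>i\<in>\<iota> ` \<F>. c i)" by (rule hat_subD[OF a(1) finite_UN[OF fin cM]])
  then have "\<nu> a \<le> \<nu> (\<Union>i\<in>\<iota> ` \<F>. c i)" by (rule charge_mono[OF \<nu> a(1) finite_UN[OF fin cM]])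
  also have "\<dots> \<le> (\<Sum>i\<in>\<iota> ` \<F>. \<nu> (c i))" by (rule charge_UN_le[OF \<nu> fin cM])
  finally have "ennreal (\<nu> a) \<le> ennreal (\<Sum>i\<in>\<iota> ` \<F>. \<nu> (c i))" by (rule ennreal_leI)
  also have "\<dots> = (\<Sum>i\<in>\<iota> ` \<F>. ennreal (\<nu> (c i)))"
    by (rule sum_ennreal[symmetric]) (rule charge_nonneg[OF \<nu> cM])
  also have "\<dots> \<le> (\<Sum>i\<in>\<iota> ` \<F>. inner_content \<nu> (U i))"
    by (intro sum_mono inner_content_ge cM hc)
  also have "\<dots> \<le> (\<Sum>i. inner_content \<nu> (U i))"
    by (intro sum_le_suminf fin) auto
  finally show "ennreal (\<nu> a) \<le> (\<Sum>i. inner_content \<nu> (U i))" .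
qed

lemma outer_measure_space_outer:
  assumes \<nu>: "charge M \<nu>"
  shows "outer_measure_space (Pow (topspace K)) (outer_content \<nu>)"
  unfolding outer_measure_space_def
proof (intro conjI)
  show "positive (Pow (topspace K)) (outer_content \<nu>)" by (simp add: positive_def outer_content_empty[OF \<nu>])
  show "increasing (Pow (topspace K)) (outer_content \<nu>)" by (simp add: increasing_def outer_content_mono)
  show "countably_subadditive (Pow (topspace K)) (outer_content \<nu>)"
    unfolding countably_subadditive_def
  proof (intro allI impI)
    fix A :: "nat \<Rightarrow> 'a set set set"
    show "outer_content \<nu> (\<Union>i. A i) \<le> (\<Sum>i. outer_content \<nu> (A i))"
    proof (rule ennreal_le_epsilon)
      fix e :: real assume e: "0 < e" "(\<Sum>i. outer_content \<nu> (A i)) < top"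
      then have lt: "outer_content \<nu> (A i) < outer_content \<nu> (A i) + e * (1/2)^Suc i" for i
        by (auto simp add: less_top dest!: ennreal_suminf_lessD)
      have "\<exists>U. openin K U \<and> A i \<subseteq> U \<and> inner_content \<nu> U \<le> outer_content \<nu> (A i) + e * (1/2)^Suc i" for i
        using lt[of i] unfolding outer_content_def[of \<nu> "A i"] INF_less_iff by (auto intro: less_imp_le)
      then obtain U where U: "\<And>i. openin K (U i)" "\<And>i. A i \<subseteq> U i"
        "\<And>i. inner_content \<nu> (U i) \<le> outer_content \<nu> (A i) + e * (1/2)^Suc i" by metis
      have "outer_content \<nu> (\<Union>i. A i) \<le> outer_content \<nu> (\<Union>i. U i)" using U(2) by (intro outer_content_mono) auto
      also have "\<dots> = inner_content \<nu> (\<Union>i. U i)" using U(1) by (intro outer_content_open openin_Union) auto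
      also have "\<dots> \<le> (\<Sum>i. inner_content \<nu> (U i))" by (rule inner_content_UN_le[OF \<nu> U(1)])
      also have "\<dots> \<le> (\<Sum>i. outer_content \<nu> (A i) + e * (1/2)^Suc i)" by (intro suminf_le U) auto
      also have "\<dots> = (\<Sum>i. outer_content \<nu> (A i)) + (\<Sum>i. ennreal e * ennreal ((1/2) ^ Suc i))"
        using e by (subst suminf_add[symmetric])
          (auto simp del: ennreal_suminf_cmult simp add: ennreal_mult[symmetric])
      also have "\<dots> = (\<Sum>i. outer_content \<nu> (A i)) + e"
        unfolding ennreal_suminf_cmult
        by (subst suminf_ennreal_eq[OF zero_le_power power_half_series]) auto
      finally show "outer_content \<nu> (\<Union>i. A i) \<le> (\<Sum>i. outer_content \<nu> (A i)) + e" .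
    qed
  qed
qed

text \<open>
  Exhaust \<open>V \<inter> U\<close> by a clopen set \<open>h a\<close>, and the open set \<open>V - h a\<close> by another one. The two are
  disjoint, so their charges add up to at most the inner content of \<open>V\<close>.
\<close>

lemma outer_content_split:
  assumes \<nu>: "charge M \<nu>" and U: "openin K U" and V: "openin K V"
  shows "inner_content \<nu> (V \<inter> U) + outer_content \<nu> (V - U) \<le> inner_content \<nu> V"
proof -
  have "inner_content \<nu> (V \<inter> U) + outer_content \<nu> (V - U) = (SUP a\<in>{a\<in>M. h a \<subseteq> V \<inter> U}. ennreal (\<nu> a) + outer_content \<nu> (V - U))"
    unfolding inner_content_def by (subst ennreal_SUP_add_left) (auto intro!: exI[of _ "{}"] simp: hat_empty)
  also have "\<dots> \<le> inner_content \<nu> V"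
  proof (rule SUP_least)
    fix a assume "a \<in> {a \<in> M. h a \<subseteq> V \<inter> U}"
    then have a: "a \<in> M" "h a \<subseteq> V" "h a \<subseteq> U" by auto
    have op: "openin K (V - h a)" using V closedin_hat[OF a(1)] by auto
    have "outer_content \<nu> (V - U) \<le> outer_content \<nu> (V - h a)" using a by (intro outer_content_mono) auto
    also have "\<dots> = inner_content \<nu> (V - h a)" by (rule outer_content_open[OF op])
    finally have "ennreal (\<nu> a) + outer_content \<nu> (V - U) \<le> ennreal (\<nu> a) + inner_content \<nu> (V - h a)"
      by (rule add_left_mono)
    also have "\<dots> = (SUP b\<in>{b\<in>M. h b \<subseteq> V - h a}. ennreal (\<nu> a) + ennreal (\<nu> b))"
      unfolding inner_content_def by (subst ennreal_SUP_add_right) (auto intro!: exI[of _ "{}"] simp: hat_empty)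
    also have "\<dots> \<le> inner_content \<nu> V"
    proof (rule SUP_least)
      fix b assume "b \<in> {b \<in> M. h b \<subseteq> V - h a}"
      then have b: "b \<in> M" "h b \<subseteq> V" "h b \<inter> h a = {}" by auto
      then have "h (a \<inter> b) = h {}" using a by (simp add: hat_Int hat_empty Int_commute)
      then have "a \<inter> b = {}" using hat_subD[of "a \<inter> b" "{}"] a b by auto
      then have "ennreal (\<nu> a) + ennreal (\<nu> b) = ennreal (\<nu> (a \<union> b))"
        using charge_Un[OF \<nu> a(1) b(1)] charge_nonneg[OF \<nu>] a b by (simp add: ennreal_plus)
      also have "\<dots> \<le> inner_content \<nu> V" using a b by (intro inner_content_ge) (auto simp: hat_Un)
      finally show "ennreal (\<nu> a) + ennreal (\<nu> b) \<le> inner_content \<nu> V" .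
    qed
    finally show "ennreal (\<nu> a) + outer_content \<nu> (V - U) \<le> inner_content \<nu> V" .
  qed
  finally show ?thesis .
qed

lemma open_lambda_system:
  assumes \<nu>: "charge M \<nu>" and U: "openin K U"
  shows "U \<in> lambda_system (topspace K) (Pow (topspace K)) (outer_content \<nu>)"
proof -
  interpret P: sigma_algebra "topspace K" "Pow (topspace K)" by (rule sigma_algebra_Pow)
  note om = outer_measure_space_outer[OF \<nu>, unfolded outer_measure_space_def]
  have sa: "subadditive (Pow (topspace K)) (outer_content \<nu>)"
    using om by (intro P.countably_subadditive_subadditive) auto
  have "outer_content \<nu> (x \<inter> U) + outer_content \<nu> (x - U) = outer_content \<nu> x" if x: "x \<subseteq> topspace K" for x
  proof (rule antisym)
    have "outer_content \<nu> ((x \<inter> U) \<union> (x - U)) \<le> outer_content \<nu> (x \<inter> U) + outer_content \<nu> (x - U)"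
      by (rule subadditiveD[OF sa]) (use x in auto)
    then show "outer_content \<nu> x \<le> outer_content \<nu> (x \<inter> U) + outer_content \<nu> (x - U)" by (simp add: Int_Diff_Un)
    show "outer_content \<nu> (x \<inter> U) + outer_content \<nu> (x - U) \<le> outer_content \<nu> x"
      unfolding outer_content_def[of \<nu> x]
    proof (rule INF_greatest)
      fix V assume "V \<in> {U. openin K U \<and> x \<subseteq> U}"
      then have V: "openin K V" "x \<subseteq> V" by auto
      have "outer_content \<nu> (x \<inter> U) + outer_content \<nu> (x - U) \<le> outer_content \<nu> (V \<inter> U) + outer_content \<nu> (V - U)"
        using V by (intro add_mono outer_content_mono) auto
      also have "\<dots> = inner_content \<nu> (V \<inter> U) + outer_content \<nu> (V - U)"
        using outer_content_open[OF openin_Int[OF V(1) U]] by simp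
      also have "\<dots> \<le> inner_content \<nu> V" by (rule outer_content_split[OF \<nu> U V(1)])
      finally show "outer_content \<nu> (x \<inter> U) + outer_content \<nu> (x - U) \<le> inner_content \<nu> V" .
    qed
  qed
  then show ?thesis
    using openin_subset[OF U] unfolding P.lambda_system_eq by auto
qed

definition charge_measure :: "('a set \<Rightarrow> real) \<Rightarrow> 'a set set measure" where
  "charge_measure \<nu> = measure_of (topspace K) (sets (borel_on K)) (outer_content \<nu>)"

lemma sets_charge_measure: "sets (charge_measure \<nu>) = sets (borel_on K)"
  unfolding charge_measure_def
  by (metis sets.sigma_sets_eq sets.space_closed sets_measure_of space_borel_on)

lemma space_charge_measure: "space (charge_measure \<nu>) = topspace K"
  unfolding charge_measure_def by (metis sets.space_closed space_borel_on space_measure_of)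

lemma emeasure_charge_measure:
  assumes \<nu>: "charge M \<nu>" and A: "A \<in> sets (borel_on K)"
  shows "emeasure (charge_measure \<nu>) A = outer_content \<nu> A"
proof -
  let ?L = "lambda_system (topspace K) (Pow (topspace K)) (outer_content \<nu>)"
  interpret P: sigma_algebra "topspace K" "Pow (topspace K)" by (rule sigma_algebra_Pow)
  have ms: "measure_space (topspace K) ?L (outer_content \<nu>)"
    by (rule P.caratheodory_lemma[OF outer_measure_space_outer[OF \<nu>]])
  then interpret L: sigma_algebra "topspace K" ?L by (simp add: measure_space_def)
  have "sets (borel_on K) \<subseteq> ?L"
    unfolding sets_borel_on by (rule L.sigma_sets_subset) (use open_lambda_system[OF \<nu>] in auto)
  moreover have sig: "sigma_algebra (topspace K) (sets (borel_on K))"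
    using sets.sigma_algebra_axioms[of "borel_on K"] by simp
  ultimately have "measure_space (topspace K) (sets (borel_on K)) (outer_content \<nu>)"
    by (intro measure_down[OF ms])
  then show ?thesis
    unfolding charge_measure_def measure_space_def
    using A by (intro emeasure_measure_of_sigma sig) auto
qed

lemma measure_charge_measure_hat:
  assumes "charge M \<nu>" "a \<in> M"
  shows "measure (charge_measure \<nu>) (h a) = \<nu> a"
  using assms by (simp add: measure_def emeasure_charge_measure hat_borel outer_content_hat charge_nonneg)

text \<open>
  Inner regularity of a set is outer regularity of its complement, which holds by construction.
\<close>

lemma charge_measure_radon:
  assumes \<nu>: "charge M \<nu>" and 1: "\<nu> X = 1"
  shows "charge_measure \<nu> \<in> radon_prob K"
proof -
  let ?N = "charge_measure \<nu>"
  have op: "U \<in> sets ?N" if "openin K U" for U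
    using that unfolding sets_charge_measure sets_borel_on by (intro sigma_sets.Basic) simp
  interpret prob_space ?N
  proof
    show "emeasure ?N (space ?N) = 1"
      unfolding space_charge_measure topspace_stone
      using emeasure_charge_measure[OF \<nu> hat_borel[of X]] outer_content_hat[OF \<nu> top] 1 by simp
  qed
  have "emeasure ?N B = (SUP C \<in> {C. compactin K C \<and> C \<subseteq> B}. emeasure ?N C)" if B: "B \<in> sets ?N" for B
  proof (rule antisym)
    show "(SUP C \<in> {C. compactin K C \<and> C \<subseteq> B}. emeasure ?N C) \<le> emeasure ?N B"
      using B by (intro SUP_least emeasure_mono) auto
    show "emeasure ?N B \<le> (SUP C \<in> {C. compactin K C \<and> C \<subseteq> B}. emeasure ?N C)"
    proof (rule ennreal_le_epsilon)
      fix e :: real assume e: "e > 0"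
      define B' where "B' = space ?N - B"
      have B': "B' \<in> sets ?N" unfolding B'_def using B by auto
      have "outer_content \<nu> B' = emeasure ?N B'"
        using emeasure_charge_measure[OF \<nu>] B' by (simp add: sets_charge_measure)
      then have "outer_content \<nu> B' < ennreal (measure ?N B' + e)"
        using e by (simp add: emeasure_eq_measure ennreal_less_iff)
      then obtain U where U: "openin K U" "B' \<subseteq> U" "inner_content \<nu> U < ennreal (measure ?N B' + e)"
        unfolding outer_content_def INF_less_iff by auto
      have "emeasure ?N U = inner_content \<nu> U"
        using emeasure_charge_measure[OF \<nu>, of U] op[OF U(1)] outer_content_open[OF U(1)] by (simp add: sets_charge_measure)
      then have mU: "measure ?N U < measure ?N B' + e"
        using U(3) e unfolding emeasure_eq_measure
        by (metis ennreal_less_iff measure_nonneg)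
      define C where "C = topspace K - U"
      have C: "compactin K C" "C \<subseteq> B"
        using U by (auto simp: C_def B'_def space_charge_measure intro!: closedin_compact_space[OF compact_stone])
      have "measure ?N C = 1 - measure ?N U"
        using prob_compl[OF op[OF U(1)]] by (simp add: C_def space_charge_measure)
      moreover have "measure ?N B' = 1 - measure ?N B"
        using prob_compl[OF B] by (simp add: B'_def)
      ultimately have "measure ?N B \<le> measure ?N C + e" using mU by linarith
      then have "emeasure ?N B \<le> emeasure ?N C + ennreal e"
        using e by (simp add: emeasure_eq_measure flip: ennreal_plus)
      also have "\<dots> \<le> (SUP C \<in> {C. compactin K C \<and> C \<subseteq> B}. emeasure ?N C) + ennreal e"
        using C by (intro add_right_mono SUP_upper) auto
      finally show "emeasure ?N B \<le> (SUP C \<in> {C. compactin K C \<and> C \<subseteq> B}. emeasure ?N C) + ennreal e" .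
    qed
  qed
  then show ?thesis
    unfolding radon_prob_def using sets_charge_measure prob_space_axioms by auto
qed

end

context field_of_sets
begin

section \<open>Weak convergence on the Stone space\<close>

lemma radonD:
  assumes "\<mu> \<in> radon_prob K"
  shows "prob_space \<mu>" "sets \<mu> = sets (borel_on K)" "space \<mu> = topspace K"
  using assms sets_eq_imp_space_eq[of \<mu> "borel_on K"] by (auto simp: radon_prob_def)

lemma continuous_measurable:
  assumes "continuous_map K euclideanreal f" "\<mu> \<in> radon_prob K"
  shows "f \<in> borel_measurable \<mu>"
proof (rule borel_measurableI)
  fix S :: "real set" assume "open S"
  then have "openin K {x \<in> topspace K. f x \<in> S}"
    using assms(1) by (auto intro: openin_continuous_map_preimage)
  moreover have "f -` S \<inter> space \<mu> = {x \<in> topspace K. f x \<in> S}"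
    using radonD(3)[OF assms(2)] by auto
  ultimately show "f -` S \<inter> space \<mu> \<in> sets \<mu>"
    unfolding radonD(2)[OF assms(2)] sets_borel_on by (auto intro: sigma_sets.Basic)
qed

text \<open>
  Cover the space by finitely many clopen sets on which \<open>f\<close> varies by less than \<open>\<epsilon>\<close>, and make them disjoint
  one at a time.
\<close>

lemma continuous_approx:
  assumes f: "continuous_map K euclideanreal f" and \<epsilon>: "\<epsilon> > 0"
  shows "\<exists>B c. finite B \<and> B \<subseteq> M \<and> (\<forall>p\<in>topspace K. \<bar>f p - (\<Sum>b\<in>B. c b * indicator (h b) p)\<bar> < \<epsilon>)"
proof -
  have step: "\<exists>B c. finite B \<and> B \<subseteq> M \<and> (\<forall>b\<in>B. b \<subseteq> \<Union>\<A>) \<and>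
      (\<forall>p\<in>h (\<Union>\<A>). \<bar>f p - (\<Sum>b\<in>B. c b * indicator (h b) p)\<bar> < \<epsilon>)"
    if "finite \<A>" "\<And>a. a \<in> \<A> \<Longrightarrow> a \<in> M \<and> (\<exists>r. \<forall>p\<in>h a. \<bar>f p - r\<bar> < \<epsilon>)" for \<A>
    using that
  proof (induction \<A> rule: finite_induct)
    case empty
    show ?case by (intro exI[of _ "{}"]) (simp add: hat_empty)
  next
    case (insert a \<A>)
    have "\<exists>B c. finite B \<and> B \<subseteq> M \<and> (\<forall>b\<in>B. b \<subseteq> \<Union>\<A>) \<and>
      (\<forall>p\<in>h (\<Union>\<A>). \<bar>f p - (\<Sum>b\<in>B. c b * indicator (h b) p)\<bar> < \<epsilon>)"
      by (rule insert(3), rule insert(4), rule insertI2)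
    then obtain B c where B: "finite B" "B \<subseteq> M" "\<forall>b\<in>B. b \<subseteq> \<Union>\<A>"
      "\<forall>p\<in>h (\<Union>\<A>). \<bar>f p - (\<Sum>b\<in>B. c b * indicator (h b) p)\<bar> < \<epsilon>"
      by (elim exE conjE)
    from insert(4)[OF insertI1] obtain r where r: "a \<in> M" "\<forall>p\<in>h a. \<bar>f p - r\<bar> < \<epsilon>"
      by (elim exE conjE)
    have AM: "\<Union>\<A> \<in> M" using insert by (intro finite_Union) auto
    define d where "d = a - \<Union>\<A>"
    have d: "d \<in> M" "d \<inter> \<Union>\<A> = {}" using r AM by (auto simp: d_def)
    have un: "\<Union>(insert a \<A>) = \<Union>\<A> \<union> d" by (auto simp: d_def)
    have dis: "h d \<inter> h (\<Union>\<A>) = {}" using hat_Int[OF d(1) AM] d(2) by (simp add: hat_empty)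
    show ?case
    proof (cases "d \<in> B")
      case True
      \<comment> \<open>The new piece can coincide with an old one only if it is empty.\<close>
      then have "d = {}" using B(3) d(2) by blast
      then show ?thesis using B unfolding un by (intro exI[of _ B] exI[of _ c]) simp
    next
      case False
      have eq: "(\<Sum>b\<in>insert d B. (c(d := r)) b * indicator (h b) p) = r * indicator (h d) p + (\<Sum>b\<in>B. c b * indicator (h b) p)" for p
        using B(1) False by (subst sum.insert) (auto intro!: sum.cong)
      have "\<bar>f p - (\<Sum>b\<in>insert d B. (c(d := r)) b * indicator (h b) p)\<bar> < \<epsilon>" if p: "p \<in> h (\<Union>\<A> \<union> d)" for p
      proof (cases "p \<in> h d")
        case True
        then have "p \<notin> h (\<Union>\<A>)" using dis by auto
        then have "p \<notin> h b" if "b \<in> B" for b using that B(2,3) hat_mono[of b "\<Union>\<A>"] AM by blast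
        then have "(\<Sum>b\<in>B. c b * indicator (h b) p) = 0" by (intro sum.neutral) (auto simp: indicator_def)
        moreover have "p \<in> h a" using True hat_mono[OF d(1) r(1)] by (auto simp: d_def)
        ultimately show ?thesis unfolding eq using True r(2) by simp
      next
        case False
        then have "p \<in> h (\<Union>\<A>)" using p hat_Un[OF AM d(1)] by auto
        then show ?thesis unfolding eq using False B(4) by simp
      qed
      then show ?thesis
        unfolding un using B d(1) by (intro exI[of _ "insert d B"] exI[of _ "c(d := r)"]) auto
    qed
  qed
  have ex: "\<exists>a\<in>M. p \<in> h a \<and> (\<exists>r. \<forall>q\<in>h a. \<bar>f q - r\<bar> < \<epsilon>)" if p: "p \<in> topspace K" for p
  proof -
    have "openin K {q \<in> topspace K. f q \<in> ball (f p) \<epsilon>}"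
      using f by (intro openin_continuous_map_preimage[of K euclideanreal]) auto
    moreover have "p \<in> {q \<in> topspace K. f q \<in> ball (f p) \<epsilon>}" using p \<epsilon> by simp
    ultimately obtain a where a: "a \<in> M" "p \<in> h a" "h a \<subseteq> {q \<in> topspace K. f q \<in> ball (f p) \<epsilon>}"
      using openin_stoneD by meson
    have "\<forall>q\<in>h a. \<bar>f q - f p\<bar> < \<epsilon>" using a(3) by (auto simp: dist_real_def abs_minus_commute)
    then show ?thesis using a by blast
  qed
  let ?A = "{a \<in> M. \<exists>r. \<forall>q\<in>h a. \<bar>f q - r\<bar> < \<epsilon>}"
  have cover: "topspace K \<subseteq> \<Union>(h ` ?A)"
  proof
    fix p assume "p \<in> topspace K"
    from ex[OF this] show "p \<in> \<Union>(h ` ?A)" by blast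
  qed
  have opens: "\<forall>V\<in>h ` ?A. openin K V" by (simp add: openin_hat)
  from compact_stone[unfolded compact_space_def compactin_def, THEN conjunct2, THEN spec,
      of "h ` ?A", THEN mp, OF conjI[OF opens cover]]
  obtain \<F> where F: "finite \<F>" "\<F> \<subseteq> h ` ?A" "topspace K \<subseteq> \<Union>\<F>"
    by (elim exE conjE)
  from finite_subset_image[OF F(1,2)] obtain \<A> where A: "\<A> \<subseteq> ?A" "finite \<A>" "\<F> = h ` \<A>"
    by (elim exE conjE)
  then have A: "finite \<A>" "\<A> \<subseteq> ?A" "topspace K \<subseteq> \<Union>(h ` \<A>)"
    using F(3) by simp_all
  have "h (\<Union>a\<in>\<A>. a) = (\<Union>a\<in>\<A>. h a)" using A(1,2) by (intro hat_UN) auto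
  then have top: "topspace K \<subseteq> h (\<Union>\<A>)" using A(3) by simp
  have "\<exists>B c. finite B \<and> B \<subseteq> M \<and> (\<forall>b\<in>B. b \<subseteq> \<Union>\<A>) \<and>
      (\<forall>p\<in>h (\<Union>\<A>). \<bar>f p - (\<Sum>b\<in>B. c b * indicator (h b) p)\<bar> < \<epsilon>)"
    by (rule step[OF A(1)]) (use A(2) in blast)
  then obtain B c where B: "finite B" "B \<subseteq> M"
    "\<forall>p\<in>h (\<Union>\<A>). \<bar>f p - (\<Sum>b\<in>B. c b * indicator (h b) p)\<bar> < \<epsilon>"
    by (elim exE conjE)
  show ?thesis
    by (intro exI[of _ B] exI[of _ c] conjI B(1,2) ballI) (use B(3) top in blast)
qed

lemma integral_step:
  assumes "\<mu> \<in> radon_prob K" "finite B"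
  shows "integrable \<mu> (\<lambda>p. \<Sum>b\<in>B. c b * indicator (h b) p)"
    and "(\<integral>p. (\<Sum>b\<in>B. c b * indicator (h b) p) \<partial>\<mu>) = (\<Sum>b\<in>B. c b * measure \<mu> (h b))"
proof -
  interpret prob_space \<mu> by (rule radonD[OF assms(1)])
  have [measurable]: "h b \<in> sets \<mu>" for b by (simp add: radonD(2)[OF assms(1)] hat_borel)
  have int: "integrable \<mu> (\<lambda>p. c b * indicator (h b) p)" for b
    by (intro integrable_mult_right integrable_real_indicator) (auto simp: less_top[symmetric])
  show "integrable \<mu> (\<lambda>p. \<Sum>b\<in>B. c b * indicator (h b) p)"
    by (rule Bochner_Integration.integrable_sum) (rule int)
  show "(\<integral>p. (\<Sum>b\<in>B. c b * indicator (h b) p) \<partial>\<mu>) = (\<Sum>b\<in>B. c b * measure \<mu> (h b))"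
  proof (subst Bochner_Integration.integral_sum[OF int], rule sum.cong[OF refl])
    fix b
    have "h b \<inter> space \<mu> = h b" using hat_sub[of b] by (auto simp: radonD(3)[OF assms(1)] topspace_stone)
    then show "(\<integral>p. c b * indicator (h b) p \<partial>\<mu>) = c b * measure \<mu> (h b)" by simp
  qed
qed

lemma integral_approx:
  assumes \<mu>: "\<mu> \<in> radon_prob K" and f: "continuous_map K euclideanreal f" and B: "finite B"
    and ap: "\<forall>p\<in>topspace K. \<bar>f p - (\<Sum>b\<in>B. c b * indicator (h b) p)\<bar> < \<epsilon>"
  shows "\<bar>(\<integral>p. f p \<partial>\<mu>) - (\<Sum>b\<in>B. c b * measure \<mu> (h b))\<bar> \<le> \<epsilon>"
proof -
  interpret prob_space \<mu> by (rule radonD[OF \<mu>])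
  define s where "s p = (\<Sum>b\<in>B. c b * indicator (h b) p)" for p
  have s: "integrable \<mu> s" "integral\<^sup>L \<mu> s = (\<Sum>b\<in>B. c b * measure \<mu> (h b))"
    using integral_step[OF \<mu> B, of c] by (simp_all add: s_def[abs_def])
  have d: "integrable \<mu> (\<lambda>p. f p - s p)"
  proof (rule integrable_const_bound)
    show "AE p in \<mu>. norm (f p - s p) \<le> \<epsilon>"
      using ap by (intro AE_I2) (simp add: radonD(3)[OF \<mu>] s_def less_imp_le)
    show "(\<lambda>p. f p - s p) \<in> borel_measurable \<mu>"
      using continuous_measurable[OF f \<mu>] s(1) by (intro borel_measurable_diff) auto
  qed
  have "integrable \<mu> (\<lambda>p. (f p - s p) + s p)" using d s(1) by (rule Bochner_Integration.integrable_add)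
  then have fi: "integrable \<mu> f" by simp
  have "\<bar>(\<integral>p. f p - s p \<partial>\<mu>)\<bar> \<le> (\<integral>p. \<bar>f p - s p\<bar> \<partial>\<mu>)"
    using integral_norm_bound[of \<mu> "\<lambda>p. f p - s p"] by simp
  also have "\<dots> \<le> (\<integral>p. \<epsilon> \<partial>\<mu>)"
    using d ap by (intro integral_mono) (auto simp: radonD(3)[OF \<mu>] s_def less_imp_le)
  also have "\<dots> = \<epsilon>" by (simp add: prob_space)
  finally show ?thesis using fi s by simp
qed

text \<open>
  Indicators of clopen sets are continuous, and step functions over clopen sets are uniformly dense among
  the continuous functions.
\<close>

lemma limitin_iff_clopen:
  assumes m: "\<And>n. m n \<in> radon_prob K" and \<mu>: "\<mu> \<in> radon_prob K"
  shows "limitin (weak_star K) m \<mu> sequentially \<longleftrightarrow>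
    (\<forall>a\<in>M. (\<lambda>n. measure (m n) (h a)) \<longlonglongrightarrow> measure \<mu> (h a))"
  unfolding limitin_weak_star_iff[OF m \<mu>]
proof (intro iffI ballI allI impI)
  fix a assume a: "a \<in> M"
    and *: "\<forall>f. continuous_map K euclideanreal f \<longrightarrow> (\<lambda>n. integral\<^sup>L (m n) f) \<longlonglongrightarrow> integral\<^sup>L \<mu> f"
  have "continuous_map K euclideanreal (indicator (h a))"
    unfolding continuous_map_def
  proof (intro conjI allI impI)
    fix U :: "real set"
    have "{x \<in> topspace K. indicator (h a) x \<in> U} =
        (if 1 \<in> U then h a else {}) \<union> (if 0 \<in> U then topspace K - h a else {})"
      using hat_sub[of a] by (auto simp: topspace_stone indicator_def split: if_splits)
    moreover have "openin K (topspace K - h a)" using closedin_hat[OF a] by blast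
    ultimately show "openin K {x \<in> topspace K. indicator (h a) x \<in> U}"
      using openin_hat[of a] by auto
  qed auto
  then have "(\<lambda>n. integral\<^sup>L (m n) (indicat_real (h a))) \<longlonglongrightarrow> integral\<^sup>L \<mu> (indicat_real (h a))"
    by (rule *[rule_format])
  moreover have "integral\<^sup>L \<kappa> (indicat_real (h a)) = measure \<kappa> (h a)" if "\<kappa> \<in> radon_prob K" for \<kappa>
    using integral_step(2)[OF that, of "{a}" "\<lambda>_. 1"] by simp
  ultimately show "(\<lambda>n. measure (m n) (h a)) \<longlonglongrightarrow> measure \<mu> (h a)" using m \<mu> by simp
next
  fix f assume conv: "\<forall>a\<in>M. (\<lambda>n. measure (m n) (h a)) \<longlonglongrightarrow> measure \<mu> (h a)"
    and f: "continuous_map K euclideanreal f"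
  show "(\<lambda>n. integral\<^sup>L (m n) f) \<longlonglongrightarrow> integral\<^sup>L \<mu> f"
  proof (rule LIMSEQ_I)
    fix r :: real assume "r > 0"
    then have r: "r / 4 > 0" by simp
    from continuous_approx[OF f r] obtain B c where B: "finite B" "B \<subseteq> M"
      "\<forall>p\<in>topspace K. \<bar>f p - (\<Sum>b\<in>B. c b * indicator (h b) p)\<bar> < r / 4"
      by (elim exE conjE)
    have "(\<lambda>n. \<Sum>b\<in>B. c b * measure (m n) (h b)) \<longlonglongrightarrow> (\<Sum>b\<in>B. c b * measure \<mu> (h b))"
      using conv B(2) by (intro tendsto_sum tendsto_mult tendsto_const) auto
    from LIMSEQ_D[OF this r] obtain N where N: "\<forall>n\<ge>N.
        norm ((\<Sum>b\<in>B. c b * measure (m n) (h b)) - (\<Sum>b\<in>B. c b * measure \<mu> (h b))) < r / 4"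
      by (rule exE)
    show "\<exists>N. \<forall>n\<ge>N. norm (integral\<^sup>L (m n) f - integral\<^sup>L \<mu> f) < r"
    proof (intro exI[of _ N] allI impI)
      fix n assume n: "n \<ge> N"
      show "norm (integral\<^sup>L (m n) f - integral\<^sup>L \<mu> f) < r"
        using N[rule_format, OF n] integral_approx[OF m[of n] f B(1,3)] integral_approx[OF \<mu> f B(1,3)] \<open>r > 0\<close>
        unfolding real_norm_def by linarith
    qed
  qed
qed

section \<open>The two hierarchies agree\<close>

text \<open>
  The charge only sees clopen sets, but the measure is supported on \<open>F\<close>: a compact set disjoint from
  \<open>F\<close> lies in a clopen set disjoint from \<open>F\<close>, which is null, and inner regularity gives that the complement
  of \<open>F\<close> is null. The mass of a single point is found by a clopen set that isolates it within \<open>F\<close>.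
\<close>

lemma radon_atomic:
  assumes \<mu>: "\<mu> \<in> radon_prob K" and F: "finite F" "\<forall>p\<in>F. ultra X M p" "\<forall>p. 0 \<le> w p"
    and eq: "\<forall>a\<in>M. measure \<mu> (h a) = (\<Sum>p\<in>F. w p * of_bool (a \<in> p))" and B: "B \<in> sets \<mu>"
  shows "measure \<mu> B = (\<Sum>p\<in>F. w p * indicator B p)"
proof -
  interpret prob_space \<mu> by (rule radonD[OF \<mu>])
  have FK: "F \<subseteq> topspace K" using F(2) hat_top by (auto simp: topspace_stone)
  have opn: "U \<in> sets \<mu>" if "openin K U" for U
    using that unfolding radonD(2)[OF \<mu>] sets_borel_on by (intro sigma_sets.Basic) simp
  have cl: "closedin K G" if "G \<subseteq> F" for G
    using finite_subset[OF that F(1)] that FK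
    by (intro closedin_Hausdorff_finite[OF Hausdorff_stone]) auto
  have clm: "G \<in> sets \<mu>" if "G \<subseteq> F" for G
  proof -
    have "topspace K - (topspace K - G) \<in> sets \<mu>"
      using opn[of "topspace K - G"] cl[OF that] sets.compl_sets[of "topspace K - G" \<mu>]
      by (simp add: radonD(3)[OF \<mu>] closedin_def)
    moreover have "topspace K - (topspace K - G) = G" using that FK by auto
    ultimately show ?thesis by simp
  qed
  have null: "measure \<mu> (topspace K - F) = 0"
  proof -
    have op: "openin K (topspace K - F)" using cl[of F] by auto
    have "emeasure \<mu> (topspace K - F) = (SUP C \<in> {C. compactin K C \<and> C \<subseteq> topspace K - F}. emeasure \<mu> C)"
      using \<mu> opn[OF op] unfolding radon_prob_def by blast
    also have "\<dots> \<le> 0"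
    proof (rule SUP_least)
      fix C assume "C \<in> {C. compactin K C \<and> C \<subseteq> topspace K - F}"
      then obtain a where a: "a \<in> M" "C \<subseteq> h a" "h a \<subseteq> topspace K - F"
        using clopen_between[OF _ op] by blast
      have "p \<in> F \<Longrightarrow> a \<notin> p" for p using a(3) F(2) by (auto simp: hat_def)
      then have "measure \<mu> (h a) = 0" using eq a(1) by (auto intro!: sum.neutral)
      moreover have "emeasure \<mu> C \<le> emeasure \<mu> (h a)"
        using a(2) by (intro emeasure_mono) (auto simp: radonD(2)[OF \<mu>] hat_borel)
      ultimately show "emeasure \<mu> C \<le> 0" by (simp add: emeasure_eq_measure)
    qed
    finally show ?thesis by (simp add: measure_def)
  qed
  have outside: "measure \<mu> A = 0" if "A \<in> sets \<mu>" "A \<inter> F = {}" for A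
  proof -
    have "A \<subseteq> topspace K - F" using that sets.sets_into_space[OF that(1)] radonD(3)[OF \<mu>] by auto
    then have "measure \<mu> A \<le> measure \<mu> (topspace K - F)"
      using cl[of F] by (intro finite_measure_mono opn) auto
    then show ?thesis using null by (simp add: measure_le_0_iff)
  qed
  have single: "measure \<mu> {p} = w p" if p: "p \<in> F" for p
  proof -
    have op: "openin K (topspace K - (F - {p}))" using cl[of "F - {p}"] by auto
    have "compactin K {p}" using p FK by auto
    then obtain a where a: "a \<in> M" "{p} \<subseteq> h a" "h a \<subseteq> topspace K - (F - {p})"
      using clopen_between[OF _ op, of "{p}"] p FK by blast
    have aq: "q \<in> F \<Longrightarrow> a \<in> q \<longleftrightarrow> q = p" for q using a(2,3) F(2) by (auto simp: hat_def)
    have "(\<Sum>q\<in>F. w q * of_bool (a \<in> q)) = (\<Sum>q\<in>F. if q = p then w q else 0)"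
      by (intro sum.cong) (auto simp: aq)
    also have "\<dots> = w p" using F(1) p by simp
    finally have "measure \<mu> (h a) = w p" using eq a(1) by simp
    moreover have "measure \<mu> (h a) = measure \<mu> {p} + measure \<mu> (h a - {p})"
      using a(2) clm[of "{p}"] p hat_borel[of a] radonD(2)[OF \<mu>]
      by (subst finite_measure_Union[symmetric]) (auto simp: insert_absorb)
    moreover have "measure \<mu> (h a - {p}) = 0"
      using a(3) clm[of "{p}"] p hat_borel[of a] radonD(2)[OF \<mu>] by (intro outside) auto
    ultimately show ?thesis by simp
  qed
  have "measure \<mu> B = measure \<mu> (B \<inter> F) + measure \<mu> (B - F)"
    using B clm[of "B \<inter> F"] clm[of F] finite_measure_Union[of "B \<inter> F" "B - F"]
    by (auto simp: Int_Diff_Un)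
  also have "measure \<mu> (B - F) = 0" using B clm[of F] by (intro outside) auto
  also have "measure \<mu> (B \<inter> F) = (\<Sum>p\<in>B \<inter> F. measure \<mu> {p})"
    using F(1) clm by (intro finite_measure_eq_sum_singleton) auto
  also have "\<dots> = (\<Sum>p\<in>B \<inter> F. w p)" using single by (intro sum.cong) auto
  also have "\<dots> = (\<Sum>p\<in>F. w p * indicator B p)"
    using F(1) by (intro sum.mono_neutral_cong_left) (auto simp: indicator_def)
  finally show ?thesis by simp
qed

text \<open>
  Above level 0 the only obstacle is normalisation: the charges in a sequence converging to a
  probability need not have total mass 1, but their masses converge to 1, so a tail of the sequence
  can be rescaled.
\<close>

lemma seq_level_iff_lev:
  "\<mu> \<in> seq_level K (topspace K) \<beta> \<longleftrightarrow> \<mu> \<in> radon_prob K \<and> lev X M \<beta> (\<lambda>a. measure \<mu> (h a))"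
proof (induction \<beta> arbitrary: \<mu> rule: less_induct)
  case (less \<beta>)
  show ?case
  proof (cases "\<beta> = 0")
    case True
    have "\<mu> \<in> conv_dirac K (topspace K) \<longleftrightarrow> \<mu> \<in> radon_prob K \<and> atomic X M (\<lambda>a. measure \<mu> (h a))"
    proof (intro iffI conjI)
      assume "\<mu> \<in> conv_dirac K (topspace K)"
      then obtain F w where F: "\<mu> \<in> radon_prob K" "finite F" "F \<subseteq> topspace K" "\<forall>p\<in>F. 0 \<le> w p"
        "\<forall>B\<in>sets (borel_on K). measure \<mu> B = (\<Sum>p\<in>F. w p * measure (return (borel_on K) p) B)"
        unfolding conv_dirac_def by blast
      show "\<mu> \<in> radon_prob K" by fact
      have u: "ultra X M p" if "p \<in> F" for p using that F(3) by (auto simp: topspace_stone dest: hat_ultra)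
      have "atomic X M (\<lambda>a. \<Sum>p\<in>F. w p * of_bool (a \<in> p))" using F u by (intro atomic_sum) auto
      then show "atomic X M (\<lambda>a. measure \<mu> (h a))"
      proof (rule atomic_cong)
        fix a
        have "measure \<mu> (h a) = (\<Sum>p\<in>F. w p * measure (return (borel_on K) p) (h a))"
          using F(5) hat_borel[of a] by (rule bspec)
        also have "\<dots> = (\<Sum>p\<in>F. w p * of_bool (a \<in> p))"
        proof (rule sum.cong[OF refl])
          fix p assume "p \<in> F"
          then show "w p * measure (return (borel_on K) p) (h a) = w p * of_bool (a \<in> p)"
            unfolding measure_return[OF hat_borel] using u[of p] by (simp add: indicator_def hat_def)
        qed
        finally show "measure \<mu> (h a) = (\<Sum>p\<in>F. w p * of_bool (a \<in> p))" .
      qed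
    next
      assume *: "\<mu> \<in> radon_prob K \<and> atomic X M (\<lambda>a. measure \<mu> (h a))"
      then have \<mu>: "\<mu> \<in> radon_prob K" by simp
      interpret prob_space \<mu> by (rule radonD[OF \<mu>])
      from atomicE_sum[OF conjunct2[OF *]]
      obtain F w where F: "finite F" "\<forall>p\<in>F. ultra X M p" "\<forall>p. 0 \<le> w p"
        "\<forall>a\<in>M. measure \<mu> (h a) = (\<Sum>p\<in>F. w p * of_bool (a \<in> p))"
        by (elim exE conjE)
      note m = radon_atomic[OF \<mu> F]
      have FK: "F \<subseteq> topspace K" using F(2) hat_top by (auto simp: topspace_stone)
      have "1 = (\<Sum>p\<in>F. w p * indicator (topspace K) p)"
        using m[OF sets.top] prob_space unfolding radonD(3)[OF \<mu>] by simp
      also have "\<dots> = sum w F" using FK by (intro sum.cong) auto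
      finally have "sum w F = 1" by simp
      moreover have "measure \<mu> B = (\<Sum>p\<in>F. w p * measure (return (borel_on K) p) B)"
        if "B \<in> sets (borel_on K)" for B
        using m[of B] that by (simp add: radonD(2)[OF \<mu>] measure_return)
      ultimately show "\<mu> \<in> conv_dirac K (topspace K)"
        unfolding conv_dirac_def using \<mu> F FK by blast
    qed
    then show ?thesis using True by (simp add: seq_level_0 lev_0_iff)
  next
    case False
    then have pos: "0 < \<beta>" using zero_le_ordinal[of \<beta>] by simp
    show ?thesis
    proof (intro iffI conjI)
      assume *: "\<mu> \<in> seq_level K (topspace K) \<beta>"
      then show \<mu>: "\<mu> \<in> radon_prob K" using seq_level_subset by blast
      obtain m where m: "\<forall>n::nat. \<exists>\<gamma><\<beta>. m n \<in> seq_level K (topspace K) \<gamma>" "limitin (weak_star K) m \<mu> sequentially"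
        using * unfolding seq_level_pos[OF pos] by blast
      then obtain \<gamma> where \<gamma>: "\<And>n. \<gamma> n < \<beta>" "\<And>n. m n \<in> seq_level K (topspace K) (\<gamma> n)" by metis
      have mr: "m n \<in> radon_prob K" for n using \<gamma>(2)[of n] seq_level_subset by blast
      show "lev X M \<beta> (\<lambda>a. measure \<mu> (h a))"
      proof (rule lev.lim[OF pos \<gamma>(1)])
        show "lev X M (\<gamma> n) (\<lambda>a. measure (m n) (h a))" for n using less[OF \<gamma>(1)] \<gamma>(2) by blast
        show "(\<lambda>n. measure (m n) (h a)) \<longlonglongrightarrow> measure \<mu> (h a)" if "a \<in> M" for a
          using limitin_iff_clopen[of m, OF mr \<mu>] m(2) that by blast
      qed
    next
      assume *: "\<mu> \<in> radon_prob K \<and> lev X M \<beta> (\<lambda>a. measure \<mu> (h a))"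
      then have \<mu>: "\<mu> \<in> radon_prob K" and lev: "lev X M \<beta> (\<lambda>a. measure \<mu> (h a))" by auto
      interpret prob_space \<mu> by (rule radonD[OF \<mu>])
      from lev_posD[OF lev pos] obtain \<gamma> m where m: "\<forall>n. \<gamma> n < \<beta>" "\<forall>n. lev X M (\<gamma> n) (m n)"
        "\<forall>a\<in>M. (\<lambda>n. m n a) \<longlonglongrightarrow> measure \<mu> (h a)" by (elim exE conjE)
      have hX: "measure \<mu> (h X) = 1" using prob_space by (simp add: radonD(3)[OF \<mu>] topspace_stone)
      then have mX: "(\<lambda>n. m n X) \<longlonglongrightarrow> 1" using m(3) top by metis
      then have "\<forall>\<^sub>F n in sequentially. 0 < m n X" by (rule order_tendstoD) simp
      then obtain N where N: "\<And>n. n \<ge> N \<Longrightarrow> 0 < m n X" by (auto simp: eventually_sequentially)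
      define c where "c n a = (1 / m (n + N) X) * m (n + N) a" for n a
      have lev_c: "lev X M (\<gamma> (n + N)) (c n)" for n
        unfolding c_def using m(2) N[of "n + N"] by (intro lev_scale) (auto intro: less_imp_le)
      have cX: "c n X = 1" for n using N[of "n + N"] by (simp add: c_def)
      have ch: "charge M (c n)" for n by (rule charge_lev[OF algebra_axioms lev_c])
      define R where "R n = charge_measure (c n)" for n
      have R: "R n \<in> radon_prob K" for n unfolding R_def by (rule charge_measure_radon[OF ch cX])
      have Rh: "measure (R n) (h a) = c n a" if "a \<in> M" for n a
        unfolding R_def by (rule measure_charge_measure_hat[OF ch that])
      have "R n \<in> seq_level K (topspace K) (\<gamma> (n + N))" for n
        by (rule less[OF m(1)[rule_format], THEN iffD2, OF conjI[OF R lev_cong[OF lev_c Rh]]])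
      moreover have "limitin (weak_star K) R \<mu> sequentially"
        unfolding limitin_iff_clopen[OF R \<mu>]
      proof
        fix a assume a: "a \<in> M"
        have "(\<lambda>n. (1 / m (n + N) X) * m (n + N) a) \<longlonglongrightarrow> (1 / 1) * measure \<mu> (h a)"
          using LIMSEQ_ignore_initial_segment[OF mX, of N] LIMSEQ_ignore_initial_segment[OF m(3)[rule_format, OF a], of N]
          by (intro tendsto_mult tendsto_divide tendsto_const) auto
        then show "(\<lambda>n. measure (R n) (h a)) \<longlonglongrightarrow> measure \<mu> (h a)"
          by (simp add: Rh[OF a] c_def)
      qed
      ultimately show "\<mu> \<in> seq_level K (topspace K) \<beta>"
        unfolding seq_level_pos[OF pos] using m(1) by (intro CollectI exI[of _ R] conjI allI) auto
    qed
  qed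
qed

end

section \<open>Construction of all levels\<close>

lemma card_prefix_cell:
  assumes "i \<le> j"
  shows "card {u::nat \<Rightarrow> bool. (\<forall>k\<ge>j. \<not> u k) \<and> (\<forall>k<i. u k = s k)} = 2 ^ (j - i)"
proof -
  let ?S = "{u::nat \<Rightarrow> bool. (\<forall>k\<ge>j. \<not> u k) \<and> (\<forall>k<i. u k = s k)}"
  have "bij_betw (\<lambda>u. {k\<in>{i..<j}. u k}) ?S (Pow {i..<j})"
  proof (rule bij_betwI[where g = "\<lambda>S k. if k < i then s k else k \<in> S"])
    show "(\<lambda>S k. if k < i then s k else k \<in> S) \<in> Pow {i..<j} \<rightarrow> ?S" using assms by auto
    show "(\<lambda>k. if k < i then s k else k \<in> {k \<in> {i..<j}. u k}) = u" if "u \<in> ?S" for u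
    proof
      fix k show "(if k < i then s k else k \<in> {k \<in> {i..<j}. u k}) = u k"
        using that by (cases "k < j") auto
    qed
  qed auto
  then have "card ?S = card (Pow {i..<j})" by (rule bij_betw_same_card)
  then show ?thesis by (simp add: card_Pow)
qed

text \<open>
  On a finite set every charge is a combination of point masses, so at level 0 there is nothing more
  to reach.
\<close>

lemma charge_Pow_atomic:
  assumes "finite X" "charge (Pow X) \<nu>"
  shows "atomic X (Pow X) \<nu>"
proof -
  interpret algebra X "Pow X" by (rule algebra_Pow)
  have "atomic X (Pow X) (\<lambda>a. \<Sum>x\<in>Y. \<nu> {x} * of_bool (x \<in> a))" if "finite Y" "Y \<subseteq> X" for Y
    using that
  proof (induction Y rule: finite_induct)
    case empty
    show ?case by (rule atomic.zero) simp
  next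
    case (insert x Y)
    show ?case
    proof (rule atomic.add[where p = "{a \<in> Pow X. x \<in> a}" and w = "\<nu> {x}"])
      show "atomic X (Pow X) (\<lambda>a. \<Sum>x\<in>Y. \<nu> {x} * of_bool (x \<in> a))" using insert by auto
      show "ultra X (Pow X) {a \<in> Pow X. x \<in> a}" using insert by (auto simp: ultra_def)
      show "0 \<le> \<nu> {x}" using insert by (intro charge_nonneg[OF assms(2)]) auto
    qed (use insert in auto)
  qed
  then have "atomic X (Pow X) (\<lambda>a. \<Sum>x\<in>X. \<nu> {x} * of_bool (x \<in> a))" using assms(1) by auto
  then show ?thesis
  proof (rule atomic_cong)
    fix a assume a: "a \<in> Pow X"
    then have fin: "finite a" using assms(1) finite_subset by auto
    have "\<nu> (\<Union>x\<in>a. {x}) = (\<Sum>x\<in>a. \<nu> {x})"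
      using a fin by (intro charge_UN_disjoint[OF assms(2)]) (auto simp: disjoint_family_on_def)
    also have "\<dots> = (\<Sum>x\<in>X. \<nu> {x} * of_bool (x \<in> a))"
      using a assms(1) by (intro sum.mono_neutral_cong_left) auto
    finally show "\<nu> a = (\<Sum>x\<in>X. \<nu> {x} * of_bool (x \<in> a))" by simp
  qed
qed

text \<open>
  The points are the bit sequences of length \<open>j\<close>, coded as reals, with the uniform distribution. Each is
  its own label.
\<close>

lemma exact_level_0: "\<exists>X M \<mu> t. exact_level 0 j (X :: real set) M \<mu> t"
proof -
  define R where "R = {u::nat \<Rightarrow> bool. \<forall>k\<ge>j. \<not> u k}"
  have finR: "finite R" unfolding R_def by (rule finite_prefixes)
  define g where "g u = real (to_nat_on R u)" for u
  have inj: "inj_on g R"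
    unfolding g_def using inj_on_to_nat_on[OF countable_finite[OF finR]] by (auto simp: inj_on_def)
  define X where "X = g ` R"
  define t where "t = inv_into R g"
  have t: "t (g u) = u" if "u \<in> R" for u unfolding t_def by (rule inv_into_f_f[OF inj that])
  have finX: "finite X" using finR by (simp add: X_def)
  define \<mu> where "\<mu> a = real (card a) / 2^j" for a :: "real set"
  interpret algebra X "Pow X" by (rule algebra_Pow)
  have ch: "charge (Pow X) \<mu>"
  proof (rule chargeI)
    fix a b assume "a \<in> Pow X" "b \<in> Pow X" "a \<inter> b = {}"
    then show "\<mu> (a \<union> b) = \<mu> a + \<mu> b"
      using finX finite_subset[of _ X] by (simp add: \<mu>_def card_Un_disjoint add_divide_distrib)
  qed (simp add: \<mu>_def)
  have \<mu>cell: "\<mu> (cell X t i s) = (1/2)^i" if "i \<le> j" for i s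
  proof -
    have "cell X t i s = g ` {u. (\<forall>k\<ge>j. \<not> u k) \<and> (\<forall>k<i. u k = s k)}"
      using t by (auto simp: cell_def X_def R_def)
    moreover have "inj_on g {u. (\<forall>k\<ge>j. \<not> u k) \<and> (\<forall>k<i. u k = s k)}"
      by (rule inj_on_subset[OF inj]) (auto simp: R_def)
    ultimately have card: "card (cell X t i s) = 2 ^ (j - i)"
      using card_prefix_cell[OF that, of s] by (simp only: card_image)
    have "(2::real) ^ j = 2 ^ (j - i) * 2 ^ i" using that by (simp flip: power_add)
    then show ?thesis unfolding \<mu>_def card by (simp add: power_one_over)
  qed
  have "cell X t 0 (\<lambda>_. False) = X" by (simp add: cell_def)
  then have "\<mu> X = 1" using \<mu>cell[of 0 "\<lambda>_. False"] by simp
  moreover have "lev X (Pow X) (osuc 0) \<nu>" if "lev X (Pow X) \<beta> \<nu>" for \<beta> \<nu>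
  proof -
    have "atomic X (Pow X) \<nu>"
      by (rule charge_Pow_atomic[OF finX charge_lev[OF algebra_axioms that]])
    then show ?thesis using lev_mono[OF lev.base zero_le_ordinal] by blast
  qed
  moreover have "lev X (Pow X) 0 \<mu>" by (rule lev.base[OF charge_Pow_atomic[OF finX ch]])
  moreover have "\<not> \<beta> < 0" for \<beta> :: ordinal using zero_le_ordinal[of \<beta>] by simp
  ultimately have "exact_level 0 j X (Pow X) \<mu> t"
    unfolding exact_level_def using algebra_axioms \<mu>cell by (auto simp: cell_def)
  then show ?thesis by blast
qed

text \<open>
  The running maximum of an enumeration of the countably many smaller ordinals. For a successor
  \<open>\<alpha> = \<gamma> + 1\<close> it is eventually equal to \<open>\<gamma>\<close>, for a limit it increases to \<open>\<alpha>\<close>; the construction treats both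
  cases alike.
\<close>

lemma ordinal_cofinal_sequence:
  fixes \<alpha> :: ordinal
  assumes "0 < \<alpha>" "\<alpha> < omega1"
  shows "\<exists>\<alpha>s. mono \<alpha>s \<and> (\<forall>n::nat. \<alpha>s n < \<alpha>) \<and> (\<forall>\<beta><\<alpha>. \<exists>n. \<beta> \<le> \<alpha>s n)"
proof -
  have c: "countable {..<\<alpha>}" "{..<\<alpha>} \<noteq> {}" using assms less_omega1_iff by auto
  define f where "f = from_nat_into {..<\<alpha>}"
  have f: "f n < \<alpha>" for n using from_nat_into[OF c(2), of n] by (simp add: f_def)
  have onto: "\<exists>n. f n = \<beta>" if "\<beta> < \<alpha>" for \<beta>
    using from_nat_into_surj[OF c(1), of \<beta>] that by (auto simp: f_def)
  define \<alpha>s where "\<alpha>s n = Max (f ` {..n})" for n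
  have "mono \<alpha>s" unfolding \<alpha>s_def by (intro monoI Max_mono) auto
  moreover have "\<alpha>s n < \<alpha>" for n unfolding \<alpha>s_def using f by (subst Max_less_iff) auto
  moreover have "\<exists>n. \<beta> \<le> \<alpha>s n" if \<beta>: "\<beta> < \<alpha>" for \<beta>
  proof -
    obtain n where "f n = \<beta>" using onto[OF \<beta>] by blast
    then have "\<beta> \<le> \<alpha>s n" unfolding \<alpha>s_def by (intro Max_ge) auto
    then show ?thesis ..
  qed
  ultimately show ?thesis by blast
qed

lemma inj_pairing: "inj (\<lambda>(n::nat, x::real). 4 * real n + arctan x)"
proof (rule injI, clarify)
  fix n m :: nat and x y :: real
  assume eq: "4 * real n + arctan x = 4 * real m + arctan y"
  \<comment> \<open>The arctangent places each copy of the line in an interval of length less than 4.\<close>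
  have "\<bar>arctan x\<bar> < 2" "\<bar>arctan y\<bar> < 2"
    using arctan_bounded[of x] arctan_bounded[of y] pi_less_4 by (auto simp: abs_less_iff)
  then have "n = m" using eq by linarith
  then show "n = m \<and> x = y" using eq by (simp add: arctan_eq_iff)
qed

theorem exact_level_exists: "\<alpha> < omega1 \<Longrightarrow> \<exists>X M \<mu> t. exact_level \<alpha> j (X :: real set) M \<mu> t"
proof (induction \<alpha> arbitrary: j rule: less_induct)
  case (less \<alpha>)
  show ?case
  proof (cases "\<alpha> = 0")
    case True
    then show ?thesis using exact_level_0 by simp
  next
    case False
    then have "0 < \<alpha>" using zero_le_ordinal[of \<alpha>] by simp
    then obtain \<alpha>s where \<alpha>s: "mono \<alpha>s" "\<And>n::nat. \<alpha>s n < \<alpha>" "\<And>\<beta>. \<beta> < \<alpha> \<Longrightarrow> \<exists>n. \<beta> \<le> \<alpha>s n"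
      using ordinal_cofinal_sequence less(2) by blast
    have "\<exists>X M \<mu> t. exact_level (\<alpha>s n) n (X :: real set) M \<mu> t" for n
      using less(1)[OF \<alpha>s(2)] less_trans[OF \<alpha>s(2) less(2)] by blast
    then obtain Xs Ms \<mu>s ts where "\<And>n. exact_level (\<alpha>s n) n (Xs n :: real set) (Ms n) (\<mu>s n) (ts n)" by metis
    then interpret tower "\<lambda>(n, x). 4 * real n + arctan x" Xs Ms \<mu>s ts \<alpha>s \<alpha>
      using \<alpha>s inj_pairing by unfold_locales
    show ?thesis using exact_level_product by blast
  qed
qed

text \<open>
  The lower bound of the invariant applied to \<open>\<mu>\<close> itself: if \<open>\<mu>\<close> belonged to a level below \<open>\<alpha>\<close>, it would
  be singular to itself, which is impossible for a charge of mass 1.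
\<close>

theorem theorem1p4:
  fixes \<alpha> :: ordinal
  assumes "1 \<le> \<alpha>" and "\<alpha> < omega1"
  shows "\<exists>(K :: real set set topology) \<mu>.
    stone_space K \<and> \<mu> \<in> radon_prob K \<and>
    \<mu> \<in> seq_level K (topspace K) \<alpha> - (\<Union>\<beta>\<in>{..<\<alpha>}. seq_level K (topspace K) \<beta>) \<and>
    seq_closure K (topspace K) = seq_level K (topspace K) (osuc \<alpha>)"
proof -
  obtain X :: "real set" and M \<nu> t where g: "exact_level \<alpha> 0 X M \<nu> t" using exact_level_exists[OF assms(2)] by blast
  then have alg: "algebra X M" and lev: "lev X M \<alpha> \<nu>" and 1: "\<nu> X = 1"
    and sg: "\<And>\<beta> \<nu>'. \<beta> < \<alpha> \<Longrightarrow> lev X M \<beta> \<nu>' \<Longrightarrow> singular X M \<nu>' \<nu>"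
    and st: "\<And>\<beta> \<nu>'. lev X M \<beta> \<nu>' \<Longrightarrow> lev X M (osuc \<alpha>) \<nu>'"
    unfolding exact_level_def by blast+
  interpret algebra X M by (rule alg)
  interpret field_of_sets X M by unfold_locales
  have ch: "charge M \<nu>" by (rule charge_lev[OF alg lev])
  define \<mu> where "\<mu> = charge_measure \<nu>"
  have \<mu>: "\<mu> \<in> radon_prob K" unfolding \<mu>_def by (rule charge_measure_radon[OF ch 1])
  have \<mu>h: "measure \<mu> (h a) = \<nu> a" if "a \<in> M" for a
    unfolding \<mu>_def by (rule measure_charge_measure_hat[OF ch that])
  have iff: "\<mu> \<in> seq_level K (topspace K) \<beta> \<longleftrightarrow> lev X M \<beta> \<nu>" for \<beta>
    unfolding seq_level_iff_lev using \<mu> lev_cong[of X M \<beta> \<nu> "\<lambda>a. measure \<mu> (h a)"]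
      lev_cong[of X M \<beta> "\<lambda>a. measure \<mu> (h a)" \<nu>] \<mu>h by auto
  have not_lower: "\<not> lev X M \<beta> \<nu>" if "\<beta> < \<alpha>" for \<beta>
  proof
    assume "lev X M \<beta> \<nu>"
    then have "singular X M \<nu> \<nu>" by (rule sg[OF that])
    then obtain a where a: "a \<in> M" "\<nu> a < 1/2" "\<nu> (X - a) < 1/2"
      unfolding singular_def by (meson half_gt_zero zero_less_one)
    have "\<nu> X = \<nu> (X \<inter> a) + \<nu> (X - a)" by (rule charge_split[OF ch a(1) top])
    moreover have "X \<inter> a = a" using sets_into_space[OF a(1)] by auto
    ultimately show False using a 1 by simp
  qed
  have "osuc \<alpha> \<le> omega1" using assms(2) by (simp add: osuc_le_iff)
  then have "seq_closure K (topspace K) = seq_level K (topspace K) (osuc \<alpha>)"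
    unfolding seq_closure_def using st lev_mono by (auto simp: seq_level_iff_lev)
  then show ?thesis
    using lev not_lower
    by (intro exI[of _ K] exI[of _ \<mu>] conjI stone_space_stone \<mu>) (simp_all add: iff)
qed

end
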